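(* Let $\mathbb F=\mathbb R$ or $\mathbb C$. Every pair $(A,B)$ of $m\times n$ matrices over $\mathbb F$ is topologically equivalent to a direct sum \[(I_r,D)\oplus(M_1,N_1)\oplus\dots\oplus(M_t,N_t),\] in which $D$ is an $r\times r$ nonsingular matrix and each $(M_i,N_i)$ is one of the pairs $(I_k,J_k(0))$, $(J_k(0),I_k)$, $(L_k,R_k)$, $(L_k^T,R_k^T)$, $k\ge1$. Moreover, if $(A,B)$ is topologically equivalent to two such direct sums $(I_r,D)\oplus(M_1,N_1)\oplus\dots\oplus(M_t,N_t)$ and $(I_{r'},D')\oplus(M'_1,N'_1)\oplus\dots\oplus(M'_{t'},N'_{t'})$, then $r=r'$, $D$ and $D'$ are topologically similar, $t=t'$, and after a reindexing $(M_i,N_i)=(M'_i,N'_i)$ for all $i$.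
   Context: $J_k(0)$ denotes the $k\times k$ nilpotent Jordan block with ones directly below the diagonal and zeros elsewhere. $L_k$ and $R_k$ are the $(k-1)\times k$ matrices obtained from $I_k$ by deleting its last row, respectively its first row; in particular $L_1=R_1$ is the $0\times 1$ matrix (the matrix of the map $\mathbb F\to 0$) and $L_1^T=R_1^T$ is the $1\times 0$ matrix. The direct sum of matrix pairs is $(A,B)\oplus(A',B')=(A\oplus A',B\oplus B')$ with block-diagonal matrices. $\mathbb F^n$ carries its usual norm topology, and each matrix $A\in\mathbb F^{m\times n}$ is identified with the linear map $\mathbb F^n\to\mathbb F^m$, $v\mapsto Av$. Two pairs $(A,B)$ ($m\times n$) and $(A',B')$ ($m'\times n'$) are topologically equivalent if there exist homeomorphisms $\varphi:\mathbb F^n\to\mathbb F^{n'}$ and $\psi:\mathbb F^m\to\mathbb F^{m'}$ with $\psi A=A'\varphi$ and $\psi B=B'\varphi$. Two $r\times r$ matrices $D,D'$ are topologically similar if there is a homeomorphism $\varphi:\mathbb F^r\to\mathbb F^r$ with $\varphi D=D'\varphi$. *)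

theory Defs
  imports Complex_Main "Jordan_Normal_Form.Matrix" "Jordan_Normal_Form.Determinant"
begin

definition is_R_or_C :: "'a::real_normed_field itself \<Rightarrow> bool" where
  "is_R_or_C _ \<longleftrightarrow>
     (\<exists>h::'a \<Rightarrow> real. bij h \<and> (\<forall>x y. h (x + y) = h x + h y \<and> h (x * y) = h x * h y)
        \<and> (\<forall>x. norm (h x) = norm x)) \<or>
     (\<exists>h::'a \<Rightarrow> complex. bij h \<and> (\<forall>x y. h (x + y) = h x + h y \<and> h (x * y) = h x * h y)
        \<and> (\<forall>x. norm (h x) = norm x))"

definition vdist :: "'a::real_normed_field vec \<Rightarrow> 'a vec \<Rightarrow> real" where
  "vdist v w = sqrt (\<Sum>i<dim_vec v. (norm (v $ i - w $ i))\<^sup>2)"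

definition vcont :: "nat \<Rightarrow> ('a::real_normed_field vec \<Rightarrow> 'a vec) \<Rightarrow> bool" where
  "vcont n f \<longleftrightarrow> (\<forall>v\<in>carrier_vec n. \<forall>e>0. \<exists>d>0. \<forall>w\<in>carrier_vec n.
      vdist w v < d \<longrightarrow> vdist (f w) (f v) < e)"

definition vec_homeo :: "nat \<Rightarrow> nat \<Rightarrow> ('a::real_normed_field vec \<Rightarrow> 'a vec) \<Rightarrow> bool" where
  "vec_homeo n n' \<phi> \<longleftrightarrow> (\<exists>g. (\<forall>v\<in>carrier_vec n. \<phi> v \<in> carrier_vec n' \<and> g (\<phi> v) = v)
      \<and> (\<forall>w\<in>carrier_vec n'. g w \<in> carrier_vec n \<and> \<phi> (g w) = w)
      \<and> vcont n \<phi> \<and> vcont n' g)"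

definition top_equiv :: "'a::real_normed_field mat \<times> 'a mat \<Rightarrow> 'a mat \<times> 'a mat \<Rightarrow> bool" where
  "top_equiv P Q \<longleftrightarrow> (case P of (A, B) \<Rightarrow> case Q of (A', B') \<Rightarrow>
     (\<exists>\<phi> \<psi>. vec_homeo (dim_col A) (dim_col A') \<phi> \<and> vec_homeo (dim_row A) (dim_row A') \<psi> \<and>
        (\<forall>v\<in>carrier_vec (dim_col A). \<psi> (A *\<^sub>v v) = A' *\<^sub>v \<phi> v \<and> \<psi> (B *\<^sub>v v) = B' *\<^sub>v \<phi> v)))"

definition top_similar :: "'a::real_normed_field mat \<Rightarrow> 'a mat \<Rightarrow> bool" where
  "top_similar D D' \<longleftrightarrow> (\<exists>\<phi>. vec_homeo (dim_row D) (dim_row D') \<phi> \<and>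
     (\<forall>v\<in>carrier_vec (dim_row D). \<phi> (D *\<^sub>v v) = D' *\<^sub>v \<phi> v))"

definition Jzero :: "nat \<Rightarrow> 'a::{zero,one} mat" where
  "Jzero k = mat k k (\<lambda>(i, j). if i = j + 1 then 1 else 0)"

text \<open>L_k: I_k without its last row; R_k: I_k without its first row.\<close>
definition Lmat :: "nat \<Rightarrow> 'a::{zero,one} mat" where
  "Lmat k = mat (k - 1) k (\<lambda>(i, j). if j = i then 1 else 0)"

definition Rmat :: "nat \<Rightarrow> 'a::{zero,one} mat" where
  "Rmat k = mat (k - 1) k (\<lambda>(i, j). if j = i + 1 then 1 else 0)"

datatype block = IJ nat | JI nat | LR nat | LRT nat

fun block_size :: "block \<Rightarrow> nat" where
  "block_size (IJ k) = k" | "block_size (JI k) = k" | "block_size (LR k) = k" | "block_size (LRT k) = k"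

fun block_pair :: "block \<Rightarrow> 'a::{zero,one} mat \<times> 'a mat" where
  "block_pair (IJ k) = (1\<^sub>m k, Jzero k)"
| "block_pair (JI k) = (Jzero k, 1\<^sub>m k)"
| "block_pair (LR k) = (Lmat k, Rmat k)"
| "block_pair (LRT k) = (transpose_mat (Lmat k), transpose_mat (Rmat k))"

definition mat_dsum :: "'a::zero mat \<Rightarrow> 'a mat \<Rightarrow> 'a mat" where
  "mat_dsum A A' = four_block_mat A (0\<^sub>m (dim_row A) (dim_col A')) (0\<^sub>m (dim_row A') (dim_col A)) A'"

definition pair_dsum :: "'a::zero mat \<times> 'a mat \<Rightarrow> 'a mat \<times> 'a mat \<Rightarrow> 'a mat \<times> 'a mat" where
  "pair_dsum P Q = (mat_dsum (fst P) (fst Q), mat_dsum (snd P) (snd Q))"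

definition canon :: "'a::{zero,one} mat \<Rightarrow> block list \<Rightarrow> 'a mat \<times> 'a mat" where
  "canon D bs = foldl pair_dsum (1\<^sub>m (dim_row D), D) (map block_pair bs)"

definition canon_ok :: "'a::comm_ring_1 mat \<Rightarrow> block list \<Rightarrow> bool" where
  "canon_ok D bs \<longleftrightarrow> D \<in> carrier_mat (dim_row D) (dim_row D) \<and> det D \<noteq> 0 \<and>
     (\<forall>b\<in>set bs. block_size b \<ge> 1)"

end

theory Submission
  imports Defs "HOL-Homology.Invariance_of_Domain" "HOL-Library.Function_Algebras"
begin

text \<open>
  Existence. View \<open>(A, B)\<close> as two linear maps \<open>U \<rightarrow> V\<close>. Up to a regular part, one finds bases on which
  both maps act as partial injections. If \<open>A U \<noteq> V\<close>, restrict to \<open>B\<^sup>-\<^sup>1 (A U) \<rightarrow> A U\<close> and extend a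
  basis found there; if \<open>A\<close> is onto with kernel \<open>N \<noteq> 0\<close>, pass to \<open>U / N \<rightarrow> V / B N\<close> and lift;
  the remaining cases follow by exchanging \<open>A\<close> and \<open>B\<close>, or \<open>A\<close> and \<open>B\<close> are bijective. Two partial
  injections decompose into paths, which are the singular and nilpotent blocks, and cycles, which
  belong to the regular part.

  Uniqueness. After a translation the homeomorphisms fix 0, so they preserve chains
  \<open>A u\<^sub>k\<^sub>+\<^sub>1 = B u\<^sub>k\<close>. The sets of endpoints of chains of length \<open>i\<close> that start, or end, at 0, or start
  anywhere, are subspaces whose dimensions are topological invariants and determine the number of
  blocks of each kind. A long chain forgets all but the regular component of its starting point;
  therefore the homeomorphism descends to the regular parts.
\<close>

text \<open>The algebraic obstacle is that one basis has to suit both maps. In the range step the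
  new source vectors have images under \<open>B\<close> that are independent modulo the image of
  \<open>A\<close>, so nothing ties them to the old basis of the target. In the quotient step a lift
  can be corrected by kernel vectors of \<open>A\<close>, which changes \<open>B\<close> but not
  \<open>A\<close>. Subspaces and projections of a single ambient type stand in for varying spaces
  and quotients, so that the induction never changes type.

  The homeomorphisms are not linear: an invariant may only use 0 and the relation
  \<open>A v = B u\<close>. This relation is preserved in both directions because
  \<open>\<psi>\<close> is injective; beyond that \<open>\<psi>\<close> only fixes the number of
  rows. That number is needed for the 1 x 0 block \<open>LRT 1\<close>, which has no source vectors
  and is invisible to chains. In canonical forms the invariant sets used are coordinate subspaces,
  so comparing their dimensions reduces, after passing to real coordinates, to invariance of
  dimension for Euclidean spaces.\<close>

unbundle no vec_syntax
hide_type (open) Finite_Cartesian_Product.vec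
hide_const (open) Finite_Cartesian_Product.vec Finite_Cartesian_Product.mat

section \<open>Bases adapted to a pencil\<close>

locale pencil_space = vector_space scale
  for scale :: "'a::field \<Rightarrow> 'b::ab_group_add \<Rightarrow> 'b"
begin

definition basis_of :: "'b set \<Rightarrow> 'b set \<Rightarrow> bool" where
  "basis_of V B \<longleftrightarrow> finite B \<and> independent B \<and> span B = V"

text \<open>The strict bound for a proper subspace is the source of the decrease in the induction of
  \<open>kronecker_basis_exists\<close>.\<close>

lemma basis_of_subspace:
  assumes "basis_of V T" "subspace W" "W \<subseteq> V" "Z \<subseteq> W" "independent Z"
  obtains B where "Z \<subseteq> B" "basis_of W B" "card B \<le> card T" "W \<noteq> V \<Longrightarrow> card B < card T"
proof -
  have T: "finite T" "independent T" "span T = V" using assms by (auto simp: basis_of_def)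
  obtain B where B: "Z \<subseteq> B" "B \<subseteq> W" "independent B" "W \<subseteq> span B"
    using maximal_independent_subset_extend[OF assms(4,5)] by metis
  have sB: "span B = W" using B assms(2) by (simp add: span_subspace)
  have BT: "finite B" "card B \<le> card T"
    using independent_span_bound[OF T(1) B(3)] B(2) assms(3) T(3) by auto
  have "card B < card T" if ne: "W \<noteq> V"
  proof -
    obtain v where v: "v \<in> V" "v \<notin> W" using ne assms(3) by blast
    have "independent (insert v B)" using v B sB by (intro independent_insertI) auto
    then have "card (insert v B) \<le> card T"
      using independent_span_bound[OF T(1)] B(2) assms(3) T(3) v by auto
    moreover have "v \<notin> B" using v B by auto
    ultimately show ?thesis using BT by simp
  qed
  with B BT sB that show ?thesis by (auto simp: basis_of_def)
qed

lemma basis_of_subspace_exists: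
  assumes "basis_of V T" "subspace W" "W \<subseteq> V"
  obtains B where "basis_of W B" "card B \<le> card T" "W \<noteq> V \<Longrightarrow> card B < card T"
  using basis_of_subspace[OF assms, of "{}"] independent_empty by (metis empty_subsetI)

lemma basis_of_card_eq:
  assumes "basis_of V B" "basis_of V C"
  shows "card B = card C"
  using assms independent_span_bound[of B C] independent_span_bound[of C B] span_superset
  unfolding basis_of_def by (metis antisym)

lemma independent_of_image:
  assumes "Vector_Spaces.linear scale scale f" "inj_on f T" "independent (f ` T)"
  shows "independent T"
proof
  interpret f: Vector_Spaces.linear scale scale f by fact
  assume "dependent T"
  then obtain v where v: "v \<in> T" "v \<in> span (T - {v})" by (auto simp: dependent_def)
  then have "f v \<in> span (f ` (T - {v}))" by (simp add: f.span_image)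
  also have "f ` (T - {v}) = f ` T - {f v}" using assms(2) v by (auto simp: inj_on_def)
  finally show False using assms(3) v by (auto simp: dependent_def)
qed

lemma independent_Un_disjoint_span:
  assumes "finite B" "independent A" "independent B" "span A \<inter> span B \<subseteq> {0}"
  shows "independent (A \<union> B)"
  using assms
proof (induction B rule: finite_induct)
  case (insert b B)
  have iB: "independent B" "b \<notin> span B"
    using insert.prems(2) insert.hyps by (auto simp: independent_insert)
  have ss: "span B \<subseteq> span (insert b B)" by (rule span_mono) auto
  have "b \<notin> span (A \<union> B)"
  proof
    assume "b \<in> span (A \<union> B)"
    then obtain x y where xy: "b = x + y" "x \<in> span A" "y \<in> span B" by (auto simp: span_Un)
    have "b \<in> span (insert b B)" by (simp add: span_base)
    then have "b - y \<in> span (insert b B)" using xy ss by (blast intro: span_diff)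
    then have "x \<in> span (insert b B)" using xy by simp
    then have "x = 0" using xy insert.prems by auto
    then show False using xy iB by simp
  qed
  moreover have "independent (A \<union> B)" using insert ss iB by blast
  ultimately show ?case by (simp add: independent_insertI)
qed simp

text \<open>The representation of \<open>x\<close> over \<open>C\<close> is supported in
  \<open>A\<close> as well as in \<open>B\<close>, hence nowhere.\<close>

lemma span_Int_disjoint_independent:
  assumes "finite C" "independent C" "A \<subseteq> C" "B \<subseteq> C" "A \<inter> B = {}" "x \<in> span A" "x \<in> span B"
  shows "x = 0"
proof -
  have r: "representation C x = representation A x" "representation C x = representation B x"
    using assms representation_extend by metis+
  have "representation C x b = 0" for b
    using r representation_ne_zero[of A x b] representation_ne_zero[of B x b] assms(5) by (metis disjoint_iff)
  then have "(\<Sum>b | representation C x b \<noteq> 0. scale (representation C x b) b) = 0" by simp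
  then show ?thesis using assms sum_nonzero_representation_eq[of C x]
    by (metis span_mono subsetD)
qed

text \<open>Rank-nullity at the level of bases: lifts of a basis of the image complete a basis of
  the kernel. An independent image together with injectivity on \<open>X\<close> makes
  \<open>f\<close> injective on \<open>span X\<close>, so the spans of \<open>Z\<close> and
  \<open>X\<close> meet only in 0.\<close>

lemma basis_of_kernel_extend:
  assumes lf: "Vector_Spaces.linear scale scale f" and S: "subspace S"
    and Z: "basis_of {s \<in> S. f s = 0} Z"
    and X: "finite X" "X \<subseteq> S" "inj_on f X" "independent (f ` X)" "f ` S \<subseteq> span (f ` X)"
  shows "Z \<inter> X = {}" "basis_of S (Z \<union> X)"
proof -
  interpret f: Vector_Spaces.linear scale scale f by fact
  have Z': "finite Z" "independent Z" "span Z = {s \<in> S. f s = 0}" using Z by (auto simp: basis_of_def)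
  have zS: "z \<in> S \<and> f z = 0" if "z \<in> Z" for z using that Z'(3) span_base by blast
  have inj: "inj_on f (span X)" using f.inj_on_span_independent_image X by blast
  show "Z \<inter> X = {}"
    using zS X(4) dependent_zero by (metis disjoint_iff imageI)
  have "span Z \<inter> span X \<subseteq> {0}"
    using inj Z'(3) by (auto simp: f.inj_on_iff_eq_0[OF subspace_span])
  then have ind: "independent (Z \<union> X)"
    using independent_Un_disjoint_span X(1) Z'(2) independent_of_image[OF lf X(3,4)] by blast
  have "S \<subseteq> span (Z \<union> X)"
  proof
    fix s assume s: "s \<in> S"
    then have "f s \<in> f ` span X" using X(5) by (auto simp: f.span_image)
    then obtain x where x: "x \<in> span X" "f s = f x" by auto
    have "x \<in> S" using x X(2) S span_minimal by blast
    then have "s - x \<in> span Z" using Z'(3) s x S by (auto simp: f.diff subspace_diff)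
    then show "s \<in> span (Z \<union> X)" using x by (auto simp: span_Un) (metis diff_add_cancel)
  qed
  moreover have "span (Z \<union> X) \<subseteq> S" using zS X(2) S by (intro span_minimal) auto
  ultimately show "basis_of S (Z \<union> X)" using Z' X ind by (auto simp: basis_of_def)
qed

text \<open>With \<open>f\<close> a projection, this enlarges a family that is independent modulo
  the kernel by vectors from a prescribed set \<open>G\<close>. One preimage is picked per new image
  vector, which keeps \<open>f\<close> injective.\<close>

lemma lift_independent_extension:
  assumes "inj_on f K" "independent (f ` K)"
  obtains Z where "Z \<subseteq> G" "K \<inter> Z = {}" "inj_on f (K \<union> Z)" "independent (f ` (K \<union> Z))"
    "f ` G \<subseteq> span (f ` (K \<union> Z))"
proof -
  obtain B where B: "f ` K \<subseteq> B" "B \<subseteq> f ` K \<union> f ` G" "independent B" "f ` K \<union> f ` G \<subseteq> span B"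
    using maximal_independent_subset_extend[of "f ` K" "f ` K \<union> f ` G"] assms by blast
  define Z where "Z = inv_into G f ` (B - f ` K)"
  have h: "b \<in> f ` G" if "b \<in> B - f ` K" for b using that B by auto
  have fZ: "f ` Z = B - f ` K" using h by (force simp: Z_def f_inv_into_f image_image)
  have ZG: "Z \<subseteq> G" using h by (auto simp: Z_def inv_into_into)
  have iZ: "inj_on f Z" using h by (auto simp: Z_def inj_on_def f_inv_into_f)
  have fKZ: "f ` (K \<union> Z) = B" using fZ B by auto
  have d: "f ` K \<inter> f ` Z = {}" using fZ by auto
  then have "K \<inter> Z = {}" by auto
  moreover have "inj_on f (K \<union> Z)" using iZ assms d by (auto simp: inj_on_Un)
  ultimately show ?thesis using that ZG fKZ B by auto
qed

text \<open>On \<open>V\<close> the map \<open>p\<close> is a model of the quotient map to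
  \<open>V / M\<close>, with its image as the quotient. It kills a basis of \<open>M\<close> and
  fixes the vectors that extend it to a basis of \<open>V\<close>.\<close>

lemma projection_along:
  assumes "basis_of V T" "subspace M" "M \<subseteq> V"
  obtains p where "Vector_Spaces.linear scale scale p" "\<And>v. v \<in> V \<Longrightarrow> v - p v \<in> M" "\<And>v. v \<in> M \<Longrightarrow> p v = 0"
proof -
  interpret vector_space_pair scale scale by unfold_locales
  obtain Z where Z: "basis_of M Z"
    using basis_of_subspace_exists[OF assms] by metis
  obtain B where B: "Z \<subseteq> B" "basis_of V B"
    using basis_of_subspace[of V T V Z] assms Z unfolding basis_of_def by (metis subset_refl subspace_span span_superset order_trans)
  obtain p where p: "Vector_Spaces.linear scale scale p" "\<And>x. x \<in> B \<Longrightarrow> p x = (if x \<in> Z then 0 else x)"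
    using linear_independent_extend[of B "\<lambda>x. if x \<in> Z then 0 else x"] B by (auto simp: basis_of_def)
  interpret p: Vector_Spaces.linear scale scale p by fact
  have "v - p v \<in> M" if "v \<in> V" for v
  proof -
    have "v \<in> span B" using that B by (auto simp: basis_of_def)
    then show ?thesis
    proof (induction rule: span_induct_alt)
      case base show ?case using assms by (simp add: subspace_0)
    next
      case (step c x y)
      have "x - p x \<in> M" using step p(2)[of x] Z assms(2) by (auto simp: basis_of_def span_base subspace_0)
      then have "scale c (x - p x) + (y - p y) \<in> M"
        using step assms(2) by (intro subspace_add subspace_scale) auto
      then show ?case by (simp add: p.add p.scale algebra_simps scale_right_diff_distrib)
    qed
  qed
  moreover have "p v = 0" if "v \<in> M" for v
  proof (rule p.eq_0_on_span[of Z])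
    show "p x = 0" if "x \<in> Z" for x using p(2)[of x] B that by auto
    show "v \<in> span Z" using \<open>v \<in> M\<close> Z by (simp add: basis_of_def)
  qed
  ultimately show ?thesis using that p by blast
qed

end

section \<open>Adapted bases and their extension beyond the range of \<open>A\<close>\<close>

context pencil_space
begin

text \<open>\<open>R\<close> belongs to the regular part: \<open>B\<close> is injective on it and
  stays in the span of its image under \<open>A\<close>, so \<open>B\<close> will be described there
  by a nonsingular matrix. On \<open>X\<close> both maps send basis vectors to basis vectors in
  \<open>Y\<close> or to 0, injectively where nonzero, which gives a graph of paths and cycles.
  Cycles are tolerated at this stage.\<close>

definition kronecker_basis :: "('b \<Rightarrow> 'b) \<Rightarrow> ('b \<Rightarrow> 'b) \<Rightarrow> 'b set \<Rightarrow> 'b set \<Rightarrow> 'b set \<Rightarrow> 'b set \<Rightarrow> 'b set \<Rightarrow> bool" where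
  "kronecker_basis A B U V R X Y \<longleftrightarrow>
     R \<inter> X = {} \<and> basis_of U (R \<union> X) \<and>
     A ` R \<inter> Y = {} \<and> basis_of V (A ` R \<union> Y) \<and> inj_on A R \<and>
     inj_on B R \<and> independent (B ` R) \<and> B ` R \<subseteq> span (A ` R) \<and>
     A ` X \<subseteq> insert 0 Y \<and> B ` X \<subseteq> insert 0 Y \<and>
     inj_on A {x \<in> X. A x \<noteq> 0} \<and> inj_on B {x \<in> X. B x \<noteq> 0}"

lemma span_eq_of_card_le:
  assumes "finite T" "independent S" "S \<subseteq> span T" "card T \<le> card S"
  shows "span S = span T"
proof -
  have S: "finite S" "card S \<le> card T" using independent_span_bound assms by blast+
  have "T \<subseteq> span S"
  proof
    fix t assume t: "t \<in> T"
    show "t \<in> span S"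
    proof (rule ccontr)
      assume n: "t \<notin> span S"
      then have "independent (insert t S)" using assms by (simp add: independent_insertI)
      then have "card (insert t S) \<le> card T"
        using independent_span_bound[OF assms(1)] assms(3) t by (simp add: span_base)
      moreover have "t \<notin> S" using n span_base by blast
      ultimately show False using S assms(4) by simp
    qed
  qed
  then show ?thesis using assms(3) by (simp add: span_eq)
qed

text \<open>The definition favours \<open>A\<close> on \<open>R\<close>. Both images of
  \<open>R\<close> have as many elements as \<open>R\<close>, so the independent image under
  \<open>B\<close> spans the same space as the image under \<open>A\<close> and may replace it in
  the basis of \<open>V\<close>.\<close>

lemma kronecker_basis_swap:
  assumes k: "kronecker_basis A B U V R X Y"
  shows "kronecker_basis B A U V R X Y"
proof -
  have f: "finite (A ` R \<union> Y)" "independent (A ` R \<union> Y)" "span (A ` R \<union> Y) = V" "finite R"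
    "A ` R \<inter> Y = {}" "inj_on A R" "inj_on B R" "independent (B ` R)" "B ` R \<subseteq> span (A ` R)"
    using k by (auto simp: kronecker_basis_def basis_of_def)
  have s: "span (B ` R) = span (A ` R)"
    using f by (intro span_eq_of_card_le) (auto simp: card_image)
  have d: "span Y \<inter> span (A ` R) \<subseteq> {0}"
    using span_Int_disjoint_independent[OF f(1,2), of Y "A ` R"] f by auto
  have "independent (Y \<union> B ` R)"
    using f d s independent_mono[OF f(2), of Y] by (intro independent_Un_disjoint_span) auto
  moreover have "span (B ` R \<union> Y) = V" using f(3) s by (simp add: span_Un)
  moreover have "B ` R \<inter> Y = {}"
  proof -
    have "x = 0" if "x \<in> B ` R" "x \<in> Y" for x
      using that d s span_base[of x "B ` R"] span_base[of x Y] by auto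
    moreover have "0 \<notin> B ` R" using f(8) dependent_zero by blast
    ultimately show ?thesis by (metis disjoint_iff)
  qed
  moreover have "independent (A ` R)" using f(2) independent_mono by blast
  moreover have "A ` R \<subseteq> span (B ` R)" using s span_superset by simp
  ultimately show ?thesis
    using k by (simp add: kronecker_basis_def basis_of_def Un_commute)
qed

text \<open>Modulo the smaller source, \<open>U\<close> is spanned by two kinds of vectors:
  \<open>K\<close>, with one preimage under \<open>A\<close> for each vector of \<open>Y\<close>
  that \<open>A\<close> does not hit from \<open>X\<close>, and \<open>Z\<close>, taken from the
  kernel of \<open>A\<close>. Their images under \<open>B\<close> are independent modulo the image
  of \<open>A\<close> and become new basis vectors of \<open>V\<close>, so both partial injections
  extend.\<close>

lemma kronecker_basis_extend_range:
  assumes A: "Vector_Spaces.linear scale scale A" and B: "Vector_Spaces.linear scale scale B"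
    and U: "basis_of U BU" and V: "basis_of V BV" and BV: "B ` U \<subseteq> V" and AV: "A ` U \<subseteq> V"
    and k: "kronecker_basis A B {u \<in> U. B u \<in> A ` U} (A ` U) R X Y"
  shows "\<exists>X' Y'. kronecker_basis A B U V R X' Y'"
proof -
  interpret A: Vector_Spaces.linear scale scale A by fact
  interpret B: Vector_Spaces.linear scale scale B by fact
  have sU: "subspace U" and sV: "subspace V" using U V by (auto simp: basis_of_def)
  have sAU: "subspace (A ` U)" using sU by (rule A.subspace_image)
  obtain p where p: "Vector_Spaces.linear scale scale p" "\<And>v. v \<in> V \<Longrightarrow> v - p v \<in> A ` U"
      "\<And>v. v \<in> A ` U \<Longrightarrow> p v = 0"
    using projection_along[OF V sAU AV] by metis
  interpret p: Vector_Spaces.linear scale scale p by fact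
  have p0: "p v = 0 \<longleftrightarrow> v \<in> A ` U" if "v \<in> V" for v using p(2,3) that by force
  define f where "f = p \<circ> B"
  have f: "Vector_Spaces.linear scale scale f"
    unfolding f_def using B p(1) by (rule Vector_Spaces.linear_compose)
  interpret f: Vector_Spaces.linear scale scale f by fact
  have ker: "{u \<in> U. B u \<in> A ` U} = {u \<in> U. f u = 0}" using p0 BV by (auto simp: f_def)
  have kd: "R \<inter> X = {}" "A ` R \<inter> Y = {}" and kAX: "A ` X \<subseteq> insert 0 Y" and kBX: "B ` X \<subseteq> insert 0 Y"
    and kA: "inj_on A {x \<in> X. A x \<noteq> 0}" and kB: "inj_on B {x \<in> X. B x \<noteq> 0}" 
    and kR: "inj_on A R" "inj_on B R" "independent (B ` R)" "B ` R \<subseteq> span (A ` R)"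
    using k by (auto simp: kronecker_basis_def)
  have bU1: "basis_of {u \<in> U. f u = 0} (R \<union> X)" and bV1: "basis_of (A ` U) (A ` R \<union> Y)" using k ker by (auto simp: kronecker_basis_def)
  have RXU: "R \<union> X \<subseteq> U" using bU1 span_superset unfolding basis_of_def by blast
  have iV1: "finite (A ` R \<union> Y)" "independent (A ` R \<union> Y)" "span (A ` R \<union> Y) = A ` U"
    using bV1 by (auto simp: basis_of_def)
  have Ynz: "0 \<notin> Y" using iV1(2) dependent_zero by blast
  define Y0 where "Y0 = Y - A ` X"
  define g where "g = inv_into U A"
  have gY: "g y \<in> U \<and> A (g y) = y" if "y \<in> Y" for y
    using that iV1(3) span_base[of y "A ` R \<union> Y"] by (auto simp: g_def inv_into_into f_inv_into_f)
  define K where "K = g ` Y0"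
  have fK: "finite K" using iV1 by (auto simp: K_def Y0_def)
  have KU: "K \<subseteq> U" using gY by (auto simp: K_def Y0_def)
  have AK: "A ` K = Y0" using gY by (force simp: K_def Y0_def)
  have injAK: "inj_on A K" using gY by (auto simp: K_def Y0_def inj_on_def)
  have spU: "span K \<subseteq> U" using KU sU by (rule span_minimal)
  have injA: "inj_on A (span K)"
    using injAK AK independent_mono[OF iV1(2), of Y0]
    by (intro A.inj_on_span_independent_image) (auto simp: Y0_def)
  \<comment> \<open>If \<open>f u = 0\<close>, then \<open>u\<close> lies in the old source, so
    \<open>A u\<close> is a combination of target basis vectors outside \<open>Y0\<close>. It is
    also a combination of \<open>Y0\<close>, hence 0.\<close>
  have injfspan: "inj_on f (span K)"
    unfolding f.inj_on_iff_eq_0[OF subspace_span]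
  proof (intro ballI impI)
    fix u assume u: "u \<in> span K" "f u = 0"
    then have "u \<in> span (R \<union> X)" using bU1 spU by (auto simp: basis_of_def)
    then have "A u \<in> span (A ` (R \<union> X))" by (simp add: A.span_image)
    also have "\<dots> \<subseteq> span (insert 0 (A ` R \<union> (Y - Y0)))"
      using kAX by (intro span_mono) (auto simp: Y0_def)
    finally have 1: "A u \<in> span (A ` R \<union> (Y - Y0))" by simp
    have 2: "A u \<in> span Y0" using u AK by (auto simp: A.span_image)
    have "A u = 0"
      by (rule span_Int_disjoint_independent[OF iV1(1,2) _ _ _ 1 2]) (use kd(2) in \<open>auto simp: Y0_def\<close>)
    then show "u = 0" using injA u by (simp add: A.inj_on_iff_eq_0[OF subspace_span])
  qed
  have injfK: "inj_on f K" using injfspan span_superset by (rule inj_on_subset)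
  have indfK: "independent (f ` K)"
    using injfspan independent_of_image[OF A injAK] AK independent_mono[OF iV1(2), of Y0]
    by (intro f.independent_injective_image) (auto simp: Y0_def)
  obtain Z where Z: "Z \<subseteq> {u \<in> U. A u = 0}" "K \<inter> Z = {}" "inj_on f (K \<union> Z)" "independent (f ` (K \<union> Z))"
      "f ` {u \<in> U. A u = 0} \<subseteq> span (f ` (K \<union> Z))"
    using lift_independent_extension[OF injfK indfK, of "{u \<in> U. A u = 0}"] .
  have KZU: "K \<union> Z \<subseteq> U" using KU Z by auto
  \<comment> \<open>\<open>A\<close> maps \<open>R\<close>, \<open>X\<close> and \<open>K\<close>
    together to a family spanning its image. So every \<open>u\<close> is a combination of
    \<open>R\<close> and \<open>X\<close>, on which \<open>f\<close> vanishes, plus a vector of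
    \<open>span K\<close>, plus one in the kernel of \<open>A\<close>.\<close>
  have fspan: "f ` U \<subseteq> span (f ` (K \<union> Z))"
  proof safe
    fix u assume u: "u \<in> U"
    have "A ` R \<union> Y \<subseteq> insert 0 (A ` (R \<union> X) \<union> A ` K)" using AK by (auto simp: Y0_def)
    then have "span (A ` R \<union> Y) \<subseteq> span (insert 0 (A ` ((R \<union> X) \<union> K)))" by (intro span_mono) auto
    then have "A u \<in> A ` span ((R \<union> X) \<union> K)" using u iV1 by (auto simp: A.span_image)
    then obtain x y where xy: "A u = A (x + y)" "x \<in> span (R \<union> X)" "y \<in> span K" by (auto simp: span_Un[of "R \<union> X"])
    have x: "x \<in> U" "f x = 0" using xy(2) bU1 by (auto simp: basis_of_def)
    have yU: "y \<in> U" using xy spU by blast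
    have "u - (x + y) \<in> {u \<in> U. A u = 0}"
      using xy u x yU sU by (auto simp: A.diff subspace_diff subspace_add)
    then have 1: "f (u - (x + y)) \<in> span (f ` (K \<union> Z))" using Z(5) by blast
    have "f y \<in> span (f ` K)" using xy by (auto simp: f.span_image)
    then have 2: "f y \<in> span (f ` (K \<union> Z))" using span_mono[of "f ` K" "f ` (K \<union> Z)"] by auto
    have "f u = f (u - (x + y)) + f y" using x by (simp add: f.diff f.add)
    then show "f u \<in> span (f ` (K \<union> Z))" using span_add[OF 1 2] by simp
  qed
  have finKZ: "finite (K \<union> Z)"
  proof -
    have "K \<union> Z \<subseteq> span BU" "independent (K \<union> Z)" "finite BU"
      using KZU U independent_of_image[OF f Z(3,4)] by (auto simp: basis_of_def)
    then show ?thesis using independent_span_bound by blast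
  qed
  note eU = basis_of_kernel_extend[OF f sU bU1 finKZ KZU Z(3,4) fspan]
  have img: "p ` B ` T = f ` T" for T by (auto simp: f_def)
  have injB: "inj_on B (K \<union> Z)" using Z(3) unfolding f_def by (rule inj_on_imageI2)
  have "inj_on p (B ` (K \<union> Z))" using Z(3) unfolding f_def by (rule inj_on_imageI)
  \<comment> \<open>The vectors of \<open>C\<close> complete the basis of \<open>V\<close> and are
    hit by neither map at this stage; an enclosing range step may still choose preimages under
    \<open>A\<close> for them.\<close>
  then obtain C where C: "C \<subseteq> V" "B ` (K \<union> Z) \<inter> C = {}" "inj_on p (B ` (K \<union> Z) \<union> C)"
      "independent (p ` (B ` (K \<union> Z) \<union> C))" "p ` V \<subseteq> span (p ` (B ` (K \<union> Z) \<union> C))"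
    using lift_independent_extension[of p "B ` (K \<union> Z)" V] Z(4) img by metis
  have CV: "B ` (K \<union> Z) \<union> C \<subseteq> V" using C(1) BV KZU by blast
  have finC: "finite (B ` (K \<union> Z) \<union> C)"
  proof -
    have "B ` (K \<union> Z) \<union> C \<subseteq> span BV" "independent (B ` (K \<union> Z) \<union> C)" "finite BV"
      using CV V independent_of_image[OF p(1) C(3,4)] by (auto simp: basis_of_def)
    then show ?thesis using independent_span_bound by blast
  qed
  have "{v \<in> V. p v = 0} = A ` U" using p0 AV by auto
  then have bV1': "basis_of {v \<in> V. p v = 0} (A ` R \<union> Y)" using bV1 by simp
  note eV = basis_of_kernel_extend[OF p(1) sV bV1' finC CV C(3-5)]
  let ?X = "X \<union> (K \<union> Z)" and ?Y = "Y \<union> (B ` (K \<union> Z) \<union> C)"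
  have "kronecker_basis A B U V R ?X ?Y"
    unfolding kronecker_basis_def
  proof (intro conjI)
    show "R \<inter> ?X = {}" using kd(1) eU(1) by blast
    show "basis_of U (R \<union> ?X)" using eU(2) by (simp add: Un_assoc)
    show "A ` R \<inter> ?Y = {}" using kd(2) eV(1) by blast
    show "basis_of V (A ` R \<union> ?Y)" using eV(2) by (simp add: Un_assoc)
    show "A ` ?X \<subseteq> insert 0 ?Y" using kAX AK Z(1) by (auto simp: Y0_def)
    show "B ` ?X \<subseteq> insert 0 ?Y" using kBX by auto
    have "{x \<in> ?X. A x \<noteq> 0} \<subseteq> {x \<in> X. A x \<noteq> 0} \<union> K" using Z(1) by auto
    moreover have "inj_on A ({x \<in> X. A x \<noteq> 0} \<union> K)"
      using kA injAK AK Ynz by (auto simp: inj_on_Un Y0_def)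
    ultimately show "inj_on A {x \<in> ?X. A x \<noteq> 0}" using inj_on_subset by blast
    have "{x \<in> ?X. B x \<noteq> 0} \<subseteq> {x \<in> X. B x \<noteq> 0} \<union> (K \<union> Z)" by auto
    moreover have "B ` (K \<union> Z) \<inter> Y = {}" using eV(1) by blast
    then have "B ` {x \<in> X. B x \<noteq> 0} \<inter> B ` (K \<union> Z) = {}" using kBX by fastforce
    then have "inj_on B ({x \<in> X. B x \<noteq> 0} \<union> (K \<union> Z))"
      using kB injB unfolding inj_on_Un[of B "{x \<in> X. B x \<noteq> 0}"] by blast
    ultimately show "inj_on B {x \<in> ?X. B x \<noteq> 0}" using inj_on_subset by blast
  qed (use kR in auto)
  then show ?thesis by blast
qed

end

section \<open>Lifting from the quotient, and the induction\<close>

context pencil_space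
begin

text \<open>All freedom lies in the kernel \<open>N\<close> of \<open>A\<close>: changing a lift
  \<open>g z\<close> by \<open>N\<close> leaves \<open>A (g z)\<close> fixed, while
  \<open>B (g z)\<close> runs through a whole coset of the image of \<open>N\<close> under
  \<open>B\<close>. Therefore \<open>A\<close> dictates the lift \<open>l\<close> of the target
  basis, and the source vectors are then corrected so that \<open>B\<close> hits these lifts
  exactly.\<close>

lemma kronecker_basis_lift_quotient:
  assumes A: "Vector_Spaces.linear scale scale A" and B: "Vector_Spaces.linear scale scale B"
    and U: "basis_of U BU" and V: "basis_of V BV" and BV: "B ` U \<subseteq> V" and AV: "A ` U = V"
    and N: "N = {u \<in> U. A u = 0}"
    and p: "Vector_Spaces.linear scale scale p" "\<And>v. v \<in> V \<Longrightarrow> v - p v \<in> B ` N" "\<And>v. v \<in> B ` N \<Longrightarrow> p v = 0"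
    and t: "Vector_Spaces.linear scale scale t" "\<And>u. u \<in> U \<Longrightarrow> u - t u \<in> N" "\<And>u. u \<in> N \<Longrightarrow> t u = 0"
    and k: "kronecker_basis (p \<circ> A) (p \<circ> B) (t ` U) (p ` V) R X Y"
  shows "\<exists>R' X' Y'. kronecker_basis A B U V R' X' Y'"
proof -
  interpret A: Vector_Spaces.linear scale scale A by fact
  interpret B: Vector_Spaces.linear scale scale B by fact
  interpret p: Vector_Spaces.linear scale scale p by fact
  interpret t: Vector_Spaces.linear scale scale t by fact
  have sU: "subspace U" and sV: "subspace V" using U V by (auto simp: basis_of_def)
  have sN: "subspace N"
    unfolding N using subspace_inter[OF sU A.subspace_kernel] by (simp add: Int_def)
  define M where "M = B ` N"
  have sM: "subspace M" unfolding M_def using sN by (rule B.subspace_image)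
  have NU: "N \<subseteq> U" using N by auto
  have MV: "M \<subseteq> V" using BV NU by (auto simp: M_def)
  have pM: "p v = 0 \<longleftrightarrow> v \<in> M" if "v \<in> V" for v using p(2,3) that by (force simp: M_def)
  have pV: "p v \<in> V" if "v \<in> V" for v
    using subspace_diff[OF sV that, of "v - p v"] p(2)[OF that] MV by (auto simp: M_def)
  have pp: "p (p v) = p v" if "v \<in> V" for v
    using p(3)[OF p(2)[OF that]] by (simp add: p.diff)
  have tU: "t u \<in> U" if "u \<in> U" for u
    using subspace_diff[OF sU that, of "u - t u"] t(2)[OF that] NU by auto
  have At: "A (t u) = A u" if "u \<in> U" for u using t(2)[OF that] by (simp add: N A.diff)
  have kd: "R \<inter> X = {}" "(p \<circ> A) ` R \<inter> Y = {}"
    and kX: "(p \<circ> A) ` X \<subseteq> insert 0 Y" "(p \<circ> B) ` X \<subseteq> insert 0 Y"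
    and kA: "inj_on (p \<circ> A) {x \<in> X. (p \<circ> A) x \<noteq> 0}" and kB: "inj_on (p \<circ> B) {x \<in> X. (p \<circ> B) x \<noteq> 0}"
    and kR: "inj_on (p \<circ> A) R" "inj_on (p \<circ> B) R" "independent ((p \<circ> B) ` R)" "(p \<circ> B) ` R \<subseteq> span ((p \<circ> A) ` R)"
    and bU: "finite (R \<union> X)" "independent (R \<union> X)" "span (R \<union> X) = t ` U"
    and bV: "finite ((p \<circ> A) ` R \<union> Y)" "independent ((p \<circ> A) ` R \<union> Y)" "span ((p \<circ> A) ` R \<union> Y) = p ` V"
    using k by (auto simp: kronecker_basis_def basis_of_def)
  have RXU: "z \<in> U" if "z \<in> R \<union> X" for z using that bU(3) tU span_superset[of "R \<union> X"] by auto
  have "inj_on A (t ` U)"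
    using At t(3) N tU by (subst A.inj_on_iff_eq_0[OF t.subspace_image[OF sU]]) auto
  then have injA: "inj_on A (span (R \<union> X))" using bU by simp
  then have injA': "inj_on A (R \<union> X)" using span_superset by (rule inj_on_subset)
  have indA: "independent (A ` (R \<union> X))" using bU(2) injA by (rule A.independent_injective_image)
  have spA: "A ` U \<subseteq> span (A ` (R \<union> X))" 
  proof safe
    fix u assume "u \<in> U"
    then have "A u \<in> A ` t ` U" using At[of u] by (metis imageI)
    then show "A u \<in> span (A ` (R \<union> X))" using bU(3) by (simp add: A.span_image)
  qed
  have Y: "y \<in> V" "p y = y" "y \<noteq> 0" if "y \<in> Y" for y
  proof -
    have "y \<in> p ` V" using that bV(3) span_superset[of "(p \<circ> A) ` R \<union> Y"] by auto
    then show "y \<in> V" "p y = y" using pV pp by auto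
    show "y \<noteq> 0" using that bV(2) dependent_zero by blast
  qed
  define X1 where "X1 = {x \<in> X. p (A x) \<noteq> 0}"
  have injX1: "inj_on (p \<circ> A) X1" using kA by (simp add: X1_def)
  \<comment> \<open>If \<open>y\<close> is the class of some \<open>A x\<close> with
    \<open>x\<close> in \<open>X1\<close>, its lift has to be that \<open>A x\<close>, because
    \<open>A\<close> cannot be corrected. Any other \<open>y\<close> is its own representative, as
    \<open>p y = y\<close>.\<close>
  define l where "l y = (if y \<in> (p \<circ> A) ` X1 then A (inv_into X1 (p \<circ> A) y) else y)" for y
  have lA: "l (p (A x)) = A x" if "x \<in> X" "p (A x) \<noteq> 0" for x
  proof -
    have "x \<in> X1" using that by (simp add: X1_def)
    then show ?thesis using inv_into_f_f[OF injX1, of x] by (simp add: l_def)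
  qed
  have l: "l y \<in> V \<and> p (l y) = y" if "y \<in> Y" for y
  proof (cases "y \<in> (p \<circ> A) ` X1")
    case True
    then have "inv_into X1 (p \<circ> A) y \<in> X1" "p (A (inv_into X1 (p \<circ> A) y)) = y"
      using inv_into_into[OF True] f_inv_into_f[OF True] by auto
    then show ?thesis using True RXU AV by (auto simp: l_def X1_def)
  next
    case False then show ?thesis using Y[OF that] by (simp add: l_def)
  qed
  have BU': "B u \<in> V" if "u \<in> U" for u using BV that by blast
  \<comment> \<open>The value \<open>v\<close> prescribed for \<open>B\<close> agrees with
    \<open>B z\<close> modulo the image of \<open>N\<close> under \<open>B\<close>, so adding a
    suitable element of \<open>N\<close> to \<open>z\<close> attains it.\<close>
  have "\<exists>u. u \<in> U \<and> u - z \<in> N \<and> (z \<in> R \<longrightarrow> B u \<in> span (A ` R)) \<and>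
      (z \<in> X \<longrightarrow> B u = (if p (B z) = 0 then 0 else l (p (B z))))" if z: "z \<in> R \<union> X" for z
  proof -
    have "\<exists>v\<in>V. p v = p (B z) \<and> (z \<in> R \<longrightarrow> v \<in> span (A ` R)) \<and>
      (z \<in> X \<longrightarrow> v = (if p (B z) = 0 then 0 else l (p (B z))))"
    proof (cases "z \<in> R")
      case True
      then have "p (B z) \<in> span (p ` A ` R)" using kR(4) by (auto simp: image_comp)
      then obtain v where v: "v \<in> span (A ` R)" "p (B z) = p v" by (auto simp: p.span_image)
      have "span (A ` R) \<subseteq> V" using AV RXU sV by (intro span_minimal) auto
      then show ?thesis using v True kd(1) by auto
    next
      case False
      then have zX: "z \<in> X" using z by blast
      then have "p (B z) \<in> insert 0 Y" using kX(2) by auto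
      then show ?thesis using False l subspace_0[OF sV]
        by (intro bexI[of _ "if p (B z) = 0 then 0 else l (p (B z))"]) auto
    qed
    then obtain v where v: "v \<in> V" "p v = p (B z)" "z \<in> R \<longrightarrow> v \<in> span (A ` R)"
      "z \<in> X \<longrightarrow> v = (if p (B z) = 0 then 0 else l (p (B z)))" by blast
    have "v - B z \<in> V" using v(1) BU' RXU[OF z] sV by (simp add: subspace_diff)
    then have "v - B z \<in> M" using v(2) by (simp add: p.diff flip: pM)
    then obtain n where n: "n \<in> N" "v - B z = B n" by (auto simp: M_def)
    have "B (z + n) = v" using n by (simp add: B.add flip: n(2))
    moreover have "z + n \<in> U" using n NU RXU[OF z] sU by (auto intro: subspace_add)
    ultimately show ?thesis using v n by (intro exI[of _ "z + n"]) auto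
  qed
  then have "\<forall>z\<in>R \<union> X. \<exists>u. u \<in> U \<and> u - z \<in> N \<and> (z \<in> R \<longrightarrow> B u \<in> span (A ` R)) \<and>
      (z \<in> X \<longrightarrow> B u = (if p (B z) = 0 then 0 else l (p (B z))))" by blast
  from bchoice[OF this] obtain g where g: "\<And>z. z \<in> R \<union> X \<Longrightarrow> g z \<in> U" "\<And>z. z \<in> R \<union> X \<Longrightarrow> g z - z \<in> N"
    "\<And>z. z \<in> R \<Longrightarrow> B (g z) \<in> span (A ` R)"
    "\<And>z. z \<in> X \<Longrightarrow> B (g z) = (if p (B z) = 0 then 0 else l (p (B z)))" by blast
  have Ag: "A (g z) = A z" if "z \<in> R \<union> X" for z using g(2)[OF that] by (simp add: N A.diff)
  have pBg: "p (B (g z)) = p (B z)" if "z \<in> R \<union> X" for z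
  proof -
    have "p (B (g z - z)) = 0" using g(2)[OF that] by (intro p(3)) auto
    then show ?thesis by (simp add: B.diff p.diff)
  qed
  have imgA: "A ` g ` T = A ` T" if "T \<subseteq> R \<union> X" for T
    using Ag that by (auto simp: image_image intro!: image_cong)
  \<comment> \<open>For these \<open>x\<close> the vector \<open>A x\<close> lies in
    \<open>M\<close>. The basis \<open>Y1\<close> of \<open>M\<close> is built around these vectors,
    so that \<open>A\<close> still sends basis vectors to basis vectors.\<close>
  define X0 where "X0 = {x \<in> X. p (A x) = 0}"
  have "independent (A ` X0)" by (rule independent_mono[OF indA]) (auto simp: X0_def)
  moreover have "A ` X0 \<subseteq> M" using pM AV RXU by (auto simp: X0_def)
  ultimately obtain Y1 where Y1: "A ` X0 \<subseteq> Y1" "basis_of M Y1"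
    using basis_of_subspace[OF V sM MV] by metis
  have Y1': "finite Y1" "independent Y1" "span Y1 = M" using Y1 by (auto simp: basis_of_def)
  have Y1M: "y \<in> B ` N" if "y \<in> Y1" for y using that Y1'(3) span_superset[of Y1] by (auto simp: M_def)
  \<comment> \<open>\<open>M\<close> is the image of \<open>N\<close> under \<open>B\<close>, so
    each vector of \<open>Y1\<close> has a preimage in \<open>N\<close>. Together with a basis
    \<open>N2\<close> of the common kernel of both maps these preimages form a basis of
    \<open>N\<close>.\<close>
  define N1 where "N1 = inv_into N B ` Y1"
  have BN1: "B ` N1 = Y1" using Y1M by (force simp: N1_def image_image f_inv_into_f)
  have N1N: "N1 \<subseteq> N" using Y1M by (auto simp: N1_def inv_into_into)
  have injN1: "inj_on B N1" using Y1M by (auto simp: N1_def inj_on_def f_inv_into_f)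
  have sN2: "subspace {n \<in> N. B n = 0}"
    using subspace_inter[OF sN B.subspace_kernel] by (simp add: Int_def)
  obtain N2 where N2: "basis_of {n \<in> N. B n = 0} N2"
    using basis_of_subspace_exists[OF U sN2] NU by blast
  have N2': "N2 \<subseteq> {n \<in> N. B n = 0}" using N2 span_superset unfolding basis_of_def by blast
  have finN1: "finite N1" using Y1' by (simp add: N1_def)
  have indN1: "independent (B ` N1)" and spN1: "B ` N \<subseteq> span (B ` N1)"
    using BN1 Y1' by (auto simp: M_def)
  note eN = basis_of_kernel_extend[OF B sN N2 finN1 N1N injN1 indN1 spN1]
  have bN: "basis_of {u \<in> U. A u = 0} (N2 \<union> N1)" using eN(2) by (simp add: N)
  have finG: "finite (g ` (R \<union> X))" using bU by simp
  have GU: "g ` (R \<union> X) \<subseteq> U" using g(1) by auto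
  have injAG: "inj_on A (g ` (R \<union> X))" using injA' Ag by (auto simp: inj_on_def)
  have AG: "A ` g ` (R \<union> X) = A ` (R \<union> X)" by (rule imgA) simp
  have indAG: "independent (A ` g ` (R \<union> X))" and spAG: "A ` U \<subseteq> span (A ` g ` (R \<union> X))"
    using AG indA spA by auto
  note eU = basis_of_kernel_extend[OF A sU bN finG GU injAG indAG spAG]
  have injg: "inj_on g (R \<union> X)" using injA' Ag by (metis inj_onI inj_onD)
  have bM: "basis_of {v \<in> V. p v = 0} Y1"
  proof -
    have "{v \<in> V. p v = 0} = M" using pM MV by auto
    then show ?thesis using Y1 by simp
  qed
  let ?W = "A ` R \<union> l ` Y"
  have finW: "finite ?W" using bV bU by simp
  have WV: "?W \<subseteq> V" using l AV RXU by auto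
  have pW: "p ` ?W = (p \<circ> A) ` R \<union> Y" using l by (auto simp: image_Un image_image)
  have pl: "p ` l ` Y = Y" using l by (auto simp: image_image)
  have "inj_on p (A ` R)" using kR(1) by (rule inj_on_imageI)
  moreover have "inj_on p (l ` Y)" using l by (auto simp: inj_on_def)
  moreover have "p ` A ` R \<inter> p ` l ` Y = {}" using kd(2) pl by (simp add: image_comp)
  ultimately have injW: "inj_on p ?W" unfolding inj_on_Un by blast
  have indW: "independent (p ` ?W)" and spW: "p ` V \<subseteq> span (p ` ?W)" using bV by (simp_all add: pW)
  note eV = basis_of_kernel_extend[OF p(1) sV bM finW WV injW indW spW]
  let ?R = "g ` R" and ?X = "g ` X \<union> (N2 \<union> N1)" and ?Y = "l ` Y \<union> Y1"
  have AgR: "A ` g ` R = A ` R" by (rule imgA) simp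
  have injl: "inj_on l Y" using l by (metis inj_onI)
  have ARlY: "A ` R \<inter> l ` Y = {}"
    using \<open>p ` A ` R \<inter> p ` l ` Y = {}\<close> by blast
  have "kronecker_basis A B U V ?R ?X ?Y"
    unfolding kronecker_basis_def
  proof (intro conjI)
    have "g ` R \<inter> g ` X = {}" using injg kd(1) inj_on_image_Int[of g "R \<union> X" R X] by simp
    then show "?R \<inter> ?X = {}" using eU(1) by blast
    show "basis_of U (?R \<union> ?X)" using eU(2) by (simp add: image_Un Un_ac)
    show "A ` ?R \<inter> ?Y = {}" using ARlY eV(1) by (auto simp: AgR)
    show "basis_of V (A ` ?R \<union> ?Y)" using eV(2) by (simp add: AgR Un_ac)
    show "inj_on A ?R" using injAG by (rule inj_on_subset) auto
    have imB: "p ` B ` ?R = (p \<circ> B) ` R" using pBg by (auto simp: image_image)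
    have "inj_on (p \<circ> B) ?R" using kR(2) pBg by (auto simp: inj_on_def)
    then show iB: "inj_on B ?R" by (rule inj_on_imageI2)
    have "inj_on p (B ` ?R)" using \<open>inj_on (p \<circ> B) ?R\<close> by (rule inj_on_imageI)
    then show "independent (B ` ?R)" using kR(3) independent_of_image[OF p(1)] imB by simp
    show "B ` ?R \<subseteq> span (A ` ?R)" using g(3) by (auto simp: AgR)
    show "A ` ?X \<subseteq> insert 0 ?Y"
    proof -
      have "A (g x) \<in> insert 0 ?Y" if x: "x \<in> X" for x
      proof (cases "p (A x) = 0")
        case True
        then have "A x \<in> Y1" using x Y1 by (auto simp: X0_def)
        then show ?thesis using x Ag by simp
      next
        case False
        then have "p (A x) \<in> Y" using x kX(1) by auto
        then have "A x \<in> l ` Y" using lA[OF x False] by (metis imageI)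
        then show ?thesis using x Ag by simp
      qed
      moreover have "A n = 0" if "n \<in> N2 \<union> N1" for n using that N2' N1N N by auto
      ultimately show ?thesis by auto
    qed
    show "B ` ?X \<subseteq> insert 0 ?Y" using g(4) kX(2) BN1 N2' by fastforce
    have "{x \<in> ?X. A x \<noteq> 0} \<subseteq> g ` (R \<union> X)" using N2' N1N N by auto
    then show "inj_on A {x \<in> ?X. A x \<noteq> 0}" using injAG inj_on_subset by blast
    let ?X2 = "{x \<in> X. p (B x) \<noteq> 0}"
    have BX2: "B (g x) = l (p (B x))" "p (B x) \<in> Y" if "x \<in> ?X2" for x using that g(4) kX(2) by auto
    have "inj_on B (g ` ?X2)"
    proof (rule inj_onI)
      fix a b assume ab: "a \<in> g ` ?X2" "b \<in> g ` ?X2" "B a = B b"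
      then obtain x y where xy: "x \<in> ?X2" "y \<in> ?X2" "a = g x" "b = g y" by blast
      then have "p (B x) = p (B y)" using ab BX2[of x] BX2[of y] inj_onD[OF injl, of "p (B x)" "p (B y)"] by simp
      then have "x = y" using kB xy by (auto simp: inj_on_def)
      then show "a = b" using xy by simp
    qed
    moreover have "B ` g ` ?X2 \<inter> B ` N1 = {}"
    proof -
      have "B ` g ` ?X2 \<subseteq> l ` Y" using BX2 by auto
      then show ?thesis using eV(1) BN1 by blast
    qed
    ultimately have "inj_on B (g ` ?X2 \<union> N1)" using injN1 unfolding inj_on_Un by blast
    moreover have "{x \<in> ?X. B x \<noteq> 0} \<subseteq> g ` ?X2 \<union> N1" using N2' g(4) by fastforce
    ultimately show "inj_on B {x \<in> ?X. B x \<noteq> 0}" using inj_on_subset by blast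
  qed
  then show ?thesis by blast
qed

text \<open>The range case makes the target strictly smaller and the quotient case the source;
  neither enlarges the other space, so the sum of the dimensions is a measure.\<close>

theorem kronecker_basis_exists:
  assumes "Vector_Spaces.linear scale scale A" "Vector_Spaces.linear scale scale B"
    and "basis_of U BU" "basis_of V BV" "A ` U \<subseteq> V" "B ` U \<subseteq> V"
  shows "\<exists>R X Y. kronecker_basis A B U V R X Y"
  using assms
proof (induction "card BU + card BV" arbitrary: A B U V BU BV rule: less_induct)
  case less
  \<comment> \<open>Stated for fresh \<open>A\<close> and \<open>B\<close> in order to apply it also
    with the two maps exchanged.\<close>
  have range_case: "\<exists>R X Y. kronecker_basis A B U V R X Y"
    if A: "Vector_Spaces.linear scale scale A" and B: "Vector_Spaces.linear scale scale B"
      and AV: "A ` U \<subseteq> V" and BV: "B ` U \<subseteq> V" and ne: "A ` U \<noteq> V" for A B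
  proof -
    interpret A: Vector_Spaces.linear scale scale A by fact
    interpret B: Vector_Spaces.linear scale scale B by fact
    have sU: "subspace U" using less.prems by (auto simp: basis_of_def)
    then have sAU: "subspace (A ` U)" by (rule A.subspace_image)
    let ?U = "{u \<in> U. B u \<in> A ` U}"
    have s1: "subspace ?U"
      using subspace_inter[OF sU B.subspace_linear_preimage[OF sAU]] by (simp add: Int_def)
    obtain C where C: "basis_of ?U C" "card C \<le> card BU"
      using basis_of_subspace_exists[OF less.prems(3) s1] by blast
    obtain D where D: "basis_of (A ` U) D" "card D < card BV"
      using basis_of_subspace_exists[OF less.prems(4) sAU AV] ne by metis
    have "\<exists>R X Y. kronecker_basis A B ?U (A ` U) R X Y"
      by (rule less.hyps[OF _ A B C(1) D(1)]) (use C D in auto)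
    then show ?thesis
      using kronecker_basis_extend_range[OF A B less.prems(3,4) BV AV] by blast
  qed
  note A = less.prems(1) and B = less.prems(2)
  interpret A: Vector_Spaces.linear scale scale A by fact
  interpret B: Vector_Spaces.linear scale scale B by fact
  have sU: "subspace U" using less.prems by (auto simp: basis_of_def)
  consider "A ` U \<noteq> V" | "A ` U = V" "{u \<in> U. A u = 0} \<noteq> {0}" | "B ` U \<noteq> V"
    | "A ` U = V" "{u \<in> U. A u = 0} = {0}" "B ` U = V" by blast
  then show ?case
  proof cases
    case 1 then show ?thesis using range_case[OF A B] less.prems by blast
  next
    case 3
    then have "\<exists>R X Y. kronecker_basis B A U V R X Y" using range_case[OF B A] less.prems by blast
    then show ?thesis using kronecker_basis_swap by blast
  next
    case 2
    define N where "N = {u \<in> U. A u = 0}"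
    have sN: "subspace N"
      unfolding N_def using subspace_inter[OF sU A.subspace_kernel] by (simp add: Int_def)
    have NU: "N \<subseteq> U" by (auto simp: N_def)
    have sM: "subspace (B ` N)" and MV: "B ` N \<subseteq> V"
      using sN B.subspace_image NU less.prems by blast+
    obtain p where p: "Vector_Spaces.linear scale scale p" "\<And>v. v \<in> V \<Longrightarrow> v - p v \<in> B ` N"
        "\<And>v. v \<in> B ` N \<Longrightarrow> p v = 0"
      using projection_along[OF less.prems(4) sM MV] by metis
    obtain t where t: "Vector_Spaces.linear scale scale t" "\<And>u. u \<in> U \<Longrightarrow> u - t u \<in> N"
        "\<And>u. u \<in> N \<Longrightarrow> t u = 0"
      using projection_along[OF less.prems(3) sN NU] by metis
    interpret p: Vector_Spaces.linear scale scale p by fact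
    interpret t: Vector_Spaces.linear scale scale t by fact
    have sV: "subspace V" using less.prems by (auto simp: basis_of_def)
    have tU: "t u \<in> U" if "u \<in> U" for u
      using subspace_diff[OF sU that, of "u - t u"] t(2)[OF that] NU by auto
    have pV: "p v \<in> V" if "v \<in> V" for v
      using subspace_diff[OF sV that, of "v - p v"] p(2)[OF that] MV by auto
    \<comment> \<open>If \<open>t\<close> were onto \<open>U\<close>, some nonzero \<open>n\<close>
      in \<open>N\<close> would equal \<open>t u\<close>. Then \<open>u\<close> differs from
      \<open>n\<close> by an element of \<open>N\<close>, hence lies in \<open>N\<close>, where
      \<open>t\<close> vanishes.\<close>
    have "t ` U \<noteq> U"
    proof
      assume eq: "t ` U = U"
      obtain n where n: "n \<in> N" "n \<noteq> 0" using 2(2) sN subspace_0 unfolding N_def by blast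
      then obtain u where u: "u \<in> U" "n = t u" using eq NU by blast
      then have "u - n \<in> N" using t(2) by auto
      then have "u \<in> N" using n(1) sN by (metis diff_add_cancel subspace_add)
      then show False using t(3) u n by auto
    qed
    then obtain C where C: "basis_of (t ` U) C" "card C < card BU"
      using basis_of_subspace_exists[OF less.prems(3) t.subspace_image[OF sU]] tU by (metis image_subsetI)
    obtain D where D: "basis_of (p ` V) D" "card D \<le> card BV"
      using basis_of_subspace_exists[OF less.prems(4) p.subspace_image[OF sV]] pV by (metis image_subsetI)
    have "\<exists>R X Y. kronecker_basis (p \<circ> A) (p \<circ> B) (t ` U) (p ` V) R X Y"
    proof (rule less.hyps[OF _ Vector_Spaces.linear_compose[OF A p(1)] Vector_Spaces.linear_compose[OF B p(1)] C(1) D(1)])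
      show "card C + card D < card BU + card BV" using C D by simp
      show "(p \<circ> A) ` t ` U \<subseteq> p ` V" "(p \<circ> B) ` t ` U \<subseteq> p ` V" using tU less.prems by (fastforce simp: image_subset_iff)+
    qed
    then show ?thesis
      using kronecker_basis_lift_quotient[OF A B less.prems(3,4) less.prems(6) 2(1) N_def p t] by blast
  next
    case 4
    have BU: "finite BU" "independent BU" "span BU = U" using less.prems by (auto simp: basis_of_def)
    have injA: "inj_on A (span BU)" using 4(2) sU BU by (auto simp: A.inj_on_iff_eq_0)
    have bA: "basis_of V (A ` BU)"
      using BU 4 A.independent_injective_image[OF BU(2) injA] by (simp add: basis_of_def A.span_image)
    have iA: "inj_on A BU" using injA span_superset by (rule inj_on_subset)
    \<comment> \<open>Counting replaces a direct proof that \<open>B\<close> is injective: a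
      subfamily of \<open>BU\<close> whose images under \<open>B\<close> form a basis of
      \<open>V\<close> has as many elements as \<open>BU\<close>, because \<open>A\<close> maps
      \<open>BU\<close> bijectively to a basis of \<open>V\<close>.\<close>
    obtain D where D: "D \<subseteq> BU" "inj_on B D" "independent (B ` D)" "B ` BU \<subseteq> span (B ` D)"
      using lift_independent_extension[of B "{}" BU] by (auto simp: independent_empty)
    have spD: "span (B ` D) = V"
      
  proof
    show "span (B ` D) \<subseteq> V" 
      using span_mono[of "B ` D" "B ` BU"] D(1) by (simp add: image_mono B.span_image BU(3) 4(3))
    have "span (B ` BU) \<subseteq> span (B ` D)" using D(4) by (rule span_minimal) (rule subspace_span)
    then show "V \<subseteq> span (B ` D)" using 4(3) BU(3) B.span_image[of BU] by auto
  qed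
    have "finite D" using D BU finite_subset by blast
    then have "basis_of V (B ` D)" using D spD by (simp add: basis_of_def)
    then have "card D = card BU"
      using basis_of_card_eq[OF _ bA, of "B ` D"] D(2) iA by (simp add: card_image)
    then have "D = BU" using D(1) BU(1) by (simp add: card_subset_eq)
    then have "kronecker_basis A B U V BU {} {}"
      using D iA bA less.prems spD span_superset[of "B ` D"] 
      by (simp add: kronecker_basis_def) (metis basis_of_def)
    then show ?thesis by blast
  qed
qed

end

section \<open>Splitting a pair of partial injections into chains\<close>

text \<open>The columns of the two block matrices, read as the action of \<open>a\<close> and
  \<open>b\<close> on the listed vectors; \<open>block_chain_represents\<close> makes this precise.
  The target only needs a 0, which keeps the splitting purely combinatorial.\<close>

fun block_chain :: "('x \<Rightarrow> 'y::zero) \<Rightarrow> ('x \<Rightarrow> 'y) \<Rightarrow> block \<Rightarrow> 'x list \<Rightarrow> 'y list \<Rightarrow> bool" where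
  "block_chain a b (IJ k) us vs \<longleftrightarrow> length us = k \<and> length vs = k \<and>
     (\<forall>j<k. a (us ! j) = vs ! j \<and> b (us ! j) = (if Suc j < k then vs ! Suc j else 0))"
| "block_chain a b (JI k) us vs \<longleftrightarrow> length us = k \<and> length vs = k \<and>
     (\<forall>j<k. a (us ! j) = (if Suc j < k then vs ! Suc j else 0) \<and> b (us ! j) = vs ! j)"
| "block_chain a b (LR k) us vs \<longleftrightarrow> length us = k \<and> length vs = k - 1 \<and>
     (\<forall>j<k. a (us ! j) = (if j < k - 1 then vs ! j else 0) \<and> b (us ! j) = (if j = 0 then 0 else vs ! (j - 1)))"
| "block_chain a b (LRT k) us vs \<longleftrightarrow> length us = k - 1 \<and> length vs = k \<and>
     (\<forall>j<k - 1. a (us ! j) = vs ! j \<and> b (us ! j) = vs ! Suc j)"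

text \<open>No vector can be revisited: injectivity of \<open>b\<close> would trace a repetition
  back to the start, which has no predecessor. So a walk has at most \<open>card X\<close> vectors,
  and a longest one cannot be continued.\<close>

lemma maximal_walk:
  assumes fin: "finite X" and x0: "x0 \<in> X" "a x0 \<notin> b ` X - {0::'y::zero}"
    and inj: "inj_on a {x \<in> X. a x \<noteq> 0}" "inj_on b {x \<in> X. b x \<noteq> 0}"
  obtains xs where "xs \<noteq> []" "hd xs = x0" "set xs \<subseteq> X" "distinct xs" "b (last xs) \<notin> a ` X - {0}"
    "\<And>i. Suc i < length xs \<Longrightarrow> b (xs ! i) = a (xs ! Suc i) \<and> b (xs ! i) \<noteq> 0"
proof -
  define walk where "walk xs \<longleftrightarrow> xs \<noteq> [] \<and> hd xs = x0 \<and> set xs \<subseteq> X \<and>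
    (\<forall>i. Suc i < length xs \<longrightarrow> b (xs ! i) = a (xs ! Suc i) \<and> b (xs ! i) \<noteq> 0)" for xs
  have wst: "b (xs ! i) = a (xs ! Suc i)" "b (xs ! i) \<noteq> 0" if "walk xs" "Suc i < length xs" for xs i
    using that unfolding walk_def by blast+
  have ne: "xs ! i \<noteq> xs ! j" if w: "walk xs" and ij: "i < j" "j < length xs" for xs i j
    using ij
  proof (induction i arbitrary: j)
    case 0
    then obtain j' where j: "j = Suc j'" by (cases j) auto
    have "a (xs ! j) = b (xs ! j')" "b (xs ! j') \<noteq> 0" "xs ! j' \<in> X"
      using w 0 j wst[OF w, of j'] by (auto simp: walk_def)
    then have "a (xs ! j) \<in> b ` X - {0}" by auto
    moreover have "xs ! 0 = x0" using w by (auto simp: walk_def hd_conv_nth)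
    ultimately show ?case using x0 by auto
  next
    case (Suc i)
    then obtain j' where j: "j = Suc j'" by (cases j) auto
    have "xs ! i \<noteq> xs ! j'" using Suc j by auto
    moreover have "xs ! i \<in> X" "xs ! j' \<in> X"
      using w Suc.prems j by (auto simp: walk_def)
    ultimately show ?case
      using inj_onD[OF inj(2), of "xs ! i" "xs ! j'"] wst[OF w, of i] wst[OF w, of j'] Suc.prems j by auto
  qed
  have dist: "distinct xs" if "walk xs" for xs
    unfolding distinct_conv_nth using ne[OF that] by (metis linorder_neqE_nat)
  have "length xs \<le> card X" if "walk xs" for xs
    using distinct_card[OF dist[OF that]] card_mono[OF fin, of "set xs"] that by (simp add: walk_def)
  moreover have "walk [x0]" using x0 by (simp add: walk_def)
  ultimately obtain xs where xs: "walk xs" "\<And>ys. walk ys \<Longrightarrow> length ys \<le> length xs"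
    using ex_has_greatest_nat[of walk "[x0]" length "Suc (card X)"] by (metis le_imp_less_Suc)
  have "b (last xs) \<notin> a ` X - {0}"
  proof
    assume "b (last xs) \<in> a ` X - {0}"
    then obtain x where x: "x \<in> X" "a x = b (last xs)" "b (last xs) \<noteq> 0" by auto
    have "walk (xs @ [x])"
      unfolding walk_def
    proof (intro conjI allI impI)
      fix i assume i: "Suc i < length (xs @ [x])"
      consider "Suc i < length xs" | "Suc i = length xs" using i by fastforce
      then have "b ((xs @ [x]) ! i) = a ((xs @ [x]) ! Suc i) \<and> b ((xs @ [x]) ! i) \<noteq> 0"
      proof cases
        case 2
        then have "xs ! i = last xs" by (metis last_conv_nth length_0_conv nat.simps(3) diff_Suc_1)
        then show ?thesis using 2 x by (simp add: nth_append)
      qed (use xs(1) in \<open>auto simp: walk_def nth_append\<close>)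
      then show "b ((xs @ [x]) ! i) = a ((xs @ [x]) ! Suc i)" "b ((xs @ [x]) ! i) \<noteq> 0" by auto
    qed (use xs(1) x in \<open>auto simp: walk_def\<close>)
    then show False using xs(2) by fastforce
  qed
  then show ?thesis
    using that[of xs] xs(1) dist[OF xs(1)] wst[OF xs(1)] unfolding walk_def by blast
qed

text \<open>Whether \<open>a\<close> vanishes at the first vector and whether \<open>b\<close>
  vanishes at the last one distinguishes the four kinds of blocks.\<close>

lemma walk_block:
  assumes xs: "xs \<noteq> []" "set xs \<subseteq> X" "distinct xs" and last: "b (last xs) \<notin> a ` X - {0::'y::zero}"
    and step: "\<And>i. Suc i < length xs \<Longrightarrow> b (xs ! i) = a (xs ! Suc i) \<and> b (xs ! i) \<noteq> 0"
    and inj: "inj_on a {x \<in> X. a x \<noteq> 0}"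
  obtains c us vs where "block_chain a b c us vs" "block_size c \<ge> 1" "distinct us" "set us = set xs"
    "distinct vs" "set vs = a ` set xs \<union> b ` set xs - {0}"
proof -
  define L where "L = map a (tl xs)"
  define n where "n = length xs"
  have n: "n \<ge> 1" "length xs = n" using xs by (auto simp: n_def Suc_le_eq)
  have Lb: "L = map b (butlast xs)"
    unfolding L_def by (rule nth_equalityI) (auto simp: nth_tl nth_butlast step)
  have ma: "map a xs = a (hd xs) # L" using xs(1) by (cases xs) (auto simp: L_def)
  have mb: "map b xs = L @ [b (last xs)]"
    using xs(1) by (metis Lb append_butlast_last_id list.simps(8,9) map_append)
  have L0: "0 \<notin> set L"
  proof
    assume "0 \<in> set L"
    then obtain i where "i < length L" "L ! i = 0" by (auto simp: in_set_conv_nth)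
    then have "Suc i < length xs" "a (xs ! Suc i) = 0" by (auto simp: L_def nth_tl)
    then show False using step[of i] by metis
  qed
  \<comment> \<open>The nonzero targets in the order in which the walk meets them. The inner ones
    form \<open>L\<close>, each being the \<open>b\<close>-value of one vector and the
    \<open>a\<close>-value of the next.\<close>
  define vs where "vs = (if a (hd xs) = 0 then [] else [a (hd xs)]) @ L @ (if b (last xs) = 0 then [] else [b (last xs)])"
  have aset: "a ` set xs = insert (a (hd xs)) (set L)" using arg_cong[OF ma, of set] by simp
  have bset: "b ` set xs = insert (b (last xs)) (set L)" using arg_cong[OF mb, of set] by simp
  have setvs: "set vs = a ` set xs \<union> b ` set xs - {0}"
    using L0 by (auto simp: vs_def aset bset)
  have injtl: "inj_on a (set (tl xs))"
  proof (rule inj_on_subset[OF inj])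
    show "set (tl xs) \<subseteq> {x \<in> X. a x \<noteq> 0}"
      using xs(1,2) L0 by (auto simp: L_def image_iff dest: list.set_sel(2))
  qed
  have dL: "distinct L" using injtl xs(3) by (simp add: L_def distinct_map distinct_tl)
  have hdL: "a (hd xs) \<notin> set L" if "a (hd xs) \<noteq> 0"
  proof
    assume "a (hd xs) \<in> set L"
    then obtain x where x: "x \<in> set (tl xs)" "a x = a (hd xs)" by (auto simp: L_def)
    have "x \<in> X" "hd xs \<in> X" using x xs(1,2) by (auto dest: list.set_sel(2))
    then have "x = hd xs" using inj x that by (auto simp: inj_on_def)
    then show False using x xs(1,3) by (cases xs) auto
  qed
  have "a ` set xs \<subseteq> a ` X" using xs(2) by blast
  then have lastL: "b (last xs) \<notin> insert (a (hd xs)) (set L)" if "b (last xs) \<noteq> 0"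
    using last that unfolding aset by auto
  have dvs: "distinct vs" using dL hdL lastL by (auto simp: vs_def)
  have st: "a (xs ! Suc i) = L ! i" "b (xs ! i) = L ! i" if "Suc i < n" for i
    using that step[of i] by (auto simp: L_def nth_tl n)
  have lenL: "length L = n - 1" by (simp add: L_def n)
  have hd: "xs ! 0 = hd xs" and la: "xs ! (n - 1) = last xs"
    using xs(1) n by (auto simp: hd_conv_nth last_conv_nth)
  have as: "a (xs ! i) = (if i = 0 then a (hd xs) else L ! (i - 1))" if "i < n" for i
    using that st(1)[of "i - 1"] hd by (cases i) auto
  have bs: "b (xs ! i) = (if i = n - 1 then b (last xs) else L ! i)" if "i < n" for i
    using that st(2)[of i] la by auto
  consider "a (hd xs) \<noteq> 0" "b (last xs) = 0" | "a (hd xs) = 0" "b (last xs) \<noteq> 0"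
    | "a (hd xs) = 0" "b (last xs) = 0" | "a (hd xs) \<noteq> 0" "b (last xs) \<noteq> 0" by blast
  then show ?thesis
  proof cases
    case 1
    have "block_chain a b (IJ n) xs vs"
      using 1 n lenL as bs by (auto simp: vs_def nth_Cons')
    then show ?thesis using that[of "IJ n" xs vs] n setvs dvs xs by simp
  next
    case 4
    have vs4: "vs = a (hd xs) # L @ [b (last xs)]" using 4 by (simp add: vs_def)
    have "a (xs ! j) = vs ! j \<and> b (xs ! j) = vs ! Suc j" if "j < n" for j
      using that lenL as[of j] bs[of j] by (auto simp: vs4 nth_Cons' nth_append)
    \<comment> \<open>A walk of \<open>n\<close> vectors with nonzero values at both ends meets
      \<open>n + 1\<close> targets, hence the index \<open>Suc n\<close>.\<close>
    then have "block_chain a b (LRT (Suc n)) xs vs" using n lenL by (simp add: vs4)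
    then show ?thesis using that[of "LRT (Suc n)" xs vs] n setvs dvs xs by simp
  next
    case 2
    have vs2: "vs = map b xs" using 2 mb by (simp add: vs_def)
    \<comment> \<open>In \<open>JI\<close> and \<open>LR\<close> consecutive vectors satisfy
      \<open>a (us ! j) = b (us ! Suc j)\<close>, opposite to the direction of the walk. Both lists
      are therefore reversed, here and in the last case.\<close>
    have "a (rev xs ! j) = (if Suc j < n then rev vs ! Suc j else 0) \<and> b (rev xs ! j) = rev vs ! j"
      if j: "j < n" for j
    proof (cases "Suc j < n")
      case True
      then have e: "n - Suc j = Suc (n - Suc (Suc j))" by simp
      show ?thesis using True n st[of "n - Suc (Suc j)"] by (simp add: vs2 rev_nth flip: e)
    next
      case False
      then have "n - Suc j = 0" by simp
      then show ?thesis using False j n 2 hd by (simp add: vs2 rev_nth)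
    qed
    then have "block_chain a b (JI n) (rev xs) (rev vs)" using n by (simp add: vs2)
    then show ?thesis using that[of "JI n" "rev xs" "rev vs"] n setvs dvs xs by simp
  next
    case 3
    have vs3: "vs = L" using 3 by (simp add: vs_def)
    have "a (rev xs ! j) = (if j < n - 1 then rev vs ! j else 0) \<and>
        b (rev xs ! j) = (if j = 0 then 0 else rev vs ! (j - 1))" if j: "j < n" for j
    proof
      show "a (rev xs ! j) = (if j < n - 1 then rev vs ! j else 0)"
      proof (cases "Suc j < n")
        case True
        then have e: "n - Suc j = Suc (n - Suc (Suc j))" by simp
        have "rev xs ! j = xs ! (n - Suc j)" using j n by (simp add: rev_nth)
        moreover have "rev vs ! j = L ! (n - Suc (Suc j))" using True lenL by (simp add: vs3 rev_nth)
        ultimately show ?thesis using True st(1)[of "n - Suc (Suc j)"] by (simp add: e less_diff_conv)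
      next
        case False
        then have "n - Suc j = 0" by simp
        then show ?thesis using False j n 3 hd by (simp add: rev_nth less_diff_conv)
      qed
      show "b (rev xs ! j) = (if j = 0 then 0 else rev vs ! (j - 1))"
      proof (cases j)
        case 0
        then show ?thesis using 3 la n by (simp add: rev_nth)
      next
        case (Suc k)
        have "rev xs ! j = xs ! (n - Suc j)" using j n by (simp add: rev_nth)
        moreover have "rev vs ! k = L ! (n - Suc j)" using j Suc lenL by (simp add: vs3 rev_nth)
        ultimately show ?thesis using st(2)[of "n - Suc j"] j Suc by simp
      qed
    qed
    then have "block_chain a b (LR n) (rev xs) (rev vs)" using n lenL by (simp add: vs3)
    then show ?thesis using that[of "LR n" "rev xs" "rev vs"] n setvs dvs xs by simp
  qed
qed

text \<open>The chain condition of \<open>LRT 1\<close> ranges over an empty set of indices, so a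
  single target with no source vector is a block whatever \<open>a\<close> and \<open>b\<close>
  are.\<close>

lemma isolated_rows_blocks:
  fixes a b :: "'x \<Rightarrow> 'y::zero"
  assumes "finite Y"
  shows "\<exists>ps. (\<forall>(c, us, vs) \<in> set ps. block_size c \<ge> 1 \<and> block_chain a b c us vs) \<and>
    concat (map (fst \<circ> snd) ps) = [] \<and> distinct (concat (map (snd \<circ> snd) ps)) \<and>
    set (concat (map (snd \<circ> snd) ps)) = Y"
proof -
  obtain ys where ys: "set ys = Y" "distinct ys" using finite_distinct_list[OF assms] by blast
  define ps where "ps = map (\<lambda>y. (LRT 1, [] :: 'x list, [y])) ys"
  have "concat (map (fst \<circ> snd) ps) = []" "concat (map (snd \<circ> snd) ps) = ys"
    by (simp_all add: ps_def comp_def)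
  then show ?thesis using ys by (intro exI[of _ ps]) (auto simp: ps_def)
qed

text \<open>Maximal walks are split off as long as some vector has no predecessor. Once every
  \<open>a x\<close> is a nonzero value of \<open>b\<close>, counting forces the two images to
  coincide: only cycles are left, and they form \<open>X0\<close>.\<close>

theorem block_chain_decomposition:
  assumes "finite X" "finite Y" "a ` X \<subseteq> insert 0 Y" "b ` X \<subseteq> insert 0 Y"
    and "inj_on a {x \<in> X. a x \<noteq> 0}" "inj_on b {x \<in> X. b x \<noteq> 0}" "0 \<notin> (Y :: 'y::zero set)"
  shows "\<exists>ps X0 Y0. (\<forall>(c, us, vs) \<in> set ps. block_size c \<ge> 1 \<and> block_chain a b c us vs) \<and>
    distinct (concat (map (fst \<circ> snd) ps)) \<and> distinct (concat (map (snd \<circ> snd) ps)) \<and>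
    set (concat (map (fst \<circ> snd) ps)) \<inter> X0 = {} \<and> set (concat (map (fst \<circ> snd) ps)) \<union> X0 = X \<and>
    set (concat (map (snd \<circ> snd) ps)) \<inter> Y0 = {} \<and> set (concat (map (snd \<circ> snd) ps)) \<union> Y0 = Y \<and>
    a ` X0 = Y0 \<and> b ` X0 = Y0"
  using assms
proof (induction "card X" arbitrary: X Y rule: less_induct)
  case less
  note inj = less.prems(5,6)
  show ?case
  proof (cases "\<exists>x0\<in>X. a x0 \<notin> b ` X - {0}")
    case True
    then obtain x0 where x0: "x0 \<in> X" "a x0 \<notin> b ` X - {0}" by blast
    obtain xs where xs: "xs \<noteq> []" "hd xs = x0" "set xs \<subseteq> X" "distinct xs" "b (last xs) \<notin> a ` X - {0}"
      "\<And>i. Suc i < length xs \<Longrightarrow> b (xs ! i) = a (xs ! Suc i) \<and> b (xs ! i) \<noteq> 0"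
      using maximal_walk[OF less.prems(1) x0 inj] by metis
    obtain c us vs where c: "block_chain a b c us vs" "block_size c \<ge> 1" "distinct us" "set us = set xs"
      "distinct vs" "set vs = a ` set xs \<union> b ` set xs - {0}"
      using walk_block[OF xs(1,3,4,5,6) inj(1)] by metis
    have vsY: "set vs \<subseteq> Y" using c(6) less.prems(3,4) xs(3) by blast
    \<comment> \<open>Injectivity keeps the remaining vectors away from the targets of the walk. The
      last target is covered by maximality: \<open>b (last xs)\<close> is not a nonzero value of
      \<open>a\<close>.\<close>
    have av: "a x \<notin> set vs" if x: "x \<in> X - set xs" for x
    proof
      assume "a x \<in> set vs"
      then have nz: "a x \<noteq> 0" and "a x \<in> a ` set xs \<or> a x \<in> b ` set xs" using c(6) by auto
      then consider z where "z \<in> set xs" "a x = a z" | i where "i < length xs" "a x = b (xs ! i)"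
        by (auto simp: in_set_conv_nth)
      then show False
      proof cases
        case 1
        then have "z \<in> X" using xs(3) by auto
        then show False using inj_onD[OF inj(1), of x z] 1 nz x by auto
      next
        case 2
        show False
        proof (cases "Suc i < length xs")
          case True
          then have "a x = a (xs ! Suc i)" "xs ! Suc i \<in> set xs" using 2 xs(6) by auto
          moreover from this have "xs ! Suc i \<in> X" using xs(3) by auto
          ultimately show False using inj_onD[OF inj(1), of x "xs ! Suc i"] nz x by auto
        next
          case False
          then have "i = length xs - 1" using 2 by simp
          then have "xs ! i = last xs" using xs(1) by (simp add: last_conv_nth)
          then have "b (last xs) = a x" using 2 by simp
          then have "b (last xs) \<in> a ` X - {0}" using nz x by simp
          then show False using xs(5) by simp
        qed
      qed
    qed
    have bv: "b x \<notin> set vs" if x: "x \<in> X - set xs" for x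
    proof
      assume "b x \<in> set vs"
      then have nz: "b x \<noteq> 0" and "b x \<in> a ` set xs \<or> b x \<in> b ` set xs" using c(6) by auto
      then consider z where "z \<in> set xs" "b x = b z" | i where "i < length xs" "b x = a (xs ! i)"
        by (auto simp: in_set_conv_nth)
      then show False
      proof cases
        case 1
        then have "z \<in> X" using xs(3) by auto
        then show False using inj_onD[OF inj(2), of x z] 1 nz x by auto
      next
        case 2
        show False
        proof (cases i)
          case (Suc k)
          then have "b x = b (xs ! k)" "xs ! k \<in> set xs" using 2 xs(6)[of k] by auto
          moreover from this have "xs ! k \<in> X" using xs(3) by auto
          ultimately show False using inj_onD[OF inj(2), of x "xs ! k"] nz x by auto
        next
          case 0
          then have "b x = a x0" using 2 xs(1,2) by (simp add: hd_conv_nth)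
          then have "a x0 \<in> b ` X - {0}" using nz x by (metis DiffD1 DiffI imageI singletonD)
          then show False using x0(2) by simp
        qed
      qed
    qed
    let ?X = "X - set xs" and ?Y = "Y - set vs"
    have "x0 \<in> set xs" using xs(1,2) by auto
    then have lt: "card ?X < card X" using x0 less.prems(1) by (intro psubset_card_mono) auto
    have "a ` ?X \<subseteq> insert 0 ?Y" "b ` ?X \<subseteq> insert 0 ?Y" using av bv less.prems(3,4) by auto
    moreover have "inj_on a {x \<in> ?X. a x \<noteq> 0}" "inj_on b {x \<in> ?X. b x \<noteq> 0}"
      using inj by (auto elim: inj_on_subset)
    ultimately obtain ps X0 Y0 where IH: "\<forall>(c, us, vs) \<in> set ps. block_size c \<ge> 1 \<and> block_chain a b c us vs"
      "distinct (concat (map (fst \<circ> snd) ps))" "distinct (concat (map (snd \<circ> snd) ps))"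
      "set (concat (map (fst \<circ> snd) ps)) \<inter> X0 = {}" "set (concat (map (fst \<circ> snd) ps)) \<union> X0 = ?X"
      "set (concat (map (snd \<circ> snd) ps)) \<inter> Y0 = {}" "set (concat (map (snd \<circ> snd) ps)) \<union> Y0 = ?Y"
      "a ` X0 = Y0" "b ` X0 = Y0"
      using less.hyps[OF lt, of ?Y] less.prems by (metis (no_types, lifting) finite_Diff DiffD1)
    show ?thesis
    proof (intro exI conjI)
      let ?ps = "(c, us, vs) # ps"
      show "\<forall>(c, us, vs) \<in> set ?ps. block_size c \<ge> 1 \<and> block_chain a b c us vs" using IH(1) c by auto
      show "distinct (concat (map (fst \<circ> snd) ?ps))" using IH(2,5) c(3,4) by auto
      show "distinct (concat (map (snd \<circ> snd) ?ps))" using IH(3,7) c(5) by auto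
      show "set (concat (map (fst \<circ> snd) ?ps)) \<inter> X0 = {}" using IH(4,5) c(4) by auto
      show "set (concat (map (fst \<circ> snd) ?ps)) \<union> X0 = X" using IH(5) c(4) xs(3) by auto
      show "set (concat (map (snd \<circ> snd) ?ps)) \<inter> Y0 = {}" using IH(6,7) by auto
      show "set (concat (map (snd \<circ> snd) ?ps)) \<union> Y0 = Y" using IH(7) vsY by auto
    qed (use IH in auto)
  next
    case False
    then have aX: "a x \<noteq> 0" "a x \<in> b ` X" if "x \<in> X" for x using that by auto
    have aY: "a x \<in> Y" if "x \<in> X" for x using less.prems(3) aX(1)[OF that] that by auto
    have "inj_on a X" by (rule inj_on_subset[OF inj(1)]) (use aX in auto)
    then have ca: "card (a ` X) = card X" by (rule card_image)
    have sub: "a ` X \<subseteq> b ` X" using aX by auto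
    have "card (b ` X) \<le> card X" using less.prems(1) by (rule card_image_le)
    then have eq: "a ` X = b ` X" using ca sub less.prems(1) by (intro card_seteq) auto
    obtain ps where ps: "\<forall>(c, us, vs) \<in> set ps. block_size c \<ge> 1 \<and> block_chain a b c us vs"
      "concat (map (fst \<circ> snd) ps) = []" "distinct (concat (map (snd \<circ> snd) ps))"
      "set (concat (map (snd \<circ> snd) ps)) = Y - a ` X"
      using isolated_rows_blocks[of "Y - a ` X" a b] less.prems by blast
    show ?thesis
    proof (intro exI conjI)
      show "set (concat (map (snd \<circ> snd) ps)) \<inter> a ` X = {}" using ps by auto
      show "set (concat (map (snd \<circ> snd) ps)) \<union> a ` X = Y" using ps(4) aY by auto
      show "set (concat (map (fst \<circ> snd) ps)) \<union> X = X" using ps(2) by simp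
      show "set (concat (map (fst \<circ> snd) ps)) \<inter> X = {}" unfolding ps(2) by simp
      show "distinct (concat (map (fst \<circ> snd) ps))" unfolding ps(2) by simp
    qed (use ps(1,3) eq in auto)
  qed
qed

section \<open>Matrices of the canonical form\<close>

lemma dim_mat_dsum [simp]:
  "dim_row (mat_dsum M M') = dim_row M + dim_row M'" "dim_col (mat_dsum M M') = dim_col M + dim_col M'"
  by (simp_all add: mat_dsum_def)

lemma index_mat_dsum:
  assumes "i < dim_row M + dim_row M'" "j < dim_col M + dim_col M'"
  shows "mat_dsum M M' $$ (i, j) = (if i < dim_row M then if j < dim_col M then M $$ (i, j) else 0
     else if j < dim_col M then 0 else M' $$ (i - dim_row M, j - dim_col M))"
  using assms by (auto simp: mat_dsum_def)

lemma sum_lessThan_add: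
  fixes f :: "nat \<Rightarrow> 'x::comm_monoid_add"
  shows "sum f {..<m + n} = sum f {..<m} + (\<Sum>i<n. f (m + i))"
  by (induction n) (simp_all add: add.assoc)

lemma canon_Nil: "canon D [] = (1\<^sub>m (dim_row D), D)"
  by (simp add: canon_def)

lemma canon_snoc: "canon D (bs @ [b]) = pair_dsum (canon D bs) (block_pair b)"
  by (simp add: canon_def)

context pencil_space
begin

text \<open>The matrix of \<open>A\<close> with respect to the families \<open>us\<close> and
  \<open>vs\<close>. That they are bases is not part of the notion, so summands can be treated one
  at a time.\<close>

definition represents :: "('b \<Rightarrow> 'b) \<Rightarrow> 'a mat \<Rightarrow> 'b list \<Rightarrow> 'b list \<Rightarrow> bool" where
  "represents A M us vs \<longleftrightarrow> length us = dim_col M \<and> length vs = dim_row M \<and>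
     (\<forall>j<dim_col M. A (us ! j) = (\<Sum>i<dim_row M. scale (M $$ (i, j)) (vs ! i)))"

lemma represents_dsum:
  assumes "represents A M us vs" "represents A M' us' vs'"
  shows "represents A (mat_dsum M M') (us @ us') (vs @ vs')"
proof -
  let ?r = "dim_row M" and ?r' = "dim_row M'" and ?c = "dim_col M"
  have len: "length us = ?c" "length vs = ?r" "length us' = dim_col M'" "length vs' = ?r'"
    using assms by (auto simp: represents_def)
  have "A ((us @ us') ! j) = (\<Sum>i<?r + ?r'. scale (mat_dsum M M' $$ (i, j)) ((vs @ vs') ! i))"
    if j: "j < ?c + dim_col M'" for j
  proof -
    have "(\<Sum>i<?r + ?r'. scale (mat_dsum M M' $$ (i, j)) ((vs @ vs') ! i)) =
      (\<Sum>i<?r. scale (mat_dsum M M' $$ (i, j)) ((vs @ vs') ! i)) +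
      (\<Sum>i<?r'. scale (mat_dsum M M' $$ (?r + i, j)) ((vs @ vs') ! (?r + i)))"
      by (rule sum_lessThan_add)
    also have "(\<Sum>i<?r. scale (mat_dsum M M' $$ (i, j)) ((vs @ vs') ! i)) =
       (\<Sum>i<?r. scale (if j < ?c then M $$ (i, j) else 0) (vs ! i))"
      using j len by (intro sum.cong) (auto simp: index_mat_dsum nth_append)
    also have "(\<Sum>i<?r'. scale (mat_dsum M M' $$ (?r + i, j)) ((vs @ vs') ! (?r + i))) =
       (\<Sum>i<?r'. scale (if j < ?c then 0 else M' $$ (i, j - ?c)) (vs' ! i))"
      using j len by (intro sum.cong) (auto simp: index_mat_dsum nth_append)
    finally show ?thesis
      using assms j len by (auto simp: represents_def nth_append)
  qed
  then show ?thesis using len by (simp add: represents_def)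
qed

lemma sum_scale_delta:
  "(\<Sum>i<n. scale (if i = k then 1 else 0) (f i)) = (if k < (n::nat) then f k else 0)"
  "(\<Sum>i<n. scale (if k = i then 1 else 0) (f i)) = (if k < (n::nat) then f k else 0)"
  by (simp_all add: if_distrib[where f = "\<lambda>x. scale x _"] sum.delta sum.delta' cong: if_cong)

lemma block_chain_represents:
  assumes "block_chain A B c us vs" "block_size c \<ge> 1"
  shows "represents A (fst (block_pair c)) us vs" "represents B (snd (block_pair c)) us vs"
proof -
  show "represents A (fst (block_pair c)) us vs"
    using assms by (cases c) (auto simp: represents_def Jzero_def Lmat_def sum_scale_delta)
  have d: "(\<Sum>i<n. scale (if k = Suc i then 1 else 0) (f i)) = (if 0 < k \<and> k \<le> n then f (k - 1) else 0)"
    for n k and f :: "nat \<Rightarrow> 'b"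
    by (cases k) (auto simp: sum_scale_delta Suc_le_eq)
  show "represents B (snd (block_pair c)) us vs"
    using assms by (cases c) (auto simp: represents_def Jzero_def Rmat_def sum_scale_delta d)
qed

lemma represents_canon:
  assumes "represents A (1\<^sub>m (dim_row D)) rs ss" "represents B D rs ss"
    and "\<forall>(c, us, vs) \<in> set ps. block_size c \<ge> 1 \<and> block_chain A B c us vs"
  shows "represents A (fst (canon D (map fst ps))) (rs @ concat (map (fst \<circ> snd) ps)) (ss @ concat (map (snd \<circ> snd) ps)) \<and>
    represents B (snd (canon D (map fst ps))) (rs @ concat (map (fst \<circ> snd) ps)) (ss @ concat (map (snd \<circ> snd) ps))"
  using assms(3)
proof (induction ps rule: rev_induct)
  case Nil then show ?case using assms by (simp add: canon_Nil)
next
  case (snoc p ps)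
  obtain c us vs where p: "p = (c, us, vs)" by (cases p)
  then have "represents A (fst (block_pair c)) us vs" "represents B (snd (block_pair c)) us vs"
    using block_chain_represents[of A B c us vs] snoc.prems by auto
  then show ?case using snoc represents_dsum
    by (simp add: p canon_snoc pair_dsum_def flip: append_assoc)
qed

text \<open>With the images under \<open>A\<close> as target basis, \<open>A\<close> becomes the
  identity and \<open>D\<close> is the coordinate matrix of \<open>B\<close>. A kernel vector of
  \<open>D\<close> would give a nontrivial combination of \<open>rs\<close> killed by
  \<open>B\<close>.\<close>

lemma represents_regular:
  assumes A: "Vector_Spaces.linear scale scale A" and B: "Vector_Spaces.linear scale scale B"
    and rs: "distinct rs" "inj_on A (set rs)" "independent (A ` set rs)"
      "inj_on B (set rs)" "independent (B ` set rs)" "B ` set rs \<subseteq> span (A ` set rs)"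
  obtains D where "D \<in> carrier_mat (length rs) (length rs)" "det D \<noteq> 0"
    "represents A (1\<^sub>m (length rs)) rs (map A rs)" "represents B D rs (map A rs)"
proof -
  interpret A: Vector_Spaces.linear scale scale A by fact
  interpret B: Vector_Spaces.linear scale scale B by fact
  define r where "r = length rs"
  define D where "D = mat r r (\<lambda>(i, j). representation (A ` set rs) (B (rs ! j)) (A (rs ! i)))"
  have D: "D \<in> carrier_mat r r" by (simp add: D_def)
  have inj: "inj_on (\<lambda>i. rs ! i) {..<r}" using rs(1) by (auto simp: inj_on_def nth_eq_iff_index_eq r_def)
  have set: "(\<lambda>i. rs ! i) ` {..<r} = set rs" by (auto simp: set_conv_nth r_def)
  have injA: "inj_on (\<lambda>i. A (rs ! i)) {..<r}"
    using comp_inj_on[OF inj, of A] rs(2) set by (simp add: comp_def)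
  have sumA: "(\<Sum>i<r. g (A (rs ! i))) = (\<Sum>b\<in>A ` set rs. g b)" for g :: "'b \<Rightarrow> 'b"
    using sum.reindex[OF injA, of g] by (simp add: comp_def image_image flip: set)
  have BD: "B (rs ! j) = (\<Sum>i<r. scale (D $$ (i, j)) (A (rs ! i)))" if "j < r" for j
  proof -
    have "rs ! j \<in> set rs" using that by (simp add: r_def)
    then have "B (rs ! j) \<in> span (A ` set rs)" using rs(6) by auto
    then have "(\<Sum>b\<in>A ` set rs. scale (representation (A ` set rs) (B (rs ! j)) b) b) = B (rs ! j)"
      using rs(3) by (intro sum_representation_eq) auto
    then show ?thesis
      using sumA[of "\<lambda>b. scale (representation (A ` set rs) (B (rs ! j)) b) b"] that
      by (simp add: D_def)
  qed
  have "det D \<noteq> 0"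
  proof
    assume "det D = 0"
    then obtain v where v: "v \<in> carrier_vec r" "v \<noteq> 0\<^sub>v r" "D *\<^sub>v v = 0\<^sub>v r"
      using det_0_iff_vec_prod_zero_field[OF D] by blast
    have "B (\<Sum>j<r. scale (v $ j) (rs ! j)) = (\<Sum>j<r. scale (v $ j) (B (rs ! j)))"
      by (simp add: B.sum B.scale)
    also have "\<dots> = (\<Sum>j<r. \<Sum>i<r. scale (v $ j * D $$ (i, j)) (A (rs ! i)))"
      by (intro sum.cong refl) (simp add: BD scale_sum_right)
    also have "\<dots> = (\<Sum>i<r. \<Sum>j<r. scale (v $ j * D $$ (i, j)) (A (rs ! i)))" by (rule sum.swap)
    also have "\<dots> = (\<Sum>i<r. scale ((D *\<^sub>v v) $ i) (A (rs ! i)))"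
      using D v(1) by (intro sum.cong)
        (auto simp: scalar_prod_def scale_sum_left mult.commute atLeast0LessThan)
    also have "\<dots> = 0" using v(3) by simp
    finally have 0: "B (\<Sum>j<r. scale (v $ j) (rs ! j)) = 0" .
    have "(\<Sum>j<r. scale (v $ j) (rs ! j)) \<in> span (set rs)"
      by (intro span_sum span_scale span_base) (simp add: r_def)
    then have 00: "(\<Sum>j<r. scale (v $ j) (rs ! j)) = 0"
      using 0 B.inj_on_span_independent_image[OF rs(5,4)] B.inj_on_iff_eq_0[OF subspace_span] by blast
    \<comment> \<open>Turns coefficients indexed by positions into coefficients indexed by vectors,
      the form in which independence is available.\<close>
    define u where "u x = v $ (inv_into {..<r} (\<lambda>i. rs ! i) x)" for x
    have "(\<Sum>x\<in>set rs. scale (u x) x) = (\<Sum>j<r. scale (u (rs ! j)) (rs ! j))"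
      using sum.reindex[OF inj, of "\<lambda>x. scale (u x) x"] set by (simp add: comp_def)
    also have "\<dots> = (\<Sum>j<r. scale (v $ j) (rs ! j))"
      using inv_into_f_f[OF inj] by (intro sum.cong) (auto simp: u_def)
    finally have "(\<Sum>x\<in>set rs. scale (u x) x) = 0" using 00 by simp
    moreover have "independent (set rs)" using independent_of_image[OF A rs(2,3)] .
    ultimately have "u x = 0" if "x \<in> set rs" for x
      using independentD[of "set rs" "set rs" u x] that by auto
    then have "u (rs ! j) = 0" if "j < r" for j using that by (simp add: r_def)
    then have "v $ j = 0" if "j < r" for j using that inv_into_f_f[OF inj] by (simp add: u_def)
    then have "v = 0\<^sub>v r" using v(1) by (intro eq_vecI) auto
    then show False using v(2) by simp
  qed
  moreover have "represents A (1\<^sub>m r) rs (map A rs)"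
  proof -
    have "(\<Sum>i<r. scale (1\<^sub>m r $$ (i, j)) (map A rs ! i)) = (\<Sum>i<r. scale (if i = j then 1 else 0) (A (rs ! i)))"
      if "j < r" for j using that by (intro sum.cong) (auto simp: r_def)
    then show ?thesis by (simp add: represents_def sum_scale_delta) (simp add: r_def)
  qed
  moreover have "represents B D rs (map A rs)"
    using BD D by (simp add: represents_def r_def)
  ultimately show ?thesis using that D by (simp add: r_def)
qed

theorem represents_canon_exists:
  assumes A: "Vector_Spaces.linear scale scale A" and B: "Vector_Spaces.linear scale scale B"
    and "basis_of U BU" "basis_of V BV" "A ` U \<subseteq> V" "B ` U \<subseteq> V"
  shows "\<exists>D bs us vs. canon_ok D bs \<and> distinct us \<and> basis_of U (set us) \<and> distinct vs \<and> basis_of V (set vs) \<and>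
    represents A (fst (canon D bs)) us vs \<and> represents B (snd (canon D bs)) us vs"
proof -
  obtain R X Y where k: "kronecker_basis A B U V R X Y" using kronecker_basis_exists[OF assms] by blast
  have kd: "R \<inter> X = {}" "A ` R \<inter> Y = {}" and bU: "basis_of U (R \<union> X)" and bV: "basis_of V (A ` R \<union> Y)"
    and kR: "inj_on A R" "inj_on B R" "B ` R \<subseteq> span (A ` R)"
    and kX: "A ` X \<subseteq> insert 0 Y" "B ` X \<subseteq> insert 0 Y"
      "inj_on A {x \<in> X. A x \<noteq> 0}" "inj_on B {x \<in> X. B x \<noteq> 0}"
    using k by (auto simp: kronecker_basis_def)
  have kd': "B ` R \<inter> Y = {}" and bV': "basis_of V (B ` R \<union> Y)"
    using kronecker_basis_swap[OF k] by (auto simp: kronecker_basis_def)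
  have fin: "finite R" "finite X" "finite Y" using bU bV by (auto simp: basis_of_def)
  have Y0: "0 \<notin> Y" using bV dependent_zero[of "A ` R \<union> Y"] by (auto simp: basis_of_def)
  obtain ps X0 Y0 where ps: "\<forall>(c, us, vs) \<in> set ps. block_size c \<ge> 1 \<and> block_chain A B c us vs"
    "distinct (concat (map (fst \<circ> snd) ps))" "distinct (concat (map (snd \<circ> snd) ps))"
    "set (concat (map (fst \<circ> snd) ps)) \<inter> X0 = {}" "set (concat (map (fst \<circ> snd) ps)) \<union> X0 = X"
    "set (concat (map (snd \<circ> snd) ps)) \<inter> Y0 = {}" "set (concat (map (snd \<circ> snd) ps)) \<union> Y0 = Y"
    "A ` X0 = Y0" "B ` X0 = Y0"
    using block_chain_decomposition[OF fin(2,3) kX Y0] by (elim exE conjE) (rule that)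
  have X0: "X0 \<subseteq> X" "Y0 \<subseteq> Y" "finite X0" using ps(5,7) fin(2) by auto
  have nz: "A x \<noteq> 0 \<and> B x \<noteq> 0" if "x \<in> X0" for x
    using that ps(8,9) X0(2) Y0 by (metis imageI subsetD)
  have sub: "X0 \<subseteq> {x \<in> X. A x \<noteq> 0}" "X0 \<subseteq> {x \<in> X. B x \<noteq> 0}" using X0 nz by auto
  \<comment> \<open>The cycles \<open>X0\<close> join the regular part here: both maps send them
    bijectively onto \<open>Y0\<close>.\<close>
  obtain rs where rs: "set rs = R \<union> X0" "distinct rs" using finite_distinct_list fin X0 by (metis finite_UnI)
  have "A ` R \<inter> A ` X0 = {}" "B ` R \<inter> B ` X0 = {}" using kd(2) kd' X0(2) unfolding ps(8,9) by blast+
  then have inj: "inj_on A (set rs)" "inj_on B (set rs)"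
    using kR inj_on_subset[OF kX(3) sub(1)] inj_on_subset[OF kX(4) sub(2)] unfolding rs inj_on_Un by blast+
  have Ars: "A ` set rs = A ` R \<union> Y0" and Brs: "B ` set rs = B ` R \<union> Y0" using ps(8,9) by (auto simp: rs)
  have indY: "independent (A ` R \<union> Y)" "independent (B ` R \<union> Y)" using bV bV' by (auto simp: basis_of_def)
  have ind: "independent (A ` set rs)" "independent (B ` set rs)"
    unfolding Ars Brs
    by (rule independent_mono[OF indY(1)], use X0(2) in blast, rule independent_mono[OF indY(2)], use X0(2) in blast)
  have "B ` set rs \<subseteq> span (A ` set rs)"
  proof -
    have "span (A ` R) \<subseteq> span (A ` set rs)" by (intro span_mono) (auto simp: rs)
    then show ?thesis using kR(3) span_superset[of "A ` set rs"] unfolding Brs Ars by auto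
  qed
  then obtain D where D: "D \<in> carrier_mat (length rs) (length rs)" "det D \<noteq> 0"
    "represents A (1\<^sub>m (length rs)) rs (map A rs)" "represents B D rs (map A rs)"
    using represents_regular[OF A B rs(2) inj(1) ind(1) inj(2) ind(2)] by metis
  let ?bs = "map fst ps" and ?us = "rs @ concat (map (fst \<circ> snd) ps)" and ?vs = "map A rs @ concat (map (snd \<circ> snd) ps)"
  have dr: "dim_row D = length rs" using D(1) by auto
  have ok: "canon_ok D ?bs" using D ps(1) unfolding canon_ok_def dr by fastforce
  have rep: "represents A (fst (canon D ?bs)) ?us ?vs" "represents B (snd (canon D ?bs)) ?us ?vs"
    using represents_canon[OF D(3)[folded dr] D(4) ps(1)] by auto
  have su: "set ?us = R \<union> X" unfolding set_append rs(1) using ps(5) by blast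
  have sv: "set ?vs = A ` R \<union> Y" unfolding set_append set_map Ars using ps(7) by blast
  have "set rs \<inter> set (concat (map (fst \<circ> snd) ps)) = {}"
    unfolding rs(1) using ps(4,5) kd(1) by blast
  then have du: "distinct ?us" using rs(2) ps(2) by simp
  have "set (map A rs) \<inter> set (concat (map (snd \<circ> snd) ps)) = {}"
    unfolding set_map Ars using ps(6,7) kd(2) by blast
  then have dv: "distinct ?vs" using rs(2) ps(3) inj(1) by (simp add: distinct_map)
  show ?thesis using ok rep du dv bU bV su sv by metis
qed

end

section \<open>Existence\<close>

lemma vdist_L2: "vdist v w = L2_set (\<lambda>i. norm (v $ i - w $ i)) {..<dim_vec v}"
  by (simp add: vdist_def L2_set_def)

lemma norm_diff_le_vdist:
  assumes "v \<in> carrier_vec n" "i < n"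
  shows "norm (v $ i - w $ i) \<le> vdist v w"
  using assms unfolding vdist_L2 by (intro member_le_L2_set) auto

lemma vdist_le_sum: "vdist v w \<le> (\<Sum>i<dim_vec v. norm (v $ i - w $ i))"
  unfolding vdist_L2 by (rule L2_set_le_sum) auto

text \<open>The filter is arbitrary because \<open>vcont_continuous_on\<close> needs the case
  \<open>at x within S\<close>.\<close>

lemma vcont_tendsto:
  fixes y :: "'b \<Rightarrow> 'a::real_normed_field vec" and f :: "'a vec \<Rightarrow> 'a vec"
  assumes "vcont n f" "\<And>v. v \<in> carrier_vec n \<Longrightarrow> f v \<in> carrier_vec n'"
    and "x \<in> carrier_vec n" "\<And>k. y k \<in> carrier_vec n"
    and "\<And>i. i < n \<Longrightarrow> ((\<lambda>k. y k $ i) \<longlongrightarrow> x $ i) F" and "j < n'"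
  shows "((\<lambda>k. f (y k) $ j) \<longlongrightarrow> f x $ j) F"
proof (rule tendstoI)
  fix e :: real assume "e > 0"
  then obtain d where d: "d > 0" "\<And>w. w \<in> carrier_vec n \<Longrightarrow> vdist w x < d \<Longrightarrow> vdist (f w) (f x) < e"
    using assms(1,3) unfolding vcont_def by blast
  have "((\<lambda>k. \<Sum>i<n. norm (y k $ i - x $ i)) \<longlongrightarrow> (\<Sum>i<n. norm (x $ i - x $ i))) F"
    by (intro tendsto_intros assms(5)) auto
  then have "\<forall>\<^sub>F k in F. (\<Sum>i<n. norm (y k $ i - x $ i)) < d"
    using d(1) by (intro order_tendstoD) auto
  then show "\<forall>\<^sub>F k in F. dist (f (y k) $ j) (f x $ j) < e"
  proof (rule eventually_mono)
    fix k assume "(\<Sum>i<n. norm (y k $ i - x $ i)) < d"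
    then have "vdist (y k) x < d"
      using vdist_le_sum[of "y k" x] carrier_vecD[OF assms(4)[of k]] by simp
    then have "vdist (f (y k)) (f x) < e" using d assms(4) by blast
    then show "dist (f (y k) $ j) (f x $ j) < e"
      using norm_diff_le_vdist[OF assms(2)[OF assms(4)[of k]] assms(6), of "f x"]
      by (simp add: dist_norm)
  qed
qed

text \<open>A failure of continuity at \<open>x\<close> supplies points at distance below
  \<open>1 / (k + 1)\<close> from \<open>x\<close> with images far from \<open>f x\<close>. These
  points converge in every coordinate, so it is enough to compute limits coordinatewise.\<close>

lemma vcont_sequentiallyI:
  fixes f :: "'a::real_normed_field vec \<Rightarrow> 'a vec"
  assumes f: "\<And>v. v \<in> carrier_vec n \<Longrightarrow> f v \<in> carrier_vec n'"
    and lim: "\<And>x y j. x \<in> carrier_vec n \<Longrightarrow> (\<And>k::nat. y k \<in> carrier_vec n) \<Longrightarrow>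
      (\<And>i. i < n \<Longrightarrow> (\<lambda>k. y k $ i) \<longlonglongrightarrow> x $ i) \<Longrightarrow> j < n' \<Longrightarrow> (\<lambda>k. f (y k) $ j) \<longlonglongrightarrow> f x $ j"
  shows "vcont n f"
  unfolding vcont_def
proof (intro ballI allI impI, rule ccontr)
  fix x :: "'a vec" and e :: real assume x: "x \<in> carrier_vec n" and e: "0 < e"
    and "\<not> (\<exists>d>0. \<forall>w\<in>carrier_vec n. vdist w x < d \<longrightarrow> vdist (f w) (f x) < e)"
  then have "\<forall>k. \<exists>w\<in>carrier_vec n. vdist w x < inverse (real (Suc k)) \<and> e \<le> vdist (f w) (f x)"
    by (metis inverse_positive_iff_positive not_le of_nat_0_less_iff zero_less_Suc)
  then obtain y where y: "\<And>k. y k \<in> carrier_vec n" "\<And>k. vdist (y k) x < inverse (real (Suc k))"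
    "\<And>k. e \<le> vdist (f (y k)) (f x)" by metis
  have "(\<lambda>k. y k $ i) \<longlonglongrightarrow> x $ i" if "i < n" for i
  proof (rule LIM_zero_cancel, rule Lim_null_comparison)
    show "\<forall>\<^sub>F k in sequentially. norm (y k $ i - x $ i) \<le> inverse (real (Suc k))"
      using norm_diff_le_vdist[OF y(1) that] y(2) by (intro always_eventually) (meson less_imp_le order_trans)
    show "(\<lambda>k. inverse (real (Suc k))) \<longlonglongrightarrow> 0" by (rule LIMSEQ_inverse_real_of_nat)
  qed
  then have l: "(\<lambda>k. f (y k) $ j) \<longlonglongrightarrow> f x $ j" if "j < n'" for j using lim[of x y j] x y(1) that by blast
  have "(\<lambda>k. \<Sum>j<n'. norm (f (y k) $ j - f x $ j)) \<longlonglongrightarrow> (\<Sum>j<n'. norm (f x $ j - f x $ j))"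
    by (intro tendsto_intros l) auto
  then have "\<forall>\<^sub>F k in sequentially. (\<Sum>j<n'. norm (f (y k) $ j - f x $ j)) < e"
    using e by (intro order_tendstoD) auto
  then obtain k where "(\<Sum>j<n'. norm (f (y k) $ j - f x $ j)) < e"
    by (auto simp: eventually_sequentially)
  then have "vdist (f (y k)) (f x) < e"
    using vdist_le_sum[of "f (y k)" "f x"] carrier_vecD[OF f[OF y(1)[of k]]] by simp
  then show False using y(3)[of k] by simp
qed

lemma vcont_comp:
  fixes f g :: "'a::real_normed_field vec \<Rightarrow> 'a vec"
  assumes "vcont n f" "vcont n' g" "\<And>v. v \<in> carrier_vec n \<Longrightarrow> f v \<in> carrier_vec n'"
  shows "vcont n (\<lambda>v. g (f v))"
  unfolding vcont_def
proof (intro ballI allI impI)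
  fix v :: "'a vec" and e :: real assume v: "v \<in> carrier_vec n" and "0 < e"
  then obtain d where d: "d > 0" "\<And>w. w \<in> carrier_vec n' \<Longrightarrow> vdist w (f v) < d \<Longrightarrow> vdist (g w) (g (f v)) < e"
    using assms(2,3) unfolding vcont_def by blast
  then obtain d' where "d' > 0" "\<And>w. w \<in> carrier_vec n \<Longrightarrow> vdist w v < d' \<Longrightarrow> vdist (f w) (f v) < d"
    using assms(1) v unfolding vcont_def by blast
  then show "\<exists>d>0. \<forall>w\<in>carrier_vec n. vdist w v < d \<longrightarrow> vdist (g (f w)) (g (f v)) < e"
    using d assms(3) by blast
qed

lemma vcont_mult_mat_vec:
  fixes M :: "'a::real_normed_field mat"
  assumes "M \<in> carrier_mat n' n"
  shows "vcont n (\<lambda>v. M *\<^sub>v v)"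
proof (rule vcont_sequentiallyI)
  fix x and y :: "nat \<Rightarrow> 'a vec" and j
  assume *: "x \<in> carrier_vec n" "\<And>k. y k \<in> carrier_vec n" "\<And>i. i < n \<Longrightarrow> (\<lambda>k. y k $ i) \<longlonglongrightarrow> x $ i" "j < n'"
  have "(\<lambda>k. \<Sum>i\<in>{0..<n}. M $$ (j, i) * y k $ i) \<longlonglongrightarrow> (\<Sum>i\<in>{0..<n}. M $$ (j, i) * x $ i)"
    by (intro tendsto_intros *(3)) auto
  moreover have "(M *\<^sub>v v) $ j = (\<Sum>i\<in>{0..<n}. M $$ (j, i) * v $ i)" if "v \<in> carrier_vec n" for v
    using that assms *(4) by (auto simp: scalar_prod_def intro!: sum.cong)
  ultimately show "(\<lambda>k. (M *\<^sub>v y k) $ j) \<longlonglongrightarrow> (M *\<^sub>v x) $ j" using * by simp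
qed (use assms in auto)

lemma vec_homeo_mult_mat_vec:
  fixes P Q :: "'a::real_normed_field mat"
  assumes "Q \<in> carrier_mat n' n" "P \<in> carrier_mat n n'"
    and "\<And>v. v \<in> carrier_vec n \<Longrightarrow> P *\<^sub>v (Q *\<^sub>v v) = v"
    and "\<And>w. w \<in> carrier_vec n' \<Longrightarrow> Q *\<^sub>v (P *\<^sub>v w) = w"
  shows "vec_homeo n n' (\<lambda>v. Q *\<^sub>v v)"
  unfolding vec_homeo_def
  using assms vcont_mult_mat_vec[OF assms(1)] vcont_mult_mat_vec[OF assms(2)]
  by (intro exI[of _ "\<lambda>w. P *\<^sub>v w"]) auto

section \<open>Coordinate spaces inside one function space\<close>

interpretation fun_space: pencil_space "\<lambda>(c::'a::field) (f :: nat \<Rightarrow> 'a) i. c * f i"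
  by unfold_locales (auto simp: fun_eq_iff algebra_simps)

lemma fun_sum_apply: "sum g I i = (\<Sum>k\<in>I. g k i)" for g :: "'b \<Rightarrow> nat \<Rightarrow> 'a::field"
  by (induction I rule: infinite_finite_induct) auto

text \<open>Models the space of \<open>n\<close>-vectors, for every \<open>n\<close>, as a subspace
  of one vector space, so that source and target share the ambient type that the locale
  fixes.\<close>

definition coord_space :: "nat \<Rightarrow> (nat \<Rightarrow> 'a::field) set" where
  "coord_space n = {f. \<forall>i\<ge>n. f i = 0}"

lemma subspace_coord_space: "fun_space.subspace (coord_space n :: (nat \<Rightarrow> 'a::field) set)"
  by (auto simp: fun_space.subspace_def coord_space_def)

lemma coord_space_basis: "\<exists>T. fun_space.basis_of (coord_space n :: (nat \<Rightarrow> 'a::field) set) T"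
proof -
  define e where "e k = (\<lambda>i. if i = k then (1::'a) else 0)" for k :: nat
  have sp: "coord_space n \<subseteq> fun_space.span (e ` {..<n})"
  proof
    fix f :: "nat \<Rightarrow> 'a" assume f: "f \<in> coord_space n"
    have "f = (\<Sum>k<n. (\<lambda>i. f k * e k i))"
    proof
      fix i show "f i = (\<Sum>k<n. (\<lambda>i. f k * e k i)) i"
        using f by (auto simp: fun_sum_apply e_def coord_space_def if_distrib cong: if_cong)
    qed
    also have "\<dots> \<in> fun_space.span (e ` {..<n})"
      by (intro fun_space.span_sum fun_space.span_scale fun_space.span_base) auto
    finally show "f \<in> fun_space.span (e ` {..<n})" .
  qed
  obtain T :: "(nat \<Rightarrow> 'a) set" where T: "T \<subseteq> coord_space n" "fun_space.independent T"
      "coord_space n \<subseteq> fun_space.span T"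
    by (rule fun_space.maximal_independent_subset)
  have "finite T" using fun_space.independent_span_bound[of "e ` {..<n}" T] T sp by blast
  moreover have "fun_space.span T = coord_space n"
    using T subspace_coord_space by (intro fun_space.span_subspace) auto
  ultimately show ?thesis using T by (auto simp: fun_space.basis_of_def)
qed

text \<open>Spanning yields a right inverse \<open>Q\<close>, column by column, by expressing the
  unit vectors in the basis; independence makes \<open>P\<close> injective. Together they show that
  \<open>Q\<close> is also a left inverse, without a prior proof that \<open>P\<close> is
  square.\<close>

lemma coord_space_basis_matrix:
  assumes "fun_space.basis_of (coord_space n :: (nat \<Rightarrow> 'a::field) set) (set us)" "distinct us"
    and P: "P = mat n (length us) (\<lambda>(i, j). (us ! j) i)"
  obtains Q where "Q \<in> carrier_mat (length us) n"
    "\<And>v. v \<in> carrier_vec n \<Longrightarrow> P *\<^sub>v (Q *\<^sub>v v) = v"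
    "\<And>w. w \<in> carrier_vec (length us) \<Longrightarrow> Q *\<^sub>v (P *\<^sub>v w) = w"
proof -
  let ?r = "length us"
  have ind: "fun_space.independent (set us)" and sp: "fun_space.span (set us) = coord_space n"
    using assms(1) by (auto simp: fun_space.basis_of_def)
  have Pc: "P \<in> carrier_mat n ?r" by (simp add: P)
  have inj: "inj_on (\<lambda>i. us ! i) {..<?r}" using assms(2) by (auto simp: inj_on_def nth_eq_iff_index_eq)
  have set: "(\<lambda>i. us ! i) ` {..<?r} = set us" by (auto simp: set_conv_nth)
  have sumus: "(\<Sum>x\<in>set us. g x) = (\<Sum>j<?r. g (us ! j))" for g :: "(nat \<Rightarrow> 'a) \<Rightarrow> nat \<Rightarrow> 'a"
    using sum.reindex[OF inj, of g] by (simp add: comp_def set)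
  have uE: "(us ! j) i = 0" if "j < ?r" "n \<le> i" for i j
    using that sp fun_space.span_base[of "us ! j" "set us"] by (auto simp: coord_space_def)
  have Pw: "(P *\<^sub>v w) $ i = (\<Sum>j<?r. w $ j * (us ! j) i)" if "w \<in> carrier_vec ?r" "i < n" for w i
    using that by (auto simp: P scalar_prod_def mult.commute atLeast0LessThan intro!: sum.cong)
  have inj0: "w = 0\<^sub>v ?r" if w: "w \<in> carrier_vec ?r" "P *\<^sub>v w = 0\<^sub>v n" for w
  proof -
    define u where "u x = w $ (inv_into {..<?r} (\<lambda>i. us ! i) x)" for x
    have u: "u (us ! j) = w $ j" if "j < ?r" for j using that inv_into_f_f[OF inj] by (simp add: u_def)
    have "(\<Sum>x\<in>set us. (\<lambda>i. u x * x i)) = (\<Sum>j<?r. (\<lambda>i. u (us ! j) * (us ! j) i))" by (rule sumus)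
    also have "\<dots> = 0"
    proof
      fix i
      show "(\<Sum>j<?r. (\<lambda>i. u (us ! j) * (us ! j) i)) i = (0 :: nat \<Rightarrow> 'a) i"
      proof (cases "i < n")
        case True
        then have "(\<Sum>j<?r. w $ j * (us ! j) i) = 0" using Pw[OF w(1)] w(2) by simp
        then show ?thesis by (simp add: fun_sum_apply u)
      next
        case False
        then show ?thesis by (simp add: fun_sum_apply uE)
      qed
    qed
    finally have "u x = 0" if "x \<in> set us" for x
      using fun_space.independentD[OF ind, of "set us" u x] that by auto
    then have "w $ j = 0" if "j < ?r" for j using u[OF that] that by simp
    then show ?thesis using w by (intro eq_vecI) auto
  qed
  have "\<exists>c. \<forall>i<n. (\<Sum>j<?r. c j * (us ! j) i) = (if i = k then 1 else 0)" if "k < n" for k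
  proof -
    have "(\<lambda>i. if i = k then 1 else 0) \<in> fun_space.span (set us)"
      using that unfolding sp by (auto simp: coord_space_def)
    then obtain u where "(\<lambda>i. if i = k then 1 else 0) = (\<Sum>x\<in>set us. (\<lambda>i. u x * x i))"
      by (auto simp: fun_space.span_finite)
    then have "(\<lambda>i. if i = k then 1 else 0) = (\<Sum>j<?r. (\<lambda>i. u (us ! j) * (us ! j) i))"
      by (simp add: sumus)
    from fun_cong[OF this] have "(\<Sum>j<?r. u (us ! j) * (us ! j) i) = (if i = k then 1 else 0)" for i
      by (simp add: fun_sum_apply)
    then show ?thesis by (intro exI[of _ "\<lambda>j. u (us ! j)"]) simp
  qed
  then obtain c where c: "\<And>k i. k < n \<Longrightarrow> i < n \<Longrightarrow> (\<Sum>j<?r. c k j * (us ! j) i) = (if i = k then 1 else 0)"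
    by metis
  define Q where "Q = mat ?r n (\<lambda>(j, k). c k j)"
  have Q: "Q \<in> carrier_mat ?r n" by (simp add: Q_def)
  have PQ: "P * Q = 1\<^sub>m n"
  proof (rule eq_matI)
    fix i k assume "i < dim_row (1\<^sub>m n :: 'a mat)" "k < dim_col (1\<^sub>m n :: 'a mat)"
    then show "(P * Q) $$ (i, k) = 1\<^sub>m n $$ (i, k)"
      using c[of k i] by (simp add: P Q_def scalar_prod_def mult.commute atLeast0LessThan)
  qed (use Pc Q in auto)
  have 1: "P *\<^sub>v (Q *\<^sub>v v) = v" if "v \<in> carrier_vec n" for v
    using that assoc_mult_mat_vec[OF Pc Q that] PQ by simp
  have 2: "Q *\<^sub>v (P *\<^sub>v w) = w" if w: "w \<in> carrier_vec ?r" for w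
  proof -
    have c: "P *\<^sub>v w \<in> carrier_vec n" "Q *\<^sub>v (P *\<^sub>v w) \<in> carrier_vec ?r" using w Pc Q by auto
    have "P *\<^sub>v (Q *\<^sub>v (P *\<^sub>v w) - w) = 0\<^sub>v n"
      using c w Pc 1[OF c(1)] by (simp add: mult_minus_distrib_mat_vec)
    then have z: "Q *\<^sub>v (P *\<^sub>v w) - w = 0\<^sub>v ?r" using c w by (intro inj0) auto
    show ?thesis
    proof (rule eq_vecI)
      fix i assume i: "i < dim_vec w"
      have "(Q *\<^sub>v (P *\<^sub>v w) - w) $ i = 0" using z i w by simp
      then show "(Q *\<^sub>v (P *\<^sub>v w)) $ i = w $ i" using i w c by simp
    qed (use c w Q in auto)
  qed
  show ?thesis using that Q 1 2 by blast
qed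

definition mat_fun :: "'a::field mat \<Rightarrow> (nat \<Rightarrow> 'a) \<Rightarrow> nat \<Rightarrow> 'a" where
  "mat_fun A f i = (if i < dim_row A then \<Sum>j<dim_col A. A $$ (i, j) * f j else 0)"

lemma linear_mat_fun: "Vector_Spaces.linear (\<lambda>(c::'a::field) f (i::nat). c * f i) (\<lambda>c f i. c * f i) (mat_fun A)"
  by unfold_locales
    (auto simp: mat_fun_def fun_eq_iff algebra_simps sum.distrib sum_distrib_left)

lemma represents_mat_fun:
  assumes "fun_space.represents (mat_fun A) M us vs" "A \<in> carrier_mat m n"
    and P: "P = mat n (length us) (\<lambda>(i, j). (us ! j) i)" and P': "P' = mat m (length vs) (\<lambda>(i, j). (vs ! j) i)"
  shows "A * P = P' * M"
proof -
  have M: "M \<in> carrier_mat (length vs) (length us)" using assms(1) by (auto simp: fun_space.represents_def)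
  show ?thesis
  proof (rule eq_matI)
    fix i j assume "i < dim_row (P' * M)" "j < dim_col (P' * M)"
    then have ij: "i < m" "j < length us" using M by (auto simp: P')
    have "mat_fun A (us ! j) = (\<Sum>l<length vs. (\<lambda>i. M $$ (l, j) * (vs ! l) i))"
      using assms(1) ij by (simp add: fun_space.represents_def)
    then have "mat_fun A (us ! j) i = (\<Sum>l<length vs. M $$ (l, j) * (vs ! l) i)"
      by (simp add: fun_sum_apply)
    then show "(A * P) $$ (i, j) = (P' * M) $$ (i, j)"
      using ij assms(2) M by (simp add: mat_fun_def P P' scalar_prod_def mult.commute atLeast0LessThan)
  qed (use assms(2) M in \<open>auto simp: P P'\<close>)
qed

text \<open>The homeomorphisms are linear: \<open>Q\<close> and \<open>Q'\<close> pass to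
  coordinates with respect to the adapted bases of source and target.\<close>

theorem top_equiv_canon_exists:
  fixes A B :: "'a::real_normed_field mat"
  assumes A: "A \<in> carrier_mat m n" and B: "B \<in> carrier_mat m n"
  shows "\<exists>D bs. canon_ok D bs \<and> top_equiv (A, B) (canon D bs)"
proof -
  obtain BU BV where b: "fun_space.basis_of (coord_space n :: (nat \<Rightarrow> 'a) set) BU"
      "fun_space.basis_of (coord_space m :: (nat \<Rightarrow> 'a) set) BV"
    using coord_space_basis by metis
  have im: "mat_fun A ` coord_space n \<subseteq> coord_space m" "mat_fun B ` coord_space n \<subseteq> coord_space m"
    using A B by (auto simp: mat_fun_def coord_space_def)
  obtain D bs us vs where c: "canon_ok D bs" "distinct us" "fun_space.basis_of (coord_space n) (set us)"
      "distinct vs" "fun_space.basis_of (coord_space m) (set vs)"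
      "fun_space.represents (mat_fun A) (fst (canon D bs)) us vs"
      "fun_space.represents (mat_fun B) (snd (canon D bs)) us vs"
    using fun_space.represents_canon_exists[OF linear_mat_fun linear_mat_fun b im] by blast
  obtain M N where MN: "canon D bs = (M, N)" by fastforce
  have M: "M \<in> carrier_mat (length vs) (length us)" and N: "N \<in> carrier_mat (length vs) (length us)"
    using c(6,7) MN by (auto simp: fun_space.represents_def)
  define P where "P = mat n (length us) (\<lambda>(i, j). (us ! j) i)"
  define P' where "P' = mat m (length vs) (\<lambda>(i, j). (vs ! j) i)"
  have Pc: "P \<in> carrier_mat n (length us)" "P' \<in> carrier_mat m (length vs)" by (simp_all add: P_def P'_def)
  obtain Q where Q: "Q \<in> carrier_mat (length us) n" "\<And>v. v \<in> carrier_vec n \<Longrightarrow> P *\<^sub>v (Q *\<^sub>v v) = v"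
    "\<And>w. w \<in> carrier_vec (length us) \<Longrightarrow> Q *\<^sub>v (P *\<^sub>v w) = w"
    using coord_space_basis_matrix[OF c(3,2) P_def] by metis
  obtain Q' where Q': "Q' \<in> carrier_mat (length vs) m" "\<And>v. v \<in> carrier_vec m \<Longrightarrow> P' *\<^sub>v (Q' *\<^sub>v v) = v"
    "\<And>w. w \<in> carrier_vec (length vs) \<Longrightarrow> Q' *\<^sub>v (P' *\<^sub>v w) = w"
    using coord_space_basis_matrix[OF c(5,4) P'_def] by metis
  have key: "Q' *\<^sub>v (C *\<^sub>v v) = K *\<^sub>v (Q *\<^sub>v v)"
    if "C * P = P' * K" "C \<in> carrier_mat m n" "K \<in> carrier_mat (length vs) (length us)" "v \<in> carrier_vec n" for C K v
  proof -
    have Qv: "Q *\<^sub>v v \<in> carrier_vec (length us)" using Q(1) that(4) by simp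
    have "C *\<^sub>v v = C *\<^sub>v (P *\<^sub>v (Q *\<^sub>v v))" using Q(2)[OF that(4)] by simp
    also have "\<dots> = P' *\<^sub>v (K *\<^sub>v (Q *\<^sub>v v))"
      using assoc_mult_mat_vec[OF that(2) Pc(1) Qv] assoc_mult_mat_vec[OF Pc(2) that(3) Qv] that(1) by simp
    finally show ?thesis using Q'(3)[of "K *\<^sub>v (Q *\<^sub>v v)"] that(3) Qv by simp
  qed
  have "A * P = P' * M" "B * P = P' * N"
    using represents_mat_fun[OF _ A P_def P'_def] represents_mat_fun[OF _ B P_def P'_def] c(6,7) MN by auto
  then have "\<forall>v\<in>carrier_vec n. Q' *\<^sub>v (A *\<^sub>v v) = M *\<^sub>v (Q *\<^sub>v v) \<and> Q' *\<^sub>v (B *\<^sub>v v) = N *\<^sub>v (Q *\<^sub>v v)"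
    using key A B M N by blast
  moreover have "vec_homeo n (length us) (\<lambda>v. Q *\<^sub>v v)" "vec_homeo m (length vs) (\<lambda>v. Q' *\<^sub>v v)"
    using vec_homeo_mult_mat_vec[OF Q(1) Pc(1) Q(2,3)] vec_homeo_mult_mat_vec[OF Q'(1) Pc(2) Q'(2,3)] by auto
  ultimately have "top_equiv (A, B) (M, N)"
    unfolding top_equiv_def using A M by fastforce
  then show ?thesis using c(1) MN by metis
qed

section \<open>Invariance of dimension\<close>

lemma vcont_continuous_on:
  fixes f :: "'a::real_normed_field vec \<Rightarrow> 'a vec" and X :: "'b::topological_space \<Rightarrow> 'a vec"
  assumes "vcont n f" "\<And>v. v \<in> carrier_vec n \<Longrightarrow> f v \<in> carrier_vec n'" "\<And>x. X x \<in> carrier_vec n"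
    and "\<And>i. i < n \<Longrightarrow> continuous_on S (\<lambda>x. X x $ i)" and "j < n'"
  shows "continuous_on S (\<lambda>x. f (X x) $ j)"
  unfolding continuous_on_def
proof
  fix x assume x: "x \<in> S"
  show "((\<lambda>x. f (X x) $ j) \<longlongrightarrow> f (X x) $ j) (at x within S)"
    by (rule vcont_tendsto[OF assms(1,2,3,3) _ assms(5)])
      (use assms(4) x in \<open>auto simp: continuous_on_def\<close>)
qed

lemma continuous_on_of_isometry:
  assumes "\<And>x y. dist (h x) (h y) = dist x y"
  shows "continuous_on S h"
  unfolding continuous_on_iff using assms by auto

text \<open>The index \<open>d\<close> is the real dimension of the scalar field; \<open>c\<close> reads off real coordinates.\<close>
lemma is_R_or_C_coordinates:
  assumes "is_R_or_C TYPE('a::real_normed_field)"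
  shows "\<exists>d (c :: 'a::real_normed_field \<Rightarrow> nat \<Rightarrow> real) mk. d > 0 \<and> (\<forall>j. continuous_on UNIV (\<lambda>a. c a j)) \<and>
    continuous_on UNIV mk \<and> (\<forall>a. mk (c a) = a) \<and> (\<forall>x. \<forall>j<d. c (mk x) j = x j) \<and>
    (\<forall>x y. (\<forall>j<d. x j = y j) \<longrightarrow> mk x = mk y)"
proof -
  have iso: "dist (h x) (h y) = dist x y" "dist (inv_into UNIV h u) (inv_into UNIV h v) = dist u v"
    if h: "bij h" "\<forall>x y. h (x + y) = h x + h y \<and> h (x * y) = h x * h y" "\<forall>x. norm (h x) = norm x"
    for h :: "'a \<Rightarrow> 'b::real_normed_field" and x y u v
  proof -
    have *: "dist (h x) (h y) = dist x y" for x y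
    proof -
      have "h x = h (x - y) + h y" using h(2) by (metis diff_add_cancel)
      then show ?thesis using h(3) by (metis add_diff_cancel_right' dist_norm)
    qed
    show "dist (h x) (h y) = dist x y" by (rule *)
    show "dist (inv_into UNIV h u) (inv_into UNIV h v) = dist u v"
      using *[of "inv_into UNIV h u" "inv_into UNIV h v"] h(1) by (simp add: bij_is_surj surj_f_inv_f)
  qed
  consider h where "bij (h::'a \<Rightarrow> real)" "\<forall>x y. h (x + y) = h x + h y \<and> h (x * y) = h x * h y" "\<forall>x. norm (h x) = norm x"
    | h where "bij (h::'a \<Rightarrow> complex)" "\<forall>x y. h (x + y) = h x + h y \<and> h (x * y) = h x * h y" "\<forall>x. norm (h x) = norm x"
    using assms unfolding is_R_or_C_def by blast
  then show ?thesis
  proof cases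
    case (1 h)
    have i: "inv_into UNIV h (h a) = a" "h (inv_into UNIV h b) = b" for a b using 1(1) by (simp_all add: bij_is_inj bij_is_surj surj_f_inv_f)
    have co: "continuous_on UNIV h" "continuous_on UNIV (inv_into UNIV h)"
      using iso[OF 1] by (intro continuous_on_of_isometry; blast)+
    show ?thesis
    proof (intro exI[of _ "1::nat"] exI[of _ "\<lambda>a _. h a"] exI[of _ "\<lambda>x. inv_into UNIV h (x 0)"] conjI)
      show "continuous_on UNIV (\<lambda>x::nat \<Rightarrow> real. inv_into UNIV h (x 0))"
        by (rule continuous_on_compose2[OF co(2)]) (auto intro: continuous_intros)
    qed (use i co in auto)
  next
    case (2 h)
    have i: "inv_into UNIV h (h a) = a" "h (inv_into UNIV h b) = b" for a b using 2(1) by (simp_all add: bij_is_inj bij_is_surj surj_f_inv_f)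
    have co: "continuous_on UNIV h" "continuous_on UNIV (inv_into UNIV h)"
      using iso[OF 2] by (intro continuous_on_of_isometry; blast)+
    define c where "c a j = (if j = (0::nat) then Re (h a) else Im (h a))" for a j
    define mk where "mk x = inv_into UNIV h (of_real (x 0) + \<i> * of_real (x 1))" for x :: "nat \<Rightarrow> real"
    have "continuous_on UNIV (\<lambda>x::nat \<Rightarrow> real. of_real (x 0) + \<i> * of_real (x 1) :: complex)"
      by (intro continuous_intros continuous_on_product_coordinates)
    then have "continuous_on UNIV mk" unfolding mk_def by (rule continuous_on_compose2[OF co(2)]) auto
    moreover have "continuous_on UNIV (\<lambda>a. c a j)" for j
      using co(1) by (cases "j = 0") (auto simp: c_def intro: continuous_intros)
    moreover have "mk (c a) = a" for a
      using i(1)[of a] complex_eq[of "h a"] by (simp add: c_def mk_def)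
    moreover have "c (mk x) j = x j" if "j < 2" for x j
      using that by (auto simp: c_def mk_def i(2) less_2_cases_iff)
    moreover have "mk x = mk y" if "\<forall>j<2. x j = y j" for x y using that by (simp add: mk_def)
    ultimately show ?thesis by (intro exI[of _ "2::nat"] exI[of _ c] exI[of _ mk]) simp
  qed
qed

text \<open>Unfolding every entry into \<open>d\<close> real coordinates turns the map into a
  homeomorphism between \<open>Euclidean_space (n * d)\<close> and
  \<open>Euclidean_space (n' * d)\<close>.\<close>

theorem vec_homeo_imp_eq_dim:
  fixes \<phi> :: "'a::real_normed_field vec \<Rightarrow> 'a vec"
  assumes F: "is_R_or_C TYPE('a)" and "vec_homeo n n' \<phi>"
  shows "n = n'"
proof -
  obtain d and c :: "'a \<Rightarrow> nat \<Rightarrow> real" and mk :: "(nat \<Rightarrow> real) \<Rightarrow> 'a" where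
    d: "d > 0" and cc: "\<And>j. continuous_on UNIV (\<lambda>a. c a j)" and cm: "continuous_on UNIV mk" and
    mkc: "\<And>a. mk (c a) = a" and cmk: "\<And>x j. j < d \<Longrightarrow> c (mk x) j = x j" and
    mkcong: "\<And>x y. (\<forall>j<d. x j = y j) \<longrightarrow> mk x = mk y"
    using is_R_or_C_coordinates[OF F] by (elim exE conjE) blast
  obtain g where hom: "\<And>v. v \<in> carrier_vec n \<Longrightarrow> \<phi> v \<in> carrier_vec n' \<and> g (\<phi> v) = v"
    "\<And>w. w \<in> carrier_vec n' \<Longrightarrow> g w \<in> carrier_vec n \<and> \<phi> (g w) = w" "vcont n \<phi>" "vcont n' g"
    using assms(2) unfolding vec_homeo_def by blast
  \<comment> \<open>Position \<open>p = i * d + j\<close> holds real coordinate \<open>j\<close> of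
    entry \<open>i\<close>. Beyond \<open>k * d\<close> the value is 0, as membership in
    \<open>Euclidean_space\<close> demands.\<close>
  define enc where "enc k v = (\<lambda>p. if p < k * d then c (v $ (p div d)) (p mod d) else 0)" for k :: nat and v
  define dec where "dec k x = vec k (\<lambda>i. mk (\<lambda>j. x (i * d + j)))" for k :: nat and x
  have dec_carrier: "dec k x \<in> carrier_vec k" for k x by (simp add: dec_def)
  have in_range: "i * d + j < k * d" if "i < k" "j < d" for i j k
  proof -
    have "i * d + j < Suc i * d" using that by simp
    also have "\<dots> \<le> k * d" using that by (intro mult_le_mono1) simp
    finally show ?thesis .
  qed
  have dec_enc: "dec k (enc k v) = v" if v: "v \<in> carrier_vec k" for k v
  proof (rule eq_vecI)
    fix i assume "i < dim_vec v"
    then have i: "i < k" using v by simp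
    have "mk (\<lambda>j. enc k v (i * d + j)) = mk (c (v $ i))"
      using in_range[OF i] d by (intro mkcong[rule_format]) (simp add: enc_def)
    then show "dec k (enc k v) $ i = v $ i" using i by (simp add: dec_def mkc)
  qed (use v in \<open>simp add: dec_def\<close>)
  have enc_dec: "enc k (dec k x) = x" if x: "x \<in> topspace (Euclidean_space (k * d))" for k x
  proof
    fix p
    show "enc k (dec k x) p = x p"
    proof (cases "p < k * d")
      case True
      then have "p div d < k" using d by (simp add: less_mult_imp_div_less)
      then show ?thesis using True d by (simp add: enc_def dec_def cmk)
    next
      case False
      then show ?thesis using x by (simp add: enc_def topspace_Euclidean_space)
    qed
  qed
  have enc_space: "enc k v \<in> topspace (Euclidean_space (k * d))" for k v
    by (simp add: enc_def topspace_Euclidean_space)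
  have cont: "continuous_map (Euclidean_space (k * d)) (Euclidean_space (k' * d)) (\<lambda>x. enc k' (f (dec k x)))"
    if f: "vcont k f" "\<And>v. v \<in> carrier_vec k \<Longrightarrow> f v \<in> carrier_vec k'" for k k' and f :: "'a vec \<Rightarrow> 'a vec"
    unfolding enc_def continuous_map_componentwise_Euclidean_space
  proof (intro allI impI)
    fix p assume "p < k' * d"
    then have p: "p div d < k'" using d by (simp add: less_mult_imp_div_less)
    have cd: "continuous_on UNIV (\<lambda>x. dec k x $ i)" if "i < k" for i
    proof -
      have "continuous_on UNIV (\<lambda>x::nat \<Rightarrow> real. mk (\<lambda>j. x (i * d + j)))"
        by (rule continuous_on_compose2[OF cm])
          (auto intro!: continuous_on_coordinatewise_then_product continuous_on_product_coordinates)
      then show ?thesis using that by (simp add: dec_def)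
    qed
    have "continuous_on UNIV (\<lambda>x. f (dec k x) $ (p div d))"
      by (rule vcont_continuous_on[OF f dec_carrier _ p]) (use cd in auto)
    then have "continuous_on UNIV (\<lambda>x. c (f (dec k x) $ (p div d)) (p mod d))"
      by (rule continuous_on_compose2[OF cc]) auto
    then show "continuous_map (Euclidean_space (k * d)) euclideanreal (\<lambda>x. c (f (dec k x) $ (p div d)) (p mod d))"
      unfolding continuous_map_Euclidean_space_iff by (rule continuous_on_subset) simp
  qed
  have "homeomorphic_maps (Euclidean_space (n * d)) (Euclidean_space (n' * d))
      (\<lambda>x. enc n' (\<phi> (dec n x))) (\<lambda>x. enc n (g (dec n' x)))"
    unfolding homeomorphic_maps_def
  proof (intro conjI ballI)
    fix x assume "x \<in> topspace (Euclidean_space (n * d))"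
    then show "enc n (g (dec n' (enc n' (\<phi> (dec n x))))) = x"
      using hom(1)[OF dec_carrier[of n x]] by (simp add: dec_enc enc_dec)
  next
    fix x assume "x \<in> topspace (Euclidean_space (n' * d))"
    then show "enc n' (\<phi> (dec n (enc n (g (dec n' x))))) = x"
      using hom(2)[OF dec_carrier[of n' x]] by (simp add: dec_enc enc_dec)
  qed (use cont hom in auto)
  then have "n * d = n' * d"
    using invariance_of_dimension_Euclidean_space homeomorphic_space_def by blast
  then show ?thesis using d by simp
qed

section \<open>Coordinate subspaces and their dimension\<close>

definition coord_subspace :: "nat \<Rightarrow> nat set \<Rightarrow> 'a::zero vec set" where
  "coord_subspace n T = {v \<in> carrier_vec n. \<forall>i<n. i \<notin> T \<longrightarrow> v $ i = 0}"

lemma coord_subspace_parametrization: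
  assumes T: "T \<subseteq> {..<n}"
  obtains emb prj :: "'a::real_normed_field vec \<Rightarrow> 'a vec" where "vcont (card T) emb" "vcont n prj"
    "\<And>v. v \<in> carrier_vec (card T) \<Longrightarrow> emb v \<in> coord_subspace n T \<and> prj (emb v) = v"
    "\<And>w. w \<in> coord_subspace n T \<Longrightarrow> emb (prj w) = w" "\<And>w. prj w \<in> carrier_vec (card T)"
proof -
  have "finite T" using T finite_subset by blast
  then obtain e where e: "bij_betw e {0..<card T} T" using ex_bij_betw_nat_finite by blast
  define e' where "e' = inv_into {0..<card T} e"
  have e': "e' i < card T" "e (e' i) = i" if "i \<in> T" for i
    using that e bij_betw_inv_into_right[OF e] inv_into_into[of i e "{0..<card T}"]
    by (auto simp: e'_def bij_betw_def)
  have ee: "e k \<in> T" "e' (e k) = k" if "k < card T" for k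
    using that e bij_betw_inv_into_left[OF e] by (auto simp: e'_def bij_betw_def)
  define emb where "emb v = vec n (\<lambda>i. if i \<in> T then v $ e' i else (0::'a))" for v
  define prj where "prj w = vec (card T) (\<lambda>k. w $ e k :: 'a)" for w
  have "vcont (card T) emb"
  proof (rule vcont_sequentiallyI[where n' = n])
    fix x :: "'a vec" and y :: "nat \<Rightarrow> 'a vec" and j
    assume "\<And>i. i < card T \<Longrightarrow> (\<lambda>k. y k $ i) \<longlonglongrightarrow> x $ i" "j < n"
    then show "(\<lambda>k. emb (y k) $ j) \<longlonglongrightarrow> emb x $ j" using e' by (cases "j \<in> T") (auto simp: emb_def)
  qed (simp add: emb_def)
  moreover have "vcont n prj"
  proof (rule vcont_sequentiallyI[where n' = "card T"])
    fix x :: "'a vec" and y :: "nat \<Rightarrow> 'a vec" and j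
    assume "\<And>i. i < n \<Longrightarrow> (\<lambda>k. y k $ i) \<longlonglongrightarrow> x $ i" "j < card T"
    then show "(\<lambda>k. prj (y k) $ j) \<longlonglongrightarrow> prj x $ j" using ee(1)[of j] T by (auto simp: prj_def)
  qed (simp add: prj_def)
  moreover have "emb v \<in> coord_subspace n T \<and> prj (emb v) = v" if "v \<in> carrier_vec (card T)" for v
    using that ee subsetD[OF T ee(1)] by (auto simp: emb_def prj_def coord_subspace_def intro!: eq_vecI)
  moreover have "emb (prj w) = w" if "w \<in> coord_subspace n T" for w
    using that e' by (auto simp: emb_def prj_def coord_subspace_def intro!: eq_vecI)
  ultimately show ?thesis using that by (simp add: prj_def)
qed

text \<open>Composition with the parametrizations turns the restricted map into a homeomorphism of
  full coordinate spaces. This is how the sizes of index sets become topological invariants.\<close>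

lemma card_eq_of_homeomorphic_coord_subspaces:
  fixes \<phi> g :: "'a::real_normed_field vec \<Rightarrow> 'a vec"
  assumes F: "is_R_or_C TYPE('a)" and T: "T \<subseteq> {..<n}" "T' \<subseteq> {..<n'}"
    and cont: "vcont n \<phi>" "vcont n' g"
    and maps: "\<And>v. v \<in> carrier_vec n \<Longrightarrow> \<phi> v \<in> carrier_vec n'" "\<And>w. w \<in> carrier_vec n' \<Longrightarrow> g w \<in> carrier_vec n"
    and im: "\<And>v. v \<in> coord_subspace n T \<Longrightarrow> \<phi> v \<in> coord_subspace n' T' \<and> g (\<phi> v) = v"
      "\<And>w. w \<in> coord_subspace n' T' \<Longrightarrow> g w \<in> coord_subspace n T \<and> \<phi> (g w) = w"
  shows "card T = card T'"
proof -
  obtain emb prj :: "'a vec \<Rightarrow> 'a vec" where p: "vcont (card T) emb" "vcont n prj"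
    "\<And>v. v \<in> carrier_vec (card T) \<Longrightarrow> emb v \<in> coord_subspace n T \<and> prj (emb v) = v"
    "\<And>w. w \<in> coord_subspace n T \<Longrightarrow> emb (prj w) = w" "\<And>w. prj w \<in> carrier_vec (card T)"
    using coord_subspace_parametrization[OF T(1)] by metis
  obtain emb' prj' :: "'a vec \<Rightarrow> 'a vec" where p': "vcont (card T') emb'" "vcont n' prj'"
    "\<And>v. v \<in> carrier_vec (card T') \<Longrightarrow> emb' v \<in> coord_subspace n' T' \<and> prj' (emb' v) = v"
    "\<And>w. w \<in> coord_subspace n' T' \<Longrightarrow> emb' (prj' w) = w" "\<And>w. prj' w \<in> carrier_vec (card T')"
    using coord_subspace_parametrization[OF T(2)] by metis
  have e: "emb v \<in> carrier_vec n" if "v \<in> carrier_vec (card T)" for v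
    using p(3)[OF that] by (simp add: coord_subspace_def)
  have e': "emb' v \<in> carrier_vec n'" if "v \<in> carrier_vec (card T')" for v
    using p'(3)[OF that] by (simp add: coord_subspace_def)
  have "vcont (card T) (\<lambda>v. prj' (\<phi> (emb v)))"
    using vcont_comp[OF vcont_comp[OF p(1) cont(1) e] p'(2)] maps e by blast
  moreover have "vcont (card T') (\<lambda>v. prj (g (emb' v)))"
    using vcont_comp[OF vcont_comp[OF p'(1) cont(2) e'] p(2)] maps e' by blast
  ultimately have "vec_homeo (card T) (card T') (\<lambda>v. prj' (\<phi> (emb v)))"
    unfolding vec_homeo_def using p p' im
    by (intro exI[of _ "\<lambda>v. prj (g (emb' v))"] conjI ballI) simp_all
  then show ?thesis by (rule vec_homeo_imp_eq_dim[OF F])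
qed

section \<open>Chains of a pencil\<close>

definition pair_dims :: "'a mat \<times> 'a mat \<Rightarrow> nat \<Rightarrow> nat \<Rightarrow> bool" where
  "pair_dims P m n \<longleftrightarrow> fst P \<in> carrier_mat m n \<and> snd P \<in> carrier_mat m n"

text \<open>The \<open>i\<close>-th power of the linear relation that holds between \<open>u\<close>
  and \<open>v\<close> when \<open>A v = B u\<close>. As a relation it makes sense although neither
  matrix needs to be invertible.\<close>

fun pencil_chain :: "'a::semiring_0 mat \<times> 'a mat \<Rightarrow> nat \<Rightarrow> 'a vec \<Rightarrow> 'a vec \<Rightarrow> bool" where
  "pencil_chain P 0 u v \<longleftrightarrow> u \<in> carrier_vec (dim_col (fst P)) \<and> v = u"
| "pencil_chain P (Suc i) u v \<longleftrightarrow> v \<in> carrier_vec (dim_col (fst P)) \<and>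
     (\<exists>w. pencil_chain P i u w \<and> fst P *\<^sub>v v = snd P *\<^sub>v w)"

lemma pencil_chain_carrier:
  assumes "pencil_chain P i u v" "pair_dims P m n"
  shows "u \<in> carrier_vec n" "v \<in> carrier_vec n"
proof -
  have "u \<in> carrier_vec n \<and> v \<in> carrier_vec n"
    using assms by (induction i arbitrary: v) (auto simp: pair_dims_def)
  then show "u \<in> carrier_vec n" "v \<in> carrier_vec n" by auto
qed

lemma pencil_chain_hom:
  assumes P: "pair_dims P m n" and P': "pair_dims P' m' n'"
    and f: "\<And>v. v \<in> carrier_vec n \<Longrightarrow> f v \<in> carrier_vec n'"
    and hom: "\<And>u v. u \<in> carrier_vec n \<Longrightarrow> v \<in> carrier_vec n \<Longrightarrow> fst P *\<^sub>v v = snd P *\<^sub>v u \<Longrightarrow> fst P' *\<^sub>v f v = snd P' *\<^sub>v f u"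
    and "pencil_chain P i u v"
  shows "pencil_chain P' i (f u) (f v)"
  using assms(5)
proof (induction i arbitrary: v)
  case 0 then show ?case using P P' f by (auto simp: pair_dims_def)
next
  case (Suc i)
  then obtain w where w: "pencil_chain P i u w" "fst P *\<^sub>v v = snd P *\<^sub>v w" by auto
  have c: "v \<in> carrier_vec n" "w \<in> carrier_vec n"
    using pencil_chain_carrier[OF _ P] Suc.prems w by blast+
  then show ?case using Suc.IH[OF w(1)] hom[OF c(2,1) w(2)] f P' by (auto simp: pair_dims_def)
qed

lemma mat_dsum_carrier:
  "M \<in> carrier_mat m n \<Longrightarrow> M' \<in> carrier_mat m' n' \<Longrightarrow> mat_dsum M M' \<in> carrier_mat (m + m') (n + n')"
  by (rule carrier_matI) simp_all

lemma pair_dims_dsum: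
  "pair_dims P m n \<Longrightarrow> pair_dims Q m' n' \<Longrightarrow> pair_dims (pair_dsum P Q) (m + m') (n + n')"
  by (simp add: pair_dims_def pair_dsum_def mat_dsum_carrier)

lemma mat_dsum_mult_vec:
  fixes M M' :: "'a::comm_ring_1 mat"
  assumes "M \<in> carrier_mat m n" "M' \<in> carrier_mat m' n'" "v \<in> carrier_vec n" "v' \<in> carrier_vec n'"
  shows "mat_dsum M M' *\<^sub>v (v @\<^sub>v v') = (M *\<^sub>v v) @\<^sub>v (M' *\<^sub>v v')"
proof -
  have "mat_dsum M M' *\<^sub>v (v @\<^sub>v v') = (M *\<^sub>v v + 0\<^sub>m m n' *\<^sub>v v') @\<^sub>v (0\<^sub>m m' n *\<^sub>v v + M' *\<^sub>v v')"
    unfolding mat_dsum_def using assms by (subst four_block_mat_mult_vec[of _ m n _ n' _ m']) auto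
  moreover have "0\<^sub>m m n' *\<^sub>v v' = 0\<^sub>v m" "0\<^sub>m m' n *\<^sub>v v = 0\<^sub>v m'"
    using assms by (auto intro!: eq_vecI simp: scalar_prod_def)
  moreover have "M *\<^sub>v v \<in> carrier_vec m" "M' *\<^sub>v v' \<in> carrier_vec m'" using assms by auto
  ultimately show ?thesis by simp
qed

lemma pencil_chain_dsum:
  fixes P Q :: "'a::comm_ring_1 mat \<times> 'a mat"
  assumes P: "pair_dims P m n" and Q: "pair_dims Q m' n'"
    and u: "u \<in> carrier_vec n" "u' \<in> carrier_vec n'" and v: "v \<in> carrier_vec n" "v' \<in> carrier_vec n'"
  shows "pencil_chain (pair_dsum P Q) i (u @\<^sub>v u') (v @\<^sub>v v') \<longleftrightarrow> pencil_chain P i u v \<and> pencil_chain Q i u' v'"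
  using v
proof (induction i arbitrary: v v')
  case 0
  have "dim_col (fst (pair_dsum P Q)) = n + n'" "dim_col (fst P) = n" "dim_col (fst Q) = n'"
    using pair_dims_dsum[OF P Q] P Q by (auto simp: pair_dims_def)
  then show ?case using u 0 append_vec_eq[OF 0(1) u(1)] by auto
next
  case (Suc i)
  have d: "dim_col (fst (pair_dsum P Q)) = n + n'" "dim_col (fst P) = n" "dim_col (fst Q) = n'"
    using pair_dims_dsum[OF P Q] P Q by (auto simp: pair_dims_def)
  have eq: "fst (pair_dsum P Q) *\<^sub>v (v @\<^sub>v v') = snd (pair_dsum P Q) *\<^sub>v (w @\<^sub>v w') \<longleftrightarrow>
      fst P *\<^sub>v v = snd P *\<^sub>v w \<and> fst Q *\<^sub>v v' = snd Q *\<^sub>v w'"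
    if "w \<in> carrier_vec n" "w' \<in> carrier_vec n'" for w w'
  proof -
    have "fst P *\<^sub>v v \<in> carrier_vec m" "snd P *\<^sub>v w \<in> carrier_vec m"
      using P that Suc.prems by (auto simp: pair_dims_def)
    from append_vec_eq[OF this] show ?thesis
      using P Q that Suc.prems mat_dsum_mult_vec[of "fst P" m n "fst Q" m' n' v v']
        mat_dsum_mult_vec[of "snd P" m n "snd Q" m' n' w w']
      by (simp add: pair_dsum_def pair_dims_def)
  qed
  show ?case
  proof
    assume l: "pencil_chain (pair_dsum P Q) (Suc i) (u @\<^sub>v u') (v @\<^sub>v v')"
    then obtain x where x: "pencil_chain (pair_dsum P Q) i (u @\<^sub>v u') x"
      "fst (pair_dsum P Q) *\<^sub>v (v @\<^sub>v v') = snd (pair_dsum P Q) *\<^sub>v x" by auto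
    have "x \<in> carrier_vec (n + n')" using pencil_chain_carrier[OF x(1) pair_dims_dsum[OF P Q]] by simp
    then obtain w w' where w: "w \<in> carrier_vec n" "w' \<in> carrier_vec n'" "x = w @\<^sub>v w'"
      using vec_first_last_append by (metis vec_first_carrier vec_last_carrier)
    then show "pencil_chain P (Suc i) u v \<and> pencil_chain Q (Suc i) u' v'"
      using x Suc.IH[OF w(1,2)] eq[OF w(1,2)] Suc.prems d by auto
  next
    assume "pencil_chain P (Suc i) u v \<and> pencil_chain Q (Suc i) u' v'"
    then obtain w w' where w: "pencil_chain P i u w" "fst P *\<^sub>v v = snd P *\<^sub>v w"
      "pencil_chain Q i u' w'" "fst Q *\<^sub>v v' = snd Q *\<^sub>v w'" by auto
    have c: "w \<in> carrier_vec n" "w' \<in> carrier_vec n'"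
      using pencil_chain_carrier[OF w(1) P] pencil_chain_carrier[OF w(3) Q] by auto
    have "pencil_chain (pair_dsum P Q) i (u @\<^sub>v u') (w @\<^sub>v w')" using Suc.IH[OF c] w by simp
    moreover have "fst (pair_dsum P Q) *\<^sub>v (v @\<^sub>v v') = snd (pair_dsum P Q) *\<^sub>v (w @\<^sub>v w')"
      using eq[OF c] w by simp
    ultimately show "pencil_chain (pair_dsum P Q) (Suc i) (u @\<^sub>v u') (v @\<^sub>v v')"
      using Suc.prems d by auto
  qed
qed

section \<open>Chains inside the single blocks\<close>

fun block_rows :: "block \<Rightarrow> nat" where
  "block_rows (IJ k) = k" | "block_rows (JI k) = k" | "block_rows (LR k) = k - 1" | "block_rows (LRT k) = k"

fun block_cols :: "block \<Rightarrow> nat" where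
  "block_cols (IJ k) = k" | "block_cols (JI k) = k" | "block_cols (LR k) = k" | "block_cols (LRT k) = k - 1"

lemma pair_dims_block: "pair_dims (block_pair b) (block_rows b) (block_cols b)"
  by (cases b) (auto simp: pair_dims_def Jzero_def Lmat_def Rmat_def)

lemma sum_delta_mult:
  fixes f :: "nat \<Rightarrow> 'a::semiring_1"
  shows "(\<Sum>i\<in>{0..<n}. (if i = k then 1 else 0) * f i) = (if k < n then f k else 0)"
    "(\<Sum>i\<in>{0..<n}. (if k = i then 1 else 0) * f i) = (if k < n then f k else 0)"
    "(\<Sum>i\<in>{0..<n}. (if k = Suc i then 1 else 0) * f i) = (if 0 < k \<and> k \<le> n then f (k - 1) else 0)"
proof -
  show 1: "(\<Sum>i\<in>{0..<n}. (if i = k then 1 else 0) * f i) = (if k < n then f k else 0)"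
    "(\<Sum>i\<in>{0..<n}. (if k = i then 1 else 0) * f i) = (if k < n then f k else 0)" for k
    by (simp_all add: if_distrib[where f = "\<lambda>x. x * _"] sum.delta sum.delta' cong: if_cong)
  show "(\<Sum>i\<in>{0..<n}. (if k = Suc i then 1 else 0) * f i) = (if 0 < k \<and> k \<le> n then f (k - 1) else 0)"
    using 1(2)[of "k - 1"] by (cases k) (auto simp: Suc_le_eq)
qed

lemma block_mult_vec:
  fixes v :: "'a::comm_ring_1 vec"
  assumes "v \<in> carrier_vec k"
  shows "Jzero k *\<^sub>v v = vec k (\<lambda>i. if i = 0 then 0 else v $ (i - 1))"
    and "Lmat k *\<^sub>v v = vec (k - 1) (\<lambda>i. v $ i)" and "Rmat k *\<^sub>v v = vec (k - 1) (\<lambda>i. v $ Suc i)"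
  using assms
  by (auto intro!: eq_vecI simp: Jzero_def Lmat_def Rmat_def scalar_prod_def sum_delta_mult)

lemma transpose_block_mult_vec:
  fixes v :: "'a::comm_ring_1 vec"
  assumes "v \<in> carrier_vec (k - 1)" "k \<ge> 1"
  shows "transpose_mat (Lmat k) *\<^sub>v v = vec k (\<lambda>i. if i < k - 1 then v $ i else 0)"
    and "transpose_mat (Rmat k) *\<^sub>v v = vec k (\<lambda>i. if i = 0 then 0 else v $ (i - 1))"
  using assms
  by (auto intro!: eq_vecI simp: Lmat_def Rmat_def scalar_prod_def sum_delta_mult)

text \<open>Here the relation is the graph of \<open>Jzero k\<close>, so a chain applies its powers:
  a shift down by \<open>i\<close> places with zeros moving in.\<close>

lemma pencil_chain_IJ:
  "pencil_chain (block_pair (IJ k)) i u v \<longleftrightarrow> u \<in> carrier_vec k \<and> v \<in> carrier_vec k \<and>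
     (\<forall>j<k. v $ j = (if j < i then 0 else u $ (j - i) :: 'a::comm_ring_1))"
proof (induction i arbitrary: v)
  case 0 then show ?case by (auto intro!: eq_vecI)
next
  case (Suc i)
  show ?case
  proof
    assume "pencil_chain (block_pair (IJ k)) (Suc i) u v"
    then obtain w where w: "pencil_chain (block_pair (IJ k)) i u w" "1\<^sub>m k *\<^sub>v v = Jzero k *\<^sub>v w" "v \<in> carrier_vec k"
      by auto
    then have wc: "u \<in> carrier_vec k" "w \<in> carrier_vec k" "\<forall>j<k. w $ j = (if j < i then 0 else u $ (j - i))"
      using Suc.IH by auto
    have "v = vec k (\<lambda>j. if j = 0 then 0 else w $ (j - 1))" using w wc by (simp add: block_mult_vec)
    then have "v $ j = (if j = 0 then 0 else w $ (j - 1))" if "j < k" for j using that by simp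
    then show "u \<in> carrier_vec k \<and> v \<in> carrier_vec k \<and> (\<forall>j<k. v $ j = (if j < Suc i then 0 else u $ (j - Suc i)))"
      using wc w(3) by auto
  next
    assume r: "u \<in> carrier_vec k \<and> v \<in> carrier_vec k \<and> (\<forall>j<k. v $ j = (if j < Suc i then 0 else u $ (j - Suc i)))"
    define w where "w = vec k (\<lambda>j. if j < i then 0 else u $ (j - i))"
    have wc: "w \<in> carrier_vec k" by (simp add: w_def)
    have "pencil_chain (block_pair (IJ k)) i u w" using Suc.IH r by (simp add: w_def)
    moreover have "1\<^sub>m k *\<^sub>v v = Jzero k *\<^sub>v w"
      using r wc by (auto simp: block_mult_vec w_def intro!: eq_vecI)
    ultimately show "pencil_chain (block_pair (IJ k)) (Suc i) u v" using r by (auto intro!: exI[of _ w])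
  qed
qed

text \<open>Exchanging the matrices reverses every chain. The recursion unfolds a chain at its end,
  so \<open>tail\<close> first provides the unfolding at its start.\<close>

lemma pencil_chain_swap:
  assumes "pair_dims P m n"
  shows "pencil_chain (snd P, fst P) i u v \<longleftrightarrow> pencil_chain P i v u"
proof -
  have tail: "pencil_chain Q (Suc i) u v \<longleftrightarrow> u \<in> carrier_vec n \<and> (\<exists>w. pencil_chain Q i w v \<and> fst Q *\<^sub>v w = snd Q *\<^sub>v u)"
    if Q: "pair_dims Q m n" for Q i and u v :: "'a vec"
  proof (induction i arbitrary: v)
    case 0
    then show ?case using Q by (auto simp: pair_dims_def)
  next
    case (Suc i)
    show ?case
      unfolding pencil_chain.simps(2)[of Q "Suc i"] Suc.IH
      unfolding pencil_chain.simps(2)[of Q i] by blast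
  qed
  show ?thesis
  proof (induction i arbitrary: u v)
    case 0 then show ?case using assms by (auto simp: pair_dims_def)
  next
    case (Suc i)
    have "pencil_chain (snd P, fst P) (Suc i) u v \<longleftrightarrow> v \<in> carrier_vec n \<and> (\<exists>w. pencil_chain P i w u \<and> snd P *\<^sub>v v = fst P *\<^sub>v w)"
      using Suc.IH assms by (auto simp: pair_dims_def)
    then show ?case using tail[OF assms, of i v u] by (auto simp: eq_commute)
  qed
qed

lemma pencil_chain_JI:
  "pencil_chain (block_pair (JI k)) i u (v :: 'a::comm_ring_1 vec) \<longleftrightarrow> pencil_chain (block_pair (IJ k)) i v u"
  using pencil_chain_swap[OF pair_dims_block[of "IJ k"], of i u v] by simp

text \<open>One step shifts the entries up and leaves the last entry free, so after \<open>i\<close>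
  steps the last \<open>i\<close> entries of \<open>v\<close> are arbitrary.\<close>

lemma pencil_chain_LR:
  "pencil_chain (block_pair (LR k)) i u v \<longleftrightarrow> u \<in> carrier_vec k \<and> v \<in> carrier_vec k \<and>
     (\<forall>j. j + i < k \<longrightarrow> v $ j = (u $ (j + i) :: 'a::comm_ring_1))"
proof (induction i arbitrary: v)
  case 0 then show ?case by (auto simp: Lmat_def intro!: eq_vecI)
next
  case (Suc i)
  show ?case
  proof
    assume "pencil_chain (block_pair (LR k)) (Suc i) u v"
    then obtain w where w: "pencil_chain (block_pair (LR k)) i u w" "Lmat k *\<^sub>v v = Rmat k *\<^sub>v w" "v \<in> carrier_vec k"
      by (auto simp: Lmat_def)
    then have wc: "u \<in> carrier_vec k" "w \<in> carrier_vec k" "\<forall>j. j + i < k \<longrightarrow> w $ j = u $ (j + i)"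
      using Suc.IH by auto
    have e: "vec (k - 1) (\<lambda>i. v $ i) = vec (k - 1) (\<lambda>i. w $ Suc i)" using w wc by (simp add: block_mult_vec)
    have "v $ j = w $ Suc j" if "j < k - 1" for j using arg_cong[OF e, of "\<lambda>x. x $ j"] that by simp
    then show "u \<in> carrier_vec k \<and> v \<in> carrier_vec k \<and> (\<forall>j. j + Suc i < k \<longrightarrow> v $ j = u $ (j + Suc i))"
      using wc w(3) by auto
  next
    assume r: "u \<in> carrier_vec k \<and> v \<in> carrier_vec k \<and> (\<forall>j. j + Suc i < k \<longrightarrow> v $ j = u $ (j + Suc i))"
    \<comment> \<open>Entries that \<open>u\<close> does not force are read off from
      \<open>v\<close>, since the last step demands \<open>v $ j = w $ Suc j\<close>. The truncated
      \<open>j - 1\<close> at \<open>j = 0\<close> is harmless because \<open>Rmat k\<close> drops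
      that entry.\<close>
    define w where "w = vec k (\<lambda>j. if j + i < k then u $ (j + i) else v $ (j - 1))"
    have wc: "w \<in> carrier_vec k" by (simp add: w_def)
    have "pencil_chain (block_pair (LR k)) i u w" using Suc.IH r by (simp add: w_def)
    moreover have "Lmat k *\<^sub>v v = Rmat k *\<^sub>v w"
      using r wc by (auto simp: block_mult_vec w_def intro!: eq_vecI)
    ultimately show "pencil_chain (block_pair (LR k)) (Suc i) u v"
      using r by (auto simp: Lmat_def intro!: exI[of _ w])
  qed
qed

text \<open>One step shifts down as in \<open>IJ\<close>, but the additional row allows it only when
  the last entry is 0. Over \<open>i\<close> steps this makes the last \<open>i\<close> entries of
  \<open>u\<close> vanish.\<close>

lemma pencil_chain_LRT:
  assumes "k \<ge> 1"
  shows "pencil_chain (block_pair (LRT k)) i u v \<longleftrightarrow> u \<in> carrier_vec (k - 1) \<and> v \<in> carrier_vec (k - 1) \<and>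
     (\<forall>j<k - 1. v $ j = (if j < i then 0 else u $ (j - i) :: 'a::comm_ring_1)) \<and>
     (\<forall>j<k - 1. k - 1 \<le> j + i \<longrightarrow> u $ j = 0)"
proof (induction i arbitrary: v)
  case 0 then show ?case by (auto simp: Lmat_def intro!: eq_vecI)
next
  case (Suc i)
  show ?case (is "_ = ?R")
  proof
    assume "pencil_chain (block_pair (LRT k)) (Suc i) u v"
    then obtain w where w: "pencil_chain (block_pair (LRT k)) i u w"
      "transpose_mat (Lmat k) *\<^sub>v v = transpose_mat (Rmat k) *\<^sub>v w" "v \<in> carrier_vec (k - 1)"
      by (auto simp: Lmat_def)
    then have wc: "u \<in> carrier_vec (k - 1)" "w \<in> carrier_vec (k - 1)"
      "\<forall>j<k - 1. w $ j = (if j < i then 0 else u $ (j - i))" "\<forall>j<k - 1. k - 1 \<le> j + i \<longrightarrow> u $ j = 0"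
      using Suc.IH by auto
    have e: "vec k (\<lambda>i. if i < k - 1 then v $ i else 0) = vec k (\<lambda>i. if i = 0 then 0 else w $ (i - 1))"
      using w wc assms by (simp add: transpose_block_mult_vec)
    have ej: "(if j < k - 1 then v $ j else 0) = (if j = 0 then 0 else w $ (j - 1))" if "j < k" for j
      using arg_cong[OF e, of "\<lambda>x. x $ j"] that by simp
    have "v $ j = (if j < Suc i then 0 else u $ (j - Suc i))" if "j < k - 1" for j
      using ej[of j] that wc(3) by (cases j) auto
    moreover have "u $ j = 0" if j: "j < k - 1" "k - 1 \<le> j + Suc i" for j
    proof (cases "k - 1 \<le> j + i")
      case True then show ?thesis using wc(4) j by blast
    next
      case False
      \<comment> \<open>The one new condition sits at \<open>j + i = k - 2\<close>: the bottom row
        of the last equation kills the last entry of \<open>w\<close>, which is \<open>u $ j\<close>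
        moved down by \<open>i\<close> places.\<close>
      then have ji: "j + i = k - 1 - 1" "k \<ge> 2" using j by auto
      then have "w $ (j + i) = 0" using ej[of "k - 1"] by simp
      have "j + i < k - 1" using ji by simp
      from wc(3)[rule_format, OF this] have "w $ (j + i) = u $ j" by simp
      with \<open>w $ (j + i) = 0\<close> show ?thesis by simp
    qed
    ultimately show ?R using wc w(3) by auto
  next
    assume r: ?R
    define w where "w = vec (k - 1) (\<lambda>j. if j < i then 0 else u $ (j - i))"
    have wc: "w \<in> carrier_vec (k - 1)" by (simp add: w_def)
    have "pencil_chain (block_pair (LRT k)) i u w" using Suc.IH r by (simp add: w_def)
    moreover have "transpose_mat (Lmat k) *\<^sub>v v = transpose_mat (Rmat k) *\<^sub>v w"
    proof (rule eq_vecI)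
      fix j assume "j < dim_vec (transpose_mat (Rmat k) *\<^sub>v w)"
      then have j: "j < k" by (simp add: Rmat_def)
      show "(transpose_mat (Lmat k) *\<^sub>v v) $ j = (transpose_mat (Rmat k) *\<^sub>v w) $ j"
      proof (cases "j < k - 1")
        case True
        then show ?thesis using r wc assms j by (auto simp: transpose_block_mult_vec w_def)
      next
        case False
        then have jk: "j = k - 1" using j by simp
        have "w $ (k - 2) = 0" if "k \<ge> 2"
          using that r by (auto simp: w_def)
        then show ?thesis using r wc assms j jk by (auto simp: transpose_block_mult_vec numeral_2_eq_2)
      qed
    qed (simp add: Lmat_def Rmat_def)
    ultimately show "pencil_chain (block_pair (LRT k)) (Suc i) u v"
      using r by (auto simp: Lmat_def intro!: exI[of _ w])
  qed
qed

text \<open>The relation is the graph of the bijection \<open>D\<close>, so a chain of length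
  \<open>i\<close> joins \<open>u\<close> to \<open>D\<close> applied \<open>i\<close> times to
  \<open>u\<close>.\<close>

lemma pencil_chain_regular:
  assumes D: "D \<in> carrier_mat r r" and E: "E \<in> carrier_mat r r" "D * E = 1\<^sub>m r" "E * D = (1\<^sub>m r :: 'a::comm_ring_1 mat)"
  shows "pencil_chain (1\<^sub>m r, D) i (0\<^sub>v r) v \<longleftrightarrow> v = 0\<^sub>v r"
    and "pencil_chain (1\<^sub>m r, D) i v (0\<^sub>v r) \<longleftrightarrow> v = 0\<^sub>v r"
    and "v \<in> carrier_vec r \<Longrightarrow> \<exists>u. pencil_chain (1\<^sub>m r, D) i u v"
    and "pencil_chain (1\<^sub>m r, D) i u v \<Longrightarrow> pencil_chain (1\<^sub>m r, D) i u w \<Longrightarrow> v = w"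
proof -
  have ED: "E *\<^sub>v (D *\<^sub>v v) = v" "D *\<^sub>v (E *\<^sub>v v) = v" if "v \<in> carrier_vec r" for v
    using assoc_mult_mat_vec[OF E(1) D that] assoc_mult_mat_vec[OF D E(1) that] E that by auto
  have dims: "pair_dims (1\<^sub>m r, D) r r" using D by (simp add: pair_dims_def)
  have u: "\<forall>v w. pencil_chain (1\<^sub>m r, D) i u v \<longrightarrow> pencil_chain (1\<^sub>m r, D) i u w \<longrightarrow> v = w" for i u
  proof (induction i)
    case 0 then show ?case by simp
  next
    case (Suc i)
    show ?case
    proof (intro allI impI)
      fix v w assume "pencil_chain (1\<^sub>m r, D) (Suc i) u v" "pencil_chain (1\<^sub>m r, D) (Suc i) u w"
      then obtain a b where "pencil_chain (1\<^sub>m r, D) i u a" "v = D *\<^sub>v a" "pencil_chain (1\<^sub>m r, D) i u b" "w = D *\<^sub>v b"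
        by auto
      then show "v = w" using Suc.IH by metis
    qed
  qed
  have z: "pencil_chain (1\<^sub>m r, D) i (0\<^sub>v r) (0\<^sub>v r)" for i
    using D by (induction i) (auto intro!: exI[of _ "0\<^sub>v r"])
  have z2: "v = 0\<^sub>v r" if "pencil_chain (1\<^sub>m r, D) i v (0\<^sub>v r)" for i v using that
  proof (induction i)
    case 0 then show ?case by simp
  next
    case (Suc i)
    then obtain a where a: "pencil_chain (1\<^sub>m r, D) i v a" "D *\<^sub>v a = 0\<^sub>v r" by auto
    then have "a \<in> carrier_vec r" using pencil_chain_carrier dims by blast
    then have "a = E *\<^sub>v 0\<^sub>v r" using ED(1)[of a] a by simp
    moreover have "E *\<^sub>v 0\<^sub>v r = 0\<^sub>v r" using E(1) by (auto intro!: eq_vecI simp: scalar_prod_def)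
    ultimately have "a = 0\<^sub>v r" by simp
    then show ?case using Suc.IH a by simp
  qed
  have su: "\<exists>u. pencil_chain (1\<^sub>m r, D) i u v" if "v \<in> carrier_vec r" for i v using that
  proof (induction i arbitrary: v)
    case 0
    then show ?case by (intro exI[of _ v]) simp
  next
    case (Suc i)
    have "E *\<^sub>v v \<in> carrier_vec r" using E(1) Suc.prems by simp
    then obtain u where "pencil_chain (1\<^sub>m r, D) i u (E *\<^sub>v v)" using Suc.IH by blast
    then have "pencil_chain (1\<^sub>m r, D) (Suc i) u v" using Suc.prems ED(2)[of v] by auto
    then show ?case by blast
  qed
  show "pencil_chain (1\<^sub>m r, D) i (0\<^sub>v r) v \<longleftrightarrow> v = 0\<^sub>v r" using u z by metis
  show "pencil_chain (1\<^sub>m r, D) i v (0\<^sub>v r) \<longleftrightarrow> v = 0\<^sub>v r" using z z2 by metis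
  show "\<exists>u. pencil_chain (1\<^sub>m r, D) i u v" if "v \<in> carrier_vec r" using su that .
  show "v = w" if "pencil_chain (1\<^sub>m r, D) i u v" "pencil_chain (1\<^sub>m r, D) i u w" using u that by metis
qed

section \<open>Topological equivalence and coordinate subspaces\<close>

text \<open>Eliminates \<open>\<psi>\<close>: chains only need the relation \<open>A v = B u\<close>
  to be preserved in both directions. The inverse \<open>g\<close> is kept as a parameter so that
  the two sides can be exchanged.\<close>

definition pencil_homeo :: "'a::real_normed_field mat \<times> 'a mat \<Rightarrow> 'a mat \<times> 'a mat \<Rightarrow> nat \<Rightarrow> nat \<Rightarrow>
    ('a vec \<Rightarrow> 'a vec) \<Rightarrow> ('a vec \<Rightarrow> 'a vec) \<Rightarrow> bool" where
  "pencil_homeo P Q n n' \<phi> g \<longleftrightarrow>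
    (\<forall>v\<in>carrier_vec n. \<phi> v \<in> carrier_vec n' \<and> g (\<phi> v) = v) \<and>
    (\<forall>w\<in>carrier_vec n'. g w \<in> carrier_vec n \<and> \<phi> (g w) = w) \<and> vcont n \<phi> \<and> vcont n' g \<and>
    \<phi> (0\<^sub>v n) = 0\<^sub>v n' \<and>
    (\<forall>u\<in>carrier_vec n. \<forall>v\<in>carrier_vec n. fst P *\<^sub>v v = snd P *\<^sub>v u \<longleftrightarrow> fst Q *\<^sub>v \<phi> v = snd Q *\<^sub>v \<phi> u)"

lemma pencil_homeo_sym:
  assumes "pencil_homeo P Q n n' \<phi> g"
  shows "pencil_homeo Q P n' n g \<phi>"
proof -
  have "g (0\<^sub>v n') = 0\<^sub>v n" using assms unfolding pencil_homeo_def by (metis zero_carrier_vec)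
  moreover have "fst Q *\<^sub>v v = snd Q *\<^sub>v u \<longleftrightarrow> fst P *\<^sub>v g v = snd P *\<^sub>v g u"
    if "u \<in> carrier_vec n'" "v \<in> carrier_vec n'" for u v
    using assms that unfolding pencil_homeo_def by metis
  ultimately show ?thesis using assms unfolding pencil_homeo_def by blast
qed

lemma pencil_homeo_comp:
  assumes f: "pencil_homeo P Q n n' \<phi> g" and f': "pencil_homeo Q R n' n'' \<phi>' g'"
  shows "pencil_homeo P R n n'' (\<lambda>v. \<phi>' (\<phi> v)) (\<lambda>w. g (g' w))"
proof -
  have "vcont n (\<lambda>v. \<phi>' (\<phi> v))" "vcont n'' (\<lambda>w. g (g' w))"
    using vcont_comp[of n \<phi> n' \<phi>'] vcont_comp[of n'' g' n' g] f f' unfolding pencil_homeo_def by metis+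
  moreover have "\<phi> v \<in> carrier_vec n'" if "v \<in> carrier_vec n" for v
    using f that unfolding pencil_homeo_def by metis
  ultimately show ?thesis using f f' unfolding pencil_homeo_def by simp
qed

lemma vcont_add_const:
  fixes a :: "'a::real_normed_field vec"
  assumes "a \<in> carrier_vec n"
  shows "vcont n (\<lambda>v. v + a)" "vcont n (\<lambda>v. v - a)"
  using assms by (auto intro!: vcont_sequentiallyI[where n' = n] tendsto_add tendsto_diff tendsto_const)

text \<open>Subtracting the constant \<open>\<phi> 0\<close> is harmless because \<open>A' (\<phi> 0) = \<psi> 0 = B' (\<phi> 0)\<close>.\<close>
lemma top_equiv_imp_pencil_homeo:
  fixes P Q :: "'a::real_normed_field mat \<times> 'a mat"
  assumes P: "pair_dims P m n" and Q: "pair_dims Q m' n'" and e: "top_equiv P Q"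
  obtains \<phi> g where "pencil_homeo P Q n n' \<phi> g"
proof -
  obtain A B A' B' where pq: "P = (A, B)" "Q = (A', B')" by (cases P; cases Q) auto
  have d: "A \<in> carrier_mat m n" "B \<in> carrier_mat m n" "A' \<in> carrier_mat m' n'" "B' \<in> carrier_mat m' n'"
    using P Q pq by (auto simp: pair_dims_def)
  obtain \<phi> \<psi> where h: "vec_homeo n n' \<phi>" "vec_homeo m m' \<psi>"
    "\<And>v. v \<in> carrier_vec n \<Longrightarrow> \<psi> (A *\<^sub>v v) = A' *\<^sub>v \<phi> v \<and> \<psi> (B *\<^sub>v v) = B' *\<^sub>v \<phi> v"
    using e d unfolding top_equiv_def pq by auto
  obtain g where g: "\<And>v. v \<in> carrier_vec n \<Longrightarrow> \<phi> v \<in> carrier_vec n' \<and> g (\<phi> v) = v"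
    "\<And>w. w \<in> carrier_vec n' \<Longrightarrow> g w \<in> carrier_vec n \<and> \<phi> (g w) = w" "vcont n \<phi>" "vcont n' g"
    using h(1) unfolding vec_homeo_def by blast
  obtain k where k: "\<And>v. v \<in> carrier_vec m \<Longrightarrow> k (\<psi> v) = v"
    using h(2) unfolding vec_homeo_def by blast
  define a where "a = \<phi> (0\<^sub>v n)"
  have a: "a \<in> carrier_vec n'" using g(1) by (simp add: a_def)
  have z: "A *\<^sub>v 0\<^sub>v n = 0\<^sub>v m" "B *\<^sub>v 0\<^sub>v n = 0\<^sub>v m" using d by (auto intro!: eq_vecI simp: scalar_prod_def)
  have ab: "A' *\<^sub>v a = B' *\<^sub>v a" using h(3)[of "0\<^sub>v n"] by (metis a_def z zero_carrier_vec)
  have hom: "A *\<^sub>v v = B *\<^sub>v u \<longleftrightarrow> A' *\<^sub>v \<phi> v = B' *\<^sub>v \<phi> u" if "u \<in> carrier_vec n" "v \<in> carrier_vec n" for u v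
  proof -
    have "A *\<^sub>v v \<in> carrier_vec m" "B *\<^sub>v u \<in> carrier_vec m" using d that by auto
    then have "A *\<^sub>v v = B *\<^sub>v u \<longleftrightarrow> \<psi> (A *\<^sub>v v) = \<psi> (B *\<^sub>v u)" using k by metis
    then show ?thesis using h(3) that by simp
  qed
  have sh: "A' *\<^sub>v (x - a) = B' *\<^sub>v (y - a) \<longleftrightarrow> A' *\<^sub>v x = B' *\<^sub>v y" if "x \<in> carrier_vec n'" "y \<in> carrier_vec n'" for x y
  proof -
    have c: "A' *\<^sub>v x \<in> carrier_vec m'" "B' *\<^sub>v y \<in> carrier_vec m'" "B' *\<^sub>v a \<in> carrier_vec m'" using d that a by auto
    have "A' *\<^sub>v (x - a) = A' *\<^sub>v x - B' *\<^sub>v a" "B' *\<^sub>v (y - a) = B' *\<^sub>v y - B' *\<^sub>v a"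
      using mult_minus_distrib_mat_vec[of A' m' n' x a] mult_minus_distrib_mat_vec[of B' m' n' y a] d that a ab by auto
    moreover have "p = q" if "p - B' *\<^sub>v a = q - B' *\<^sub>v a" "p \<in> carrier_vec m'" "q \<in> carrier_vec m'" for p q
    proof (rule eq_vecI)
      fix i assume i: "i < dim_vec q"
      then have "(p - B' *\<^sub>v a) $ i = p $ i - (B' *\<^sub>v a) $ i" "(q - B' *\<^sub>v a) $ i = q $ i - (B' *\<^sub>v a) $ i"
        using i that(2,3) d(4) by (auto simp del: index_mult_mat_vec)
      then show "p $ i = q $ i" using that(1) by simp
    qed (use that in auto)
    ultimately show ?thesis using c by metis
  qed
  have ar: "v - a + a = v" "v + a - a = v" if "v \<in> carrier_vec n'" for v using that a by (auto intro!: eq_vecI)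
  have "pencil_homeo P Q n n' (\<lambda>v. \<phi> v - a) (\<lambda>w. g (w + a))"
    unfolding pencil_homeo_def
  proof (intro conjI ballI)
    show "vcont n (\<lambda>v. \<phi> v - a)" using vcont_comp[OF g(3) vcont_add_const(2)[OF a]] g(1) by blast
    show "vcont n' (\<lambda>w. g (w + a))" using vcont_comp[OF vcont_add_const(1)[OF a] g(4)] a by simp
    show "\<phi> (0\<^sub>v n) - a = 0\<^sub>v n'" using a unfolding a_def[symmetric] by (intro eq_vecI) auto
    show "(fst P *\<^sub>v v = snd P *\<^sub>v u) = (fst Q *\<^sub>v (\<phi> v - a) = snd Q *\<^sub>v (\<phi> u - a))"
      if "u \<in> carrier_vec n" "v \<in> carrier_vec n" for u v
      using hom[OF that] sh g(1) that by (simp add: pq)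
    fix v :: "'a vec" assume v: "v \<in> carrier_vec n"
    show "\<phi> v - a \<in> carrier_vec n'" using v g(1) a by simp
    show "g (\<phi> v - a + a) = v" using v g(1) ar by simp
  next
    fix w :: "'a vec" assume "w \<in> carrier_vec n'"
    then have wa: "w \<in> carrier_vec n'" "w + a \<in> carrier_vec n'" using a by auto
    show "g (w + a) \<in> carrier_vec n" using g(2) wa by blast
    show "\<phi> (g (w + a)) - a = w" using g(2)[OF wa(2)] ar wa by simp
  qed
  then show ?thesis using that by blast
qed

lemma pencil_homeo_chain:
  assumes "pencil_homeo P Q n n' \<phi> g" "pair_dims P m n" "pair_dims Q m' n'" "pencil_chain P i u v"
  shows "pencil_chain Q i (\<phi> u) (\<phi> v)"
proof (rule pencil_chain_hom[OF assms(2,3) _ _ assms(4)])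
  show "\<phi> v \<in> carrier_vec n'" if "v \<in> carrier_vec n" for v using assms(1) that unfolding pencil_homeo_def by blast
  show "fst Q *\<^sub>v \<phi> v = snd Q *\<^sub>v \<phi> u"
    if "u \<in> carrier_vec n" "v \<in> carrier_vec n" "fst P *\<^sub>v v = snd P *\<^sub>v u" for u v
    using assms(1) that unfolding pencil_homeo_def by blast
qed

definition coord_dim :: "nat \<Rightarrow> 'a::zero vec set \<Rightarrow> nat \<Rightarrow> bool" where
  "coord_dim n S d \<longleftrightarrow> (\<exists>T\<subseteq>{..<n}. S = coord_subspace n T \<and> card T = d)"

lemma coord_dim_unique:
  fixes S S' :: "'a::real_normed_field vec set"
  assumes F: "is_R_or_C TYPE('a)" and h: "pencil_homeo P Q n n' \<phi> g"
    and S: "coord_dim n S d" "coord_dim n' S' d'"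
    and im: "\<And>v. v \<in> S \<Longrightarrow> \<phi> v \<in> S'" "\<And>w. w \<in> S' \<Longrightarrow> g w \<in> S"
  shows "d = d'"
proof -
  obtain T where T: "T \<subseteq> {..<n}" "S = coord_subspace n T" "card T = d" using S(1) by (auto simp: coord_dim_def)
  obtain T' where T': "T' \<subseteq> {..<n'}" "S' = coord_subspace n' T'" "card T' = d'" using S(2) by (auto simp: coord_dim_def)
  have c: "v \<in> S \<Longrightarrow> v \<in> carrier_vec n" "w \<in> S' \<Longrightarrow> w \<in> carrier_vec n'" for v w
    by (auto simp: T T' coord_subspace_def)
  have "card T = card T'"
    by (rule card_eq_of_homeomorphic_coord_subspaces[OF F T(1) T'(1), of \<phi> g])
      (use h im c in \<open>auto simp: pencil_homeo_def T(2)[symmetric] T'(2)[symmetric]\<close>)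
  then show ?thesis using T T' by simp
qed

lemma coord_dim_append:
  fixes S S' :: "'a::zero vec set"
  assumes "coord_dim n S d" "coord_dim n' S' d'"
  shows "coord_dim (n + n') {v @\<^sub>v w | v w. v \<in> S \<and> w \<in> S'} (d + d')"
proof -
  obtain T where T: "T \<subseteq> {..<n}" "S = coord_subspace n T" "card T = d" using assms(1) by (auto simp: coord_dim_def)
  obtain T' where T': "T' \<subseteq> {..<n'}" "S' = coord_subspace n' T'" "card T' = d'" using assms(2) by (auto simp: coord_dim_def)
  let ?T = "T \<union> (+) n ` T'"
  have fin: "finite T" "finite T'" using T(1) T'(1) finite_subset by blast+
  have "card ?T = card T + card ((+) n ` T')"
    using fin T(1) by (intro card_Un_disjoint) auto
  then have card: "card ?T = d + d'" using T T' by (simp add: card_image)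
  have "{v @\<^sub>v w | v w. v \<in> S \<and> w \<in> S'} = coord_subspace (n + n') ?T"
  proof (intro equalityI subsetI)
    fix x assume "x \<in> {v @\<^sub>v w | v w. v \<in> S \<and> w \<in> S'}"
    then obtain v w where x: "x = v @\<^sub>v w" "v \<in> S" "w \<in> S'" by blast
    then have c: "v \<in> carrier_vec n" "w \<in> carrier_vec n'" by (auto simp: T T' coord_subspace_def)
    have "x $ i = 0" if "i < n + n'" "i \<notin> ?T" for i
    proof (cases "i < n")
      case True
      then show ?thesis using that x c by (auto simp: T(2) coord_subspace_def)
    next
      case False
      then have "i - n < n'" "i - n \<notin> T'" using that by (auto simp: image_iff)
      then show ?thesis using False that x c by (auto simp: T'(2) coord_subspace_def)
    qed
    then show "x \<in> coord_subspace (n + n') ?T" using x c by (auto simp: coord_subspace_def)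
  next
    fix x :: "'a vec" assume x: "x \<in> coord_subspace (n + n') ?T"
    let ?v = "vec_first x n" and ?w = "vec_last x n'"
    have xc: "x \<in> carrier_vec (n + n')" using x by (simp add: coord_subspace_def)
    have e: "x = ?v @\<^sub>v ?w" using vec_first_last_append[OF xc] by simp
    have "i \<notin> (+) n ` T'" if "i < n" for i using that by auto
    then have "?v \<in> S" using x T(1) by (auto simp: T(2) coord_subspace_def vec_first_def)
    moreover have "n + i \<notin> T" "n + i \<notin> (+) n ` T'" if "i \<notin> T'" for i using that T(1) by auto
    then have "?w \<in> S'"
      using x xc T(1) T'(1) by (auto simp: T'(2) coord_subspace_def vec_last_def)
    ultimately show "x \<in> {v @\<^sub>v w | v w. v \<in> S \<and> w \<in> S'}" using e by blast
  qed
  moreover have "?T \<subseteq> {..<n + n'}" using T(1) T'(1) by auto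
  ultimately show ?thesis unfolding coord_dim_def using card by blast
qed

section \<open>Numerical invariants\<close>

text \<open>Reduces an invariant of a canonical form to its values on the single summands, where it
  can be computed; \<open>coord_dim_canon\<close> adds these up.\<close>

definition additive_invariant :: "('a::comm_ring_1 mat \<times> 'a mat \<Rightarrow> 'a vec set) \<Rightarrow> bool" where
  "additive_invariant Z \<longleftrightarrow> (\<forall>P Q m n m' n'. pair_dims P m n \<longrightarrow> pair_dims Q m' n' \<longrightarrow>
     Z (pair_dsum P Q) = {v @\<^sub>v w | v w. v \<in> Z P \<and> w \<in> Z Q})"

text \<open>In the language of linear relations this is the multivalued part of the
  \<open>i\<close>-th power; the next two definitions are its kernel and its range.\<close>

definition forward_kernel :: "nat \<Rightarrow> 'a::comm_ring_1 mat \<times> 'a mat \<Rightarrow> 'a vec set" where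
  "forward_kernel i P = {v. pencil_chain P i (0\<^sub>v (dim_col (fst P))) v}"

definition backward_kernel :: "nat \<Rightarrow> 'a::comm_ring_1 mat \<times> 'a mat \<Rightarrow> 'a vec set" where
  "backward_kernel i P = {v. pencil_chain P i v (0\<^sub>v (dim_col (fst P)))}"

definition forward_range :: "nat \<Rightarrow> 'a::comm_ring_1 mat \<times> 'a mat \<Rightarrow> 'a vec set" where
  "forward_range i P = {v. \<exists>u. pencil_chain P i u v}"

lemma dim_col_fst_pair_dims: "pair_dims P m n \<Longrightarrow> dim_col (fst P) = n"
  by (auto simp: pair_dims_def)

lemma append_zero_vec: "0\<^sub>v (n + n') = 0\<^sub>v n @\<^sub>v (0\<^sub>v n' :: 'a::zero vec)"
  by (intro eq_vecI) auto

lemma append_vec_cases: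
  assumes "x \<in> carrier_vec (n + n')"
  obtains v w where "v \<in> carrier_vec n" "w \<in> carrier_vec n'" "x = v @\<^sub>v w"
  using vec_first_last_append[OF assms] by (metis vec_first_carrier vec_last_carrier)

lemma additive_invariantI:
  fixes Z :: "'a::comm_ring_1 mat \<times> 'a mat \<Rightarrow> 'a vec set"
  assumes carrier: "\<And>P m n v. pair_dims P m n \<Longrightarrow> v \<in> Z P \<Longrightarrow> v \<in> carrier_vec n"
    and app: "\<And>P Q m n m' n' v w. pair_dims P m n \<Longrightarrow> pair_dims Q m' n' \<Longrightarrow> v \<in> carrier_vec n \<Longrightarrow>
      w \<in> carrier_vec n' \<Longrightarrow> v @\<^sub>v w \<in> Z (pair_dsum P Q) \<longleftrightarrow> v \<in> Z P \<and> w \<in> Z Q"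
  shows "additive_invariant Z"
  unfolding additive_invariant_def
proof (intro allI impI equalityI subsetI)
  fix P Q :: "'a mat \<times> 'a mat" and m n m' n' x
  assume d: "pair_dims P m n" "pair_dims Q m' n'" and x: "x \<in> Z (pair_dsum P Q)"
  have "x \<in> carrier_vec (n + n')" using carrier[OF pair_dims_dsum[OF d] x] .
  then obtain v w where vw: "v \<in> carrier_vec n" "w \<in> carrier_vec n'" "x = v @\<^sub>v w" by (rule append_vec_cases)
  then show "x \<in> {v @\<^sub>v w | v w. v \<in> Z P \<and> w \<in> Z Q}" using app[OF d vw(1,2)] x by blast
next
  fix P Q :: "'a mat \<times> 'a mat" and m n m' n' x
  assume d: "pair_dims P m n" "pair_dims Q m' n'" and "x \<in> {v @\<^sub>v w | v w. v \<in> Z P \<and> w \<in> Z Q}"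
  then obtain v w where vw: "x = v @\<^sub>v w" "v \<in> Z P" "w \<in> Z Q" by blast
  then show "x \<in> Z (pair_dsum P Q)" using app[OF d] carrier[OF d(1)] carrier[OF d(2)] by blast
qed

lemma additive_forward_kernel:
  "additive_invariant (forward_kernel i :: 'a::comm_ring_1 mat \<times> 'a mat \<Rightarrow> 'a vec set)"
proof (rule additive_invariantI)
  fix P Q :: "'a mat \<times> 'a mat" and m n m' n' and v w :: "'a vec"
  assume d: "pair_dims P m n" "pair_dims Q m' n'" and c: "v \<in> carrier_vec n" "w \<in> carrier_vec n'"
  show "v @\<^sub>v w \<in> forward_kernel i (pair_dsum P Q) \<longleftrightarrow> v \<in> forward_kernel i P \<and> w \<in> forward_kernel i Q"
    using pencil_chain_dsum[OF d zero_carrier_vec zero_carrier_vec c]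
    by (simp add: forward_kernel_def dim_col_fst_pair_dims[OF d(1)] dim_col_fst_pair_dims[OF d(2)]
        dim_col_fst_pair_dims[OF pair_dims_dsum[OF d]] append_zero_vec)
qed (use pencil_chain_carrier in \<open>auto simp: forward_kernel_def\<close>)

lemma additive_backward_kernel:
  "additive_invariant (backward_kernel i :: 'a::comm_ring_1 mat \<times> 'a mat \<Rightarrow> 'a vec set)"
proof (rule additive_invariantI)
  fix P Q :: "'a mat \<times> 'a mat" and m n m' n' and v w :: "'a vec"
  assume d: "pair_dims P m n" "pair_dims Q m' n'" and c: "v \<in> carrier_vec n" "w \<in> carrier_vec n'"
  show "v @\<^sub>v w \<in> backward_kernel i (pair_dsum P Q) \<longleftrightarrow> v \<in> backward_kernel i P \<and> w \<in> backward_kernel i Q"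
    using pencil_chain_dsum[OF d c zero_carrier_vec zero_carrier_vec]
    by (simp add: backward_kernel_def dim_col_fst_pair_dims[OF d(1)] dim_col_fst_pair_dims[OF d(2)]
        dim_col_fst_pair_dims[OF pair_dims_dsum[OF d]] append_zero_vec)
qed (use pencil_chain_carrier in \<open>auto simp: backward_kernel_def\<close>)

lemma additive_forward_range:
  "additive_invariant (forward_range i :: 'a::comm_ring_1 mat \<times> 'a mat \<Rightarrow> 'a vec set)"
proof (rule additive_invariantI)
  fix P Q :: "'a mat \<times> 'a mat" and m n m' n' and v w :: "'a vec"
  assume d: "pair_dims P m n" "pair_dims Q m' n'" and c: "v \<in> carrier_vec n" "w \<in> carrier_vec n'"
  show "v @\<^sub>v w \<in> forward_range i (pair_dsum P Q) \<longleftrightarrow> v \<in> forward_range i P \<and> w \<in> forward_range i Q"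
  proof
    assume "v @\<^sub>v w \<in> forward_range i (pair_dsum P Q)"
    then obtain x where x: "pencil_chain (pair_dsum P Q) i x (v @\<^sub>v w)" by (auto simp: forward_range_def)
    have "x \<in> carrier_vec (n + n')" using pencil_chain_carrier[OF x pair_dims_dsum[OF d]] by blast
    then obtain a b where "a \<in> carrier_vec n" "b \<in> carrier_vec n'" "x = a @\<^sub>v b" by (rule append_vec_cases)
    then show "v \<in> forward_range i P \<and> w \<in> forward_range i Q"
      using pencil_chain_dsum[OF d _ _ c] x unfolding forward_range_def by blast
  next
    assume "v \<in> forward_range i P \<and> w \<in> forward_range i Q"
    then obtain a b where ab: "pencil_chain P i a v" "pencil_chain Q i b w" by (auto simp: forward_range_def)
    have "a \<in> carrier_vec n" "b \<in> carrier_vec n'"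
      using pencil_chain_carrier(1)[OF ab(1) d(1)] pencil_chain_carrier(1)[OF ab(2) d(2)] by auto
    then show "v @\<^sub>v w \<in> forward_range i (pair_dsum P Q)"
      using pencil_chain_dsum[OF d _ _ c] ab unfolding forward_range_def by blast
  qed
qed (use pencil_chain_carrier in \<open>auto simp: forward_range_def\<close>)

text \<open>A vector splits in only one way into parts of given lengths, so membership in both sets
  can be tested on the same two parts.\<close>

lemma additive_invariant_Int:
  fixes Z Z' :: "'a::comm_ring_1 mat \<times> 'a mat \<Rightarrow> 'a vec set"
  assumes Z: "additive_invariant Z" "additive_invariant Z'"
    and carrier: "\<And>P m n v. pair_dims P m n \<Longrightarrow> v \<in> Z P \<Longrightarrow> v \<in> carrier_vec n"
      "\<And>P m n v. pair_dims P m n \<Longrightarrow> v \<in> Z' P \<Longrightarrow> v \<in> carrier_vec n"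
  shows "additive_invariant (\<lambda>P. Z P \<inter> Z' P)"
proof (rule additive_invariantI)
  fix P Q :: "'a mat \<times> 'a mat" and m n m' n' and v w :: "'a vec"
  assume d: "pair_dims P m n" "pair_dims Q m' n'" and c: "v \<in> carrier_vec n" "w \<in> carrier_vec n'"
  have "v @\<^sub>v w \<in> Y (pair_dsum P Q) \<longleftrightarrow> v \<in> Y P \<and> w \<in> Y Q"
    if "additive_invariant Y" and cY: "\<And>v. v \<in> Y P \<Longrightarrow> v \<in> carrier_vec n" for Y
  proof -
    have "Y (pair_dsum P Q) = {v @\<^sub>v w | v w. v \<in> Y P \<and> w \<in> Y Q}"
      using that(1) d unfolding additive_invariant_def by blast
    then show ?thesis using append_vec_eq[OF c(1)] cY by auto
  qed
  from this[OF Z(1)] this[OF Z(2)]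
  show "v @\<^sub>v w \<in> Z (pair_dsum P Q) \<inter> Z' (pair_dsum P Q) \<longleftrightarrow> v \<in> Z P \<inter> Z' P \<and> w \<in> Z Q \<inter> Z' Q"
    using carrier d by blast
qed (use carrier in blast)

lemma pair_dims_canon:
  assumes "D \<in> carrier_mat r r"
  shows "pair_dims (canon D bs) (r + sum_list (map block_rows bs)) (r + sum_list (map block_cols bs))"
proof (induction bs rule: rev_induct)
  case Nil then show ?case using assms by (auto simp: canon_Nil pair_dims_def)
next
  case (snoc b bs)
  then show ?case using pair_dims_dsum[OF snoc pair_dims_block[of b]] by (simp add: canon_snoc add.assoc)
qed

lemma coord_dim_canon:
  fixes D :: "'a::comm_ring_1 mat"
  assumes D: "D \<in> carrier_mat r r" and Z: "additive_invariant Z" and base: "coord_dim r (Z (1\<^sub>m r, D)) d"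
    and blocks: "\<forall>b\<in>set bs. coord_dim (block_cols b) (Z (block_pair b)) (z b)"
  shows "coord_dim (r + sum_list (map block_cols bs)) (Z (canon D bs)) (d + sum_list (map z bs))"
  using blocks
proof (induction bs rule: rev_induct)
  case Nil then show ?case using base D by (simp add: canon_Nil)
next
  case (snoc b bs)
  have "Z (canon D (bs @ [b])) = {v @\<^sub>v w | v w. v \<in> Z (canon D bs) \<and> w \<in> Z (block_pair b)}"
    using Z pair_dims_canon[OF D] pair_dims_block unfolding additive_invariant_def canon_snoc by blast
  then show ?case using snoc coord_dim_append[of _ "Z (canon D bs)"] by (simp flip: add.assoc)
qed

text \<open>The functions \<open>fk_dim\<close>, \<open>bk_dim\<close> and \<open>fr_dim\<close>
  belong to the three sets above, and \<open>ik_dim\<close> to the intersection of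
  \<open>forward_kernel 1\<close> with \<open>backward_kernel i\<close>. The intersection isolates
  \<open>LR\<close>: only there does a nonzero vector both come from 0 in one step and lead back to
  0, namely after \<open>k\<close> steps.\<close>

fun fk_dim bk_dim fr_dim ik_dim :: "nat \<Rightarrow> block \<Rightarrow> nat" where
  "fk_dim i (IJ k) = 0" | "fk_dim i (JI k) = min i k" | "fk_dim i (LR k) = min i k" | "fk_dim i (LRT k) = 0"
| "bk_dim i (IJ k) = min i k" | "bk_dim i (JI k) = 0" | "bk_dim i (LR k) = min i k" | "bk_dim i (LRT k) = 0"
| "fr_dim i (IJ k) = k - i" | "fr_dim i (JI k) = k" | "fr_dim i (LR k) = k" | "fr_dim i (LRT k) = k - 1 - i"
| "ik_dim i (IJ k) = 0" | "ik_dim i (JI k) = 0" | "ik_dim i (LR k) = (if k \<le> i then 1 else 0)" | "ik_dim i (LRT k) = 0"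

lemma coord_dimI: "S = coord_subspace n T \<Longrightarrow> T \<subseteq> {..<n} \<Longrightarrow> card T = d \<Longrightarrow> coord_dim n S d"
  by (auto simp: coord_dim_def)

lemma dim_col_block: "dim_col (fst (block_pair b :: 'a::{zero,one} mat \<times> 'a mat)) = block_cols b"
  using dim_col_fst_pair_dims[OF pair_dims_block] .

lemma chain_from_zero_block:
  fixes v :: "'a::comm_ring_1 vec"
  assumes "block_size b \<ge> 1"
  shows "v \<in> forward_kernel i (block_pair b) \<longleftrightarrow> v \<in> coord_subspace (block_cols b)
    (case b of IJ k \<Rightarrow> {} | JI k \<Rightarrow> {k - i..<k} | LR k \<Rightarrow> {k - i..<k} | LRT k \<Rightarrow> {})"
proof (cases b)
  case (JI k)
  show ?thesis
    unfolding forward_kernel_def mem_Collect_eq dim_col_block JI pencil_chain_JI pencil_chain_IJ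
    by (auto simp: coord_subspace_def) (metis add.commute add_diff_cancel_left' le_add1 less_diff_conv not_less)
qed (use assms in \<open>auto simp: forward_kernel_def dim_col_block pencil_chain_IJ pencil_chain_LR pencil_chain_LRT
    coord_subspace_def simp del: block_pair.simps\<close>)

lemma chain_to_zero_block:
  fixes v :: "'a::comm_ring_1 vec"
  assumes "block_size b \<ge> 1"
  shows "v \<in> backward_kernel i (block_pair b) \<longleftrightarrow> v \<in> coord_subspace (block_cols b)
    (case b of IJ k \<Rightarrow> {k - i..<k} | JI k \<Rightarrow> {} | LR k \<Rightarrow> {..<min i k} | LRT k \<Rightarrow> {})"
proof (cases b)
  case (IJ k)
  show ?thesis
    unfolding backward_kernel_def mem_Collect_eq dim_col_block IJ pencil_chain_IJ
    by (auto simp: coord_subspace_def) (metis add.commute add_diff_cancel_left' le_add1 less_diff_conv not_less)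
next
  case (JI k)
  show ?thesis
    unfolding backward_kernel_def mem_Collect_eq dim_col_block JI pencil_chain_JI pencil_chain_IJ
    by (auto simp: coord_subspace_def)
next
  case (LR k)
  show ?thesis
    unfolding backward_kernel_def mem_Collect_eq dim_col_block LR pencil_chain_LR
    by (auto simp: coord_subspace_def) (metis le_add_diff_inverse2 not_less)
next
  case (LRT k)
  have k: "k \<ge> 1" using assms LRT by simp
  show ?thesis
    unfolding backward_kernel_def mem_Collect_eq dim_col_block LRT pencil_chain_LRT[OF k]
    by (auto simp: coord_subspace_def) (metis add.commute add_diff_cancel_left' le_add1 less_diff_conv not_less)
qed

text \<open>Besides the explicit chain formulas this needs a start vector, obtained by moving
  \<open>v\<close> back by \<open>i\<close> places.\<close>

lemma chain_range_block:
  fixes v :: "'a::comm_ring_1 vec"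
  assumes "block_size b \<ge> 1"
  shows "v \<in> forward_range i (block_pair b) \<longleftrightarrow> v \<in> coord_subspace (block_cols b)
    (case b of IJ k \<Rightarrow> {i..<k} | JI k \<Rightarrow> {..<k} | LR k \<Rightarrow> {..<k} | LRT k \<Rightarrow> {i..<k - 1})" (is "_ \<longleftrightarrow> v \<in> ?S")
proof (cases b)
  case (IJ k)
  show ?thesis
  proof
    assume "v \<in> forward_range i (block_pair b)"
    then show "v \<in> ?S"
      unfolding forward_range_def mem_Collect_eq IJ pencil_chain_IJ by (auto simp: coord_subspace_def)
  next
    assume "v \<in> ?S"
    \<comment> \<open>For \<open>j + i \<ge> k\<close> the entry is whatever \<open>v\<close> yields
      outside its range; a chain of length \<open>i\<close> in \<open>IJ\<close> pushes these
      entries out.\<close>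
    then have "pencil_chain (block_pair (IJ k)) i (vec k (\<lambda>j. v $ (j + i))) v"
      unfolding pencil_chain_IJ by (auto simp: coord_subspace_def IJ)
    then show "v \<in> forward_range i (block_pair b)" unfolding forward_range_def IJ by blast
  qed
next
  case (JI k)
  have "pencil_chain (block_pair (JI k)) i (vec k (\<lambda>j. if j < i then 0 else v $ (j - i))) v" if "v \<in> carrier_vec k"
    unfolding pencil_chain_JI pencil_chain_IJ using that by auto
  moreover have "v \<in> carrier_vec k" if "pencil_chain (block_pair (JI k)) i u v" for u
    using pencil_chain_carrier(2)[OF that pair_dims_block] by simp
  ultimately show ?thesis unfolding forward_range_def JI by (auto simp: coord_subspace_def simp del: block_pair.simps)
next
  case (LR k)
  have "pencil_chain (block_pair (LR k)) i (vec k (\<lambda>j. if j < i then 0 else v $ (j - i))) v" if "v \<in> carrier_vec k"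
    unfolding pencil_chain_LR using that by auto
  moreover have "v \<in> carrier_vec k" if "pencil_chain (block_pair (LR k)) i u v" for u
    using pencil_chain_carrier(2)[OF that pair_dims_block] by simp
  ultimately show ?thesis unfolding forward_range_def LR by (auto simp: coord_subspace_def simp del: block_pair.simps)
next
  case (LRT k)
  have k: "k \<ge> 1" using assms LRT by simp
  show ?thesis
  proof
    assume "v \<in> forward_range i (block_pair b)"
    then show "v \<in> ?S"
      unfolding forward_range_def mem_Collect_eq LRT pencil_chain_LRT[OF k] by (auto simp: coord_subspace_def)
  next
    assume "v \<in> ?S"
    \<comment> \<open>Unlike in \<open>IJ\<close>, the padding must be 0: the last \<open>i\<close>
      entries of a start vector have to vanish.\<close>
    then have "pencil_chain (block_pair (LRT k)) i (vec (k - 1) (\<lambda>j. if j + i < k - 1 then v $ (j + i) else 0)) v"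
      unfolding pencil_chain_LRT[OF k] by (auto simp: coord_subspace_def LRT)
    then show "v \<in> forward_range i (block_pair b)" unfolding forward_range_def LRT by blast
  qed
qed

lemma coord_dim_block:
  assumes b: "block_size b \<ge> 1"
  shows "coord_dim (block_cols b) (forward_kernel i (block_pair b :: 'a::comm_ring_1 mat \<times> 'a mat)) (fk_dim i b)"
    and "coord_dim (block_cols b) (backward_kernel i (block_pair b :: 'a mat \<times> 'a mat)) (bk_dim i b)"
    and "coord_dim (block_cols b) (forward_range i (block_pair b :: 'a mat \<times> 'a mat)) (fr_dim i b)"
    and "coord_dim (block_cols b) (forward_kernel 1 (block_pair b :: 'a mat \<times> 'a mat) \<inter> backward_kernel i (block_pair b)) (ik_dim i b)"
proof -
  note e = chain_from_zero_block[OF b] chain_to_zero_block[OF b] chain_range_block[OF b]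
  show "coord_dim (block_cols b) (forward_kernel i (block_pair b :: 'a mat \<times> 'a mat)) (fk_dim i b)"
    by (rule coord_dimI[OF Set.set_eqI[OF e(1)]]) (auto split: block.split)
  show "coord_dim (block_cols b) (backward_kernel i (block_pair b :: 'a mat \<times> 'a mat)) (bk_dim i b)"
    by (rule coord_dimI[OF Set.set_eqI[OF e(2)]]) (auto split: block.split)
  show "coord_dim (block_cols b) (forward_range i (block_pair b :: 'a mat \<times> 'a mat)) (fr_dim i b)"
    by (rule coord_dimI[OF Set.set_eqI[OF e(3)]]) (auto split: block.split)
  have int: "coord_subspace n T \<inter> coord_subspace n T' = (coord_subspace n (T \<inter> T') :: 'a vec set)" for n T T'
    by (auto simp: coord_subspace_def)
  have lr: "card ({k - Suc 0..<k} \<inter> {..<k}) = Suc 0" if "Suc 0 \<le> k" for k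
  proof -
    have "{k - Suc 0..<k} \<inter> {..<k} = {k - Suc 0}" using that by auto
    then show ?thesis by simp
  qed
  show "coord_dim (block_cols b) (forward_kernel 1 (block_pair b :: 'a mat \<times> 'a mat) \<inter> backward_kernel i (block_pair b)) (ik_dim i b)"
    unfolding Set.set_eqI[OF e(1)] Set.set_eqI[OF e(2)] int
    by (rule coord_dimI[OF refl]) (use b lr in \<open>auto split: block.split\<close>)
qed

section \<open>Uniqueness\<close>

text \<open>There are two marked blocks because a second difference in \<open>block_mset_eq\<close>
  picks up two kinds of blocks at once.\<close>

lemma sum_list_add_counts:
  fixes f g :: "'b \<Rightarrow> nat"
  assumes "\<forall>b\<in>set bs. f b = g b + (if b = x then 1 else 0) + (if b = y then 1 else 0)"
  shows "sum_list (map f bs) = sum_list (map g bs) + count (mset bs) x + count (mset bs) y"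
  using assms by (induction bs) auto

lemma sum_list_combine:
  "sum_list (map f bs) + sum_list (map g bs) = sum_list (map (\<lambda>b. f b + g b :: nat) bs)"
  by (induction bs) auto

text \<open>The first difference of \<open>ik_dim\<close> in \<open>i\<close> counts the blocks
  \<open>LR\<close> of one size. The second differences of \<open>min i k\<close> and of
  \<open>k - i\<close> are concentrated at one size: \<open>fk_dim\<close> and \<open>bk_dim\<close>
  then give \<open>JI\<close> and \<open>IJ\<close> once \<open>LR\<close> is known, and
  \<open>fr_dim\<close> gives \<open>LRT\<close> of size at least 2 once \<open>IJ\<close> is known.
  \<open>LRT 1\<close> has no columns and is counted by rows.\<close>

lemma block_mset_eq:
  assumes sizes: "\<forall>b\<in>set bs. block_size b \<ge> 1" "\<forall>b\<in>set bs'. block_size b \<ge> 1"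
    and fk: "\<And>i. sum_list (map (fk_dim i) bs) = sum_list (map (fk_dim i) bs')"
    and bk: "\<And>i. sum_list (map (bk_dim i) bs) = sum_list (map (bk_dim i) bs')"
    and fr: "\<And>i. sum_list (map (fr_dim i) bs) = sum_list (map (fr_dim i) bs')"
    and ik: "\<And>i. sum_list (map (ik_dim i) bs) = sum_list (map (ik_dim i) bs')"
    and rows: "sum_list (map block_rows bs) = sum_list (map block_rows bs')"
  shows "mset bs = mset bs'"
proof -
  let ?c = "\<lambda>b. count (mset bs) b" and ?c' = "\<lambda>b. count (mset bs') b"
  have zero: "?c b = 0" "?c' b = 0" if "block_size b = 0" for b
    using sizes that by (auto simp: count_eq_zero_iff)
  have LR: "?c (LR (Suc j)) = ?c' (LR (Suc j))" for j
  proof -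
    \<comment> \<open>\<open>IJ 0\<close> merely fills the second slot of
      \<open>sum_list_add_counts\<close>; it does not occur in the lists, since sizes are
      positive.\<close>
    have "ik_dim (Suc j) b = ik_dim j b + (if b = LR (Suc j) then 1 else 0) + (if b = IJ 0 then 1 else 0)"
      if "block_size b \<ge> 1" for b using that by (cases b) auto
    then have "sum_list (map (ik_dim (Suc j)) cs) = sum_list (map (ik_dim j) cs) + count (mset cs) (LR (Suc j)) + count (mset cs) (IJ 0)"
      if "\<forall>b\<in>set cs. block_size b \<ge> 1" for cs using that by (intro sum_list_add_counts) blast
    from this[OF sizes(1)] this[OF sizes(2)] show ?thesis using ik[of j] ik[of "Suc j"] zero[of "IJ 0"] by simp
  qed
  have JI: "?c (JI (Suc j)) = ?c' (JI (Suc j))" for j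
  proof -
    \<comment> \<open>A second difference centred at \<open>Suc j\<close>, written additively to
      avoid truncated subtraction.\<close>
    have "fk_dim (Suc j) b + fk_dim (Suc j) b = (fk_dim j b + fk_dim (Suc (Suc j)) b) + (if b = JI (Suc j) then 1 else 0) + (if b = LR (Suc j) then 1 else 0)"
      for b by (cases b) auto
    then have "sum_list (map (\<lambda>b. fk_dim (Suc j) b + fk_dim (Suc j) b) cs) = sum_list (map (\<lambda>b. fk_dim j b + fk_dim (Suc (Suc j)) b) cs)
        + count (mset cs) (JI (Suc j)) + count (mset cs) (LR (Suc j))" for cs
      by (intro sum_list_add_counts) blast
    from this[of bs] this[of bs'] show ?thesis
      using fk[of j] fk[of "Suc j"] fk[of "Suc (Suc j)"] LR[of j] by (simp flip: sum_list_combine)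
  qed
  have IJ: "?c (IJ (Suc j)) = ?c' (IJ (Suc j))" for j
  proof -
    have "bk_dim (Suc j) b + bk_dim (Suc j) b = (bk_dim j b + bk_dim (Suc (Suc j)) b) + (if b = IJ (Suc j) then 1 else 0) + (if b = LR (Suc j) then 1 else 0)"
      for b by (cases b) auto
    then have "sum_list (map (\<lambda>b. bk_dim (Suc j) b + bk_dim (Suc j) b) cs) = sum_list (map (\<lambda>b. bk_dim j b + bk_dim (Suc (Suc j)) b) cs)
        + count (mset cs) (IJ (Suc j)) + count (mset cs) (LR (Suc j))" for cs
      by (intro sum_list_add_counts) blast
    from this[of bs] this[of bs'] show ?thesis
      using bk[of j] bk[of "Suc j"] bk[of "Suc (Suc j)"] LR[of j] by (simp flip: sum_list_combine)
  qed
  have LRT: "?c (LRT (Suc (Suc j))) = ?c' (LRT (Suc (Suc j)))" for j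
  proof -
    \<comment> \<open>\<open>LRT (Suc (Suc j))\<close> has \<open>Suc j\<close> columns, hence its
      index is one larger than that of \<open>IJ\<close>.\<close>
    have "fr_dim j b + fr_dim (Suc (Suc j)) b = (fr_dim (Suc j) b + fr_dim (Suc j) b) + (if b = IJ (Suc j) then 1 else 0) + (if b = LRT (Suc (Suc j)) then 1 else 0)"
      for b by (cases b) auto
    then have "sum_list (map (\<lambda>b. fr_dim j b + fr_dim (Suc (Suc j)) b) cs) = sum_list (map (\<lambda>b. fr_dim (Suc j) b + fr_dim (Suc j) b) cs)
        + count (mset cs) (IJ (Suc j)) + count (mset cs) (LRT (Suc (Suc j)))" for cs
      by (intro sum_list_add_counts) blast
    from this[of bs] this[of bs'] show ?thesis
      using fr[of j] fr[of "Suc j"] fr[of "Suc (Suc j)"] IJ[of j] by (simp flip: sum_list_combine)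
  qed
  have most: "?c b = ?c' b" if "b \<noteq> LRT 1" for b
  proof (cases "block_size b = 0")
    case False
    then show ?thesis using LR JI IJ LRT that
      by (cases b; metis Suc_pred block_size.simps bot_nat_0.not_eq_extremum One_nat_def)
  next
    case True
    then show ?thesis using zero by metis
  qed
  then have "filter_mset (\<lambda>b. b \<noteq> LRT 1) (mset bs) = filter_mset (\<lambda>b. b \<noteq> LRT 1) (mset bs')"
    by (intro multiset_eqI) simp
  moreover have "sum_list (map block_rows cs) = sum_mset (image_mset block_rows (filter_mset (\<lambda>b. b \<noteq> LRT 1) (mset cs))) + count (mset cs) (LRT 1)" for cs
    by (induction cs) auto
  ultimately have "?c (LRT 1) = ?c' (LRT 1)" using rows by simp
  with most have "?c b = ?c' b" for b by (cases "b = LRT 1") auto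
  then show ?thesis by (rule multiset_eqI)
qed

section \<open>The regular summand and the map induced on it\<close>

lemma mat_dsum_assoc: "mat_dsum (mat_dsum M N) K = mat_dsum M (mat_dsum N K)"
proof (rule eq_matI)
  fix i j assume "i < dim_row (mat_dsum M (mat_dsum N K))" "j < dim_col (mat_dsum M (mat_dsum N K))"
  then have "i < dim_row M + (dim_row N + dim_row K)" "j < dim_col M + (dim_col N + dim_col K)" by simp_all
  then have "i < dim_row M \<or> (\<exists>k<dim_row N. i = dim_row M + k) \<or> (\<exists>k<dim_row K. i = dim_row M + dim_row N + k)"
    "j < dim_col M \<or> (\<exists>k<dim_col N. j = dim_col M + k) \<or> (\<exists>k<dim_col K. j = dim_col M + dim_col N + k)"
    by presburger+
  then show "mat_dsum (mat_dsum M N) K $$ (i, j) = mat_dsum M (mat_dsum N K) $$ (i, j)"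
    by (elim disjE exE conjE) (simp_all add: index_mat_dsum)
qed simp_all

lemma mat_dsum_empty: "Z \<in> carrier_mat 0 0 \<Longrightarrow> mat_dsum M Z = M"
  by (rule eq_matI) (auto simp: index_mat_dsum)

text \<open>The matrix \<open>0\<^sub>m 0 0\<close> is an empty regular part, so the remaining
  blocks form a canonical form of their own and the results on \<open>canon\<close> apply to
  them.\<close>

lemma canon_split:
  "canon D bs = pair_dsum (1\<^sub>m (dim_row D), D) (canon (0\<^sub>m 0 0) bs)"
proof (induction bs rule: rev_induct)
  case Nil then show ?case by (simp add: canon_Nil pair_dsum_def mat_dsum_empty)
next
  case (snoc b bs) then show ?case by (simp add: canon_snoc pair_dsum_def mat_dsum_assoc)
qed

lemma mult_mat_zero_vec: "M \<in> carrier_mat m n \<Longrightarrow> M *\<^sub>v 0\<^sub>v n = (0\<^sub>v m :: 'a::comm_ring_1 vec)"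
  by (auto intro!: eq_vecI simp: scalar_prod_def)

lemma pencil_chain_zero:
  assumes "pair_dims P m n"
  shows "pencil_chain P i (0\<^sub>v n) (0\<^sub>v n :: 'a::comm_ring_1 vec)"
proof (induction i)
  case 0 then show ?case using assms by (auto simp: pair_dims_def)
next
  case (Suc i) then show ?case
    using assms mult_mat_zero_vec[of "fst P" m n] mult_mat_zero_vec[of "snd P" m n]
    by (auto simp: pair_dims_def intro!: exI[of _ "0\<^sub>v n"])
qed

text \<open>After \<open>N\<close> steps \<open>IJ\<close> and \<open>LRT\<close> reach only 0,
  while \<open>JI\<close> and \<open>LR\<close> reach every vector already from 0. Hence outside the
  regular part the start of a long chain may be replaced by 0 without changing its end.\<close>

lemma forward_range_eq_kernel:
  assumes "\<forall>b\<in>set bs. 1 \<le> block_size b \<and> block_size b \<le> N"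
  shows "forward_range N (canon (0\<^sub>m 0 0) bs) = (forward_kernel N (canon (0\<^sub>m 0 0) bs) :: 'a::comm_ring_1 vec set)"
  using assms
proof (induction bs rule: rev_induct)
  case Nil
  have d: "pair_dims (1\<^sub>m 0, 0\<^sub>m 0 0 :: 'a mat) 0 0" by (simp add: pair_dims_def)
  have "u = 0\<^sub>v 0" if "pencil_chain (1\<^sub>m 0, 0\<^sub>m 0 0 :: 'a mat) N u v" for u v
    using pencil_chain_carrier(1)[OF that d] by auto
  then show ?case by (auto simp: canon_Nil forward_range_def forward_kernel_def)
next
  case (snoc b bs)
  have "forward_range N (block_pair b) = (forward_kernel N (block_pair b) :: 'a vec set)"
  proof (rule Set.set_eqI)
    fix v :: "'a vec"
    have b: "1 \<le> block_size b" "block_size b \<le> N" using snoc.prems by auto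
    have "(case b of IJ k \<Rightarrow> {N..<k} | JI k \<Rightarrow> {..<k} | LR k \<Rightarrow> {..<k} | LRT k \<Rightarrow> {N..<k - 1}) =
      (case b of IJ k \<Rightarrow> {} | JI k \<Rightarrow> {k - N..<k} | LR k \<Rightarrow> {k - N..<k} | LRT k \<Rightarrow> {})"
      using b by (auto split: block.split)
    then show "v \<in> forward_range N (block_pair b) \<longleftrightarrow> v \<in> forward_kernel N (block_pair b)"
      by (simp only: chain_range_block[OF b(1)] chain_from_zero_block[OF b(1)])
  qed
  moreover have dec: "Z (canon (0\<^sub>m 0 0) (bs @ [b])) = {v @\<^sub>v w | v w. v \<in> Z (canon (0\<^sub>m 0 0) bs) \<and> w \<in> Z (block_pair b)}"
    if "additive_invariant Z" for Z :: "'a mat \<times> 'a mat \<Rightarrow> 'a vec set"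
    using that pair_dims_canon[OF zero_carrier_mat[of 0 0], of bs] pair_dims_block[of b]
    unfolding additive_invariant_def canon_snoc by blast
  ultimately show ?case
    using snoc by (simp add: dec[OF additive_forward_range] dec[OF additive_forward_kernel])
qed

lemma canon_ok_inverse:
  fixes D :: "'a::field mat"
  assumes "canon_ok D bs"
  obtains E where "E \<in> carrier_mat (dim_row D) (dim_row D)" "D * E = 1\<^sub>m (dim_row D)" "E * D = 1\<^sub>m (dim_row D)"
proof -
  have "D \<in> carrier_mat (dim_row D) (dim_row D)" "det D \<noteq> 0" using assms by (auto simp: canon_ok_def)
  from det_non_zero_imp_unit[OF this, where b = "()"] show ?thesis
    using that by (auto simp: Units_def ring_mat_simps)
qed

lemma vcont_vec_first: "r \<le> n \<Longrightarrow> vcont n (\<lambda>v :: 'a::real_normed_field vec. vec_first v r)"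
  by (rule vcont_sequentiallyI[where n' = r]) (auto simp: vec_first_def)

lemma vcont_append_zero: "vcont r (\<lambda>v :: 'a::real_normed_field vec. v @\<^sub>v 0\<^sub>v q)"
proof (rule vcont_sequentiallyI[where n' = "r + q"])
  fix x :: "'a vec" and y :: "nat \<Rightarrow> 'a vec" and j
  assume *: "x \<in> carrier_vec r" "\<And>k. y k \<in> carrier_vec r" "\<And>i. i < r \<Longrightarrow> (\<lambda>k. y k $ i) \<longlonglongrightarrow> x $ i" "j < r + q"
  have lim: "(\<lambda>k. if j < r then y k $ j else 0) \<longlonglongrightarrow> (if j < r then x $ j else 0)"
    using *(3) by (cases "j < r") auto
  have e: "(v @\<^sub>v 0\<^sub>v q) $ j = (if j < r then v $ j else 0)" if "v \<in> carrier_vec r" for v :: "'a vec"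
    using that *(4) by auto
  show "(\<lambda>k. (y k @\<^sub>v 0\<^sub>v q) $ j) \<longlonglongrightarrow> (x @\<^sub>v 0\<^sub>v q) $ j"
    unfolding e[OF *(1)] e[OF *(2)] by (rule lim)
qed auto

lemma vec_first_append: "v \<in> carrier_vec r \<Longrightarrow> vec_first (v @\<^sub>v w) r = v"
  by (auto simp: vec_first_def intro!: eq_vecI)

text \<open>After \<open>N\<close> steps, with \<open>N\<close> at least every block size, a chain starting at \<open>q\<close> forgets
  everything but the regular component of \<open>q\<close>; hence \<open>\<phi>\<close> descends to the regular components.\<close>
lemma regular_component_retract:
  fixes P P' :: "'a::real_normed_field mat \<times> 'a mat"
  assumes ok: "canon_ok D bs" "canon_ok D' bs'"
    and P: "P = canon D bs" "P' = canon D' bs'" "r = dim_row D" "r' = dim_row D'"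
    and q: "q = sum_list (map block_cols bs)" "q' = sum_list (map block_cols bs')"
    and h: "pencil_homeo P P' (r + q) (r' + q') \<phi> g"
    and y: "y \<in> carrier_vec r'"
  shows "vec_first (\<phi> (vec_first (g (y @\<^sub>v 0\<^sub>v q')) r @\<^sub>v 0\<^sub>v q)) r' = y"
proof -
  define Q Q' where "Q = canon (0\<^sub>m 0 0 :: 'a mat) bs" and "Q' = canon (0\<^sub>m 0 0 :: 'a mat) bs'"
  have D: "D \<in> carrier_mat r r" "D' \<in> carrier_mat r' r'" using ok P by (auto simp: canon_ok_def)
  obtain E where E: "E \<in> carrier_mat r r" "D * E = 1\<^sub>m r" "E * D = 1\<^sub>m r" using canon_ok_inverse[OF ok(1)] P by metis
  obtain E' where E': "E' \<in> carrier_mat r' r'" "D' * E' = 1\<^sub>m r'" "E' * D' = 1\<^sub>m r'" using canon_ok_inverse[OF ok(2)] P by metis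
  have s: "P = pair_dsum (1\<^sub>m r, D) Q" "P' = pair_dsum (1\<^sub>m r', D') Q'"
    unfolding P Q_def Q'_def by (rule canon_split)+
  have dR: "pair_dims (1\<^sub>m r, D) r r" "pair_dims (1\<^sub>m r', D') r' r'" using D by (auto simp: pair_dims_def)
  have dQ: "pair_dims Q (sum_list (map block_rows bs)) q" "pair_dims Q' (sum_list (map block_rows bs')) q'"
    using pair_dims_canon[OF zero_carrier_mat[of 0 0]] by (auto simp: Q_def Q'_def q)
  note dP = pair_dims_dsum[OF dR(1) dQ(1), folded s] pair_dims_dsum[OF dR(2) dQ(2), folded s]
  note split = pencil_chain_dsum[OF dR(1) dQ(1), folded s] 
  note split' = pencil_chain_dsum[OF dR(2) dQ(2), folded s]
  define N where "N = sum_list (map block_size bs)"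
  have N: "\<forall>b\<in>set bs. 1 \<le> block_size b \<and> block_size b \<le> N"
    using ok(1) member_le_sum_list[of _ "map block_size bs"] by (auto simp: canon_ok_def N_def)
  let ?y = "y @\<^sub>v 0\<^sub>v q'"
  have yc: "?y \<in> carrier_vec (r' + q')" using y by simp
  obtain u where u: "pencil_chain (1\<^sub>m r', D') N u y" using pencil_chain_regular(3)[OF D(2) E' y] by blast
  have "u \<in> carrier_vec r'" using pencil_chain_carrier(1)[OF u dR(2)] .
  then have "pencil_chain P' N (u @\<^sub>v 0\<^sub>v q') ?y" using split' u y pencil_chain_zero[OF dQ(2)] by simp
  then have c1: "pencil_chain P N (g (u @\<^sub>v 0\<^sub>v q')) (g ?y)"
    by (rule pencil_homeo_chain[OF pencil_homeo_sym[OF h] dP(2,1)])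
  have "g ?y \<in> carrier_vec (r + q)" using h yc unfolding pencil_homeo_def by blast
  then obtain x e where xe: "x \<in> carrier_vec r" "e \<in> carrier_vec q" "g ?y = x @\<^sub>v e" by (rule append_vec_cases)
  have "g (u @\<^sub>v 0\<^sub>v q') \<in> carrier_vec (r + q)" using pencil_chain_carrier(1)[OF c1 dP(1)] .
  then obtain x' e' where xe': "x' \<in> carrier_vec r" "e' \<in> carrier_vec q" "g (u @\<^sub>v 0\<^sub>v q') = x' @\<^sub>v e'" by (rule append_vec_cases)
  have "pencil_chain Q N e' e" using c1 split[OF xe'(1,2) xe(1,2)] xe(3) xe'(3) by simp
  then have "e \<in> forward_range N Q" by (auto simp: forward_range_def)
  then have e0: "pencil_chain Q N (0\<^sub>v q) e"
    using forward_range_eq_kernel[OF N] dim_col_fst_pair_dims[OF dQ(1)] by (auto simp: Q_def forward_kernel_def)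
  obtain z where z: "pencil_chain (1\<^sub>m r, D) N z x" using pencil_chain_regular(3)[OF D(1) E xe(1)] by blast
  have zc: "z \<in> carrier_vec r" using pencil_chain_carrier(1)[OF z dR(1)] .
  \<comment> \<open>One start, \<open>z\<close> padded with zeros, reaches both \<open>x\<close>
    padded with zeros and \<open>x\<close> followed by \<open>e\<close>. After transport by
    \<open>\<phi>\<close> the two ends share their regular component, because in the regular part
    the start determines the end.\<close>
  have "pencil_chain P N (z @\<^sub>v 0\<^sub>v q) (x @\<^sub>v 0\<^sub>v q)" "pencil_chain P N (z @\<^sub>v 0\<^sub>v q) (x @\<^sub>v e)"
    using split[OF zc _ xe(1)] z e0 xe pencil_chain_zero[OF dQ(1)] by auto
  then have c2: "pencil_chain P' N (\<phi> (z @\<^sub>v 0\<^sub>v q)) (\<phi> (x @\<^sub>v 0\<^sub>v q))" "pencil_chain P' N (\<phi> (z @\<^sub>v 0\<^sub>v q)) (\<phi> (x @\<^sub>v e))"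
    using pencil_homeo_chain[OF h dP] by blast+
  obtain a b where ab: "a \<in> carrier_vec r'" "b \<in> carrier_vec q'" "\<phi> (z @\<^sub>v 0\<^sub>v q) = a @\<^sub>v b"
    using pencil_chain_carrier(1)[OF c2(1) dP(2)] by (rule append_vec_cases)
  obtain c d where cd: "c \<in> carrier_vec r'" "d \<in> carrier_vec q'" "\<phi> (x @\<^sub>v 0\<^sub>v q) = c @\<^sub>v d"
    using pencil_chain_carrier(2)[OF c2(1) dP(2)] by (rule append_vec_cases)
  have "\<phi> (x @\<^sub>v e) = ?y" using h yc xe(3) unfolding pencil_homeo_def by metis
  then have "pencil_chain (1\<^sub>m r', D') N a c" "pencil_chain (1\<^sub>m r', D') N a y"
    using c2 split'[OF ab(1,2)] ab cd y by auto
  then have "c = y" using pencil_chain_regular(4)[OF D(2) E'] by blast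
  then show ?thesis using cd xe by (simp add: vec_first_append)
qed

text \<open>The regular components of \<open>\<phi>\<close> and \<open>g\<close> on vectors padded
  with zeros are mutually inverse by \<open>regular_component_retract\<close>, used in both
  directions. They intertwine \<open>D\<close> and \<open>D'\<close> because \<open>D x\<close>
  follows \<open>x\<close> in a chain of length 1.\<close>

lemma pencil_homeo_canon_top_similar:
  fixes D D' :: "'a::real_normed_field mat"
  assumes ok: "canon_ok D bs" "canon_ok D' bs'"
    and q: "q = sum_list (map block_cols bs)" "q' = sum_list (map block_cols bs')"
    and h: "pencil_homeo (canon D bs) (canon D' bs') (dim_row D + q) (dim_row D' + q') \<phi> g"
  shows "top_similar D D'"
proof -
  let ?r = "dim_row D" and ?r' = "dim_row D'"
  define f where "f x = vec_first (\<phi> (x @\<^sub>v 0\<^sub>v q)) ?r'" for x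
  define k where "k y = vec_first (g (y @\<^sub>v 0\<^sub>v q')) ?r" for y
  have fk: "f (k y) = y" if "y \<in> carrier_vec ?r'" for y
    unfolding f_def k_def using regular_component_retract[OF ok refl refl refl refl q h that] .
  have kf: "k (f x) = x" if "x \<in> carrier_vec ?r" for x
    unfolding f_def k_def
    using regular_component_retract[OF ok(2,1) refl refl refl refl q(2,1) pencil_homeo_sym[OF h] that] .
  have c: "\<phi> v \<in> carrier_vec (?r' + q')" if "v \<in> carrier_vec (?r + q)" for v using h that unfolding pencil_homeo_def by blast
  have c': "g v \<in> carrier_vec (?r + q)" if "v \<in> carrier_vec (?r' + q')" for v using h that unfolding pencil_homeo_def by blast
  have vc: "vcont (?r + q) \<phi>" "vcont (?r' + q') g" using h unfolding pencil_homeo_def by blast+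
  have "vcont ?r f" unfolding f_def
    by (rule vcont_comp[OF vcont_comp[OF vcont_append_zero vc(1)] vcont_vec_first[OF le_add1[of ?r' q']]]) (use c in auto)
  moreover have "vcont ?r' k" unfolding k_def
    by (rule vcont_comp[OF vcont_comp[OF vcont_append_zero vc(2)] vcont_vec_first[OF le_add1[of ?r q]]]) (use c' in auto)
  moreover have "f x \<in> carrier_vec ?r'" "k x \<in> carrier_vec ?r" for x by (simp_all add: f_def k_def)
  ultimately have "vec_homeo ?r ?r' f"
    unfolding vec_homeo_def using fk kf by (intro exI[of _ k]) auto
  moreover have "f (D *\<^sub>v x) = D' *\<^sub>v f x" if x: "x \<in> carrier_vec ?r" for x
  proof -
    define Q Q' where "Q = canon (0\<^sub>m 0 0 :: 'a mat) bs" and "Q' = canon (0\<^sub>m 0 0 :: 'a mat) bs'"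
    have D: "D \<in> carrier_mat ?r ?r" "D' \<in> carrier_mat ?r' ?r'" using ok by (auto simp: canon_ok_def)
    have s: "canon D bs = pair_dsum (1\<^sub>m ?r, D) Q" "canon D' bs' = pair_dsum (1\<^sub>m ?r', D') Q'"
      unfolding Q_def Q'_def by (rule canon_split)+
    have dR: "pair_dims (1\<^sub>m ?r, D) ?r ?r" "pair_dims (1\<^sub>m ?r', D') ?r' ?r'"
      unfolding pair_dims_def fst_conv snd_conv using D one_carrier_mat by blast+
    have dQ: "pair_dims Q (sum_list (map block_rows bs)) q" "pair_dims Q' (sum_list (map block_rows bs')) q'"
      using pair_dims_canon[OF zero_carrier_mat[of 0 0]] by (auto simp: Q_def Q'_def q)
    note dP = pair_dims_dsum[OF dR(1) dQ(1), folded s] pair_dims_dsum[OF dR(2) dQ(2), folded s]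
    have Dx: "D *\<^sub>v x \<in> carrier_vec ?r" using mult_mat_vec_carrier[OF D(1) x] .
    have "pencil_chain (1\<^sub>m ?r, D) 1 x (D *\<^sub>v x)" using x Dx by simp
    then have "pencil_chain (canon D bs) 1 (x @\<^sub>v 0\<^sub>v q) ((D *\<^sub>v x) @\<^sub>v 0\<^sub>v q)"
      using pencil_chain_dsum[OF dR(1) dQ(1) x zero_carrier_vec Dx zero_carrier_vec, folded s] pencil_chain_zero[OF dQ(1)]
      by blast
    then have c1: "pencil_chain (canon D' bs') 1 (\<phi> (x @\<^sub>v 0\<^sub>v q)) (\<phi> ((D *\<^sub>v x) @\<^sub>v 0\<^sub>v q))"
      by (rule pencil_homeo_chain[OF h dP])
    obtain a b where ab: "a \<in> carrier_vec ?r'" "b \<in> carrier_vec q'" "\<phi> (x @\<^sub>v 0\<^sub>v q) = a @\<^sub>v b"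
      using pencil_chain_carrier(1)[OF c1 dP(2)] by (rule append_vec_cases)
    obtain c d where cd: "c \<in> carrier_vec ?r'" "d \<in> carrier_vec q'" "\<phi> ((D *\<^sub>v x) @\<^sub>v 0\<^sub>v q) = c @\<^sub>v d"
      using pencil_chain_carrier(2)[OF c1 dP(2)] by (rule append_vec_cases)
    have "pencil_chain (1\<^sub>m ?r', D') 1 a c"
      using c1 pencil_chain_dsum[OF dR(2) dQ(2) ab(1,2) cd(1,2), folded s] unfolding ab(3) cd(3) by blast
    then have "c = D' *\<^sub>v a" by auto
    then show ?thesis using ab cd by (simp add: f_def vec_first_append)
  qed
  ultimately show ?thesis unfolding top_similar_def by blast
qed

lemma kernel_carrier:
  assumes "pair_dims P m n"
  shows "v \<in> forward_kernel i P \<Longrightarrow> v \<in> carrier_vec n" "v \<in> backward_kernel i P \<Longrightarrow> v \<in> carrier_vec n"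
  unfolding forward_kernel_def backward_kernel_def mem_Collect_eq
  using pencil_chain_carrier[OF _ assms] by blast+

theorem canon_unique:
  fixes D D' :: "'a::real_normed_field mat"
  assumes F: "is_R_or_C TYPE('a)" and ok: "canon_ok D bs" "canon_ok D' bs'"
    and h: "pencil_homeo (canon D bs) (canon D' bs') (dim_row D + sum_list (map block_cols bs))
      (dim_row D' + sum_list (map block_cols bs')) \<phi> g"
    and rows: "dim_row D + sum_list (map block_rows bs) = dim_row D' + sum_list (map block_rows bs')"
  shows "dim_row D = dim_row D'" "top_similar D D'" "mset bs = mset bs'"
proof -
  let ?r = "dim_row D" and ?r' = "dim_row D'"
  let ?q = "sum_list (map block_cols bs)" and ?q' = "sum_list (map block_cols bs')"
  have D: "D \<in> carrier_mat ?r ?r" "D' \<in> carrier_mat ?r' ?r'" using ok by (auto simp: canon_ok_def)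
  have sz: "\<forall>b\<in>set bs. block_size b \<ge> 1" "\<forall>b\<in>set bs'. block_size b \<ge> 1" using ok by (auto simp: canon_ok_def)
  note d = pair_dims_canon[OF D(1), of bs] pair_dims_canon[OF D(2), of bs']
  note h' = pencil_homeo_sym[OF h]
  show ts: "top_similar D D'" by (rule pencil_homeo_canon_top_similar[OF ok refl refl h])
  then show r: "?r = ?r'" unfolding top_similar_def using vec_homeo_imp_eq_dim[OF F] by blast
  \<comment> \<open>Common scheme for the four invariants: \<open>\<phi>\<close> and
    \<open>g\<close> match the two coordinate subspaces, whose dimensions are sums over the
    summands.\<close>
  have inv: "x + sum_list (map z bs) = x' + sum_list (map z bs')"
    if Z: "additive_invariant Z" and x: "coord_dim ?r (Z (1\<^sub>m ?r, D)) x" "coord_dim ?r' (Z (1\<^sub>m ?r', D')) x'"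
      and z: "\<And>b. block_size b \<ge> 1 \<Longrightarrow> coord_dim (block_cols b) (Z (block_pair b)) (z b)"
      and im: "\<And>v. v \<in> Z (canon D bs) \<Longrightarrow> \<phi> v \<in> Z (canon D' bs')" "\<And>v. v \<in> Z (canon D' bs') \<Longrightarrow> g v \<in> Z (canon D bs)"
    for Z x x' z
    using coord_dim_unique[OF F h coord_dim_canon[OF D(1) Z x(1)] coord_dim_canon[OF D(2) Z x(2)] im] z sz by blast
  have z0: "\<phi> (0\<^sub>v (?r + ?q)) = 0\<^sub>v (?r' + ?q')" "g (0\<^sub>v (?r' + ?q')) = 0\<^sub>v (?r + ?q)"
    using h h' unfolding pencil_homeo_def by blast+
  note dc = dim_col_fst_pair_dims[OF d(1)] dim_col_fst_pair_dims[OF d(2)]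
  note ch = pencil_homeo_chain[OF h d] pencil_homeo_chain[OF h' d(2,1)]
  have fkm: "\<phi> v \<in> forward_kernel i (canon D' bs')" if "v \<in> forward_kernel i (canon D bs)" for i v
    using that ch(1)[of i "0\<^sub>v (?r + ?q)" v] z0 by (simp add: forward_kernel_def dc)
  have fkm': "g v \<in> forward_kernel i (canon D bs)" if "v \<in> forward_kernel i (canon D' bs')" for i v
    using that ch(2)[of i "0\<^sub>v (?r' + ?q')" v] z0 by (simp add: forward_kernel_def dc)
  have bkm: "\<phi> v \<in> backward_kernel i (canon D' bs')" if "v \<in> backward_kernel i (canon D bs)" for i v
    using that ch(1)[of i v "0\<^sub>v (?r + ?q)"] z0 by (simp add: backward_kernel_def dc)
  have bkm': "g v \<in> backward_kernel i (canon D bs)" if "v \<in> backward_kernel i (canon D' bs')" for i v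
    using that ch(2)[of i v "0\<^sub>v (?r' + ?q')"] z0 by (simp add: backward_kernel_def dc)
  have frm: "\<phi> v \<in> forward_range i (canon D' bs')" if "v \<in> forward_range i (canon D bs)" for i v
    using that ch(1) unfolding forward_range_def by blast
  have frm': "g v \<in> forward_range i (canon D bs)" if "v \<in> forward_range i (canon D' bs')" for i v
    using that ch(2) unfolding forward_range_def by blast
  \<comment> \<open>The regular part contributes only to the range, namely its full size, and the
    sizes on both sides already agree.\<close>
  have reg: "coord_dim (dim_row G) (forward_kernel i (1\<^sub>m (dim_row G), G)) 0"
    "coord_dim (dim_row G) (backward_kernel i (1\<^sub>m (dim_row G), G)) 0"
    "coord_dim (dim_row G) (forward_range i (1\<^sub>m (dim_row G), G)) (dim_row G)"
    "coord_dim (dim_row G) (forward_kernel 1 (1\<^sub>m (dim_row G), G) \<inter> backward_kernel i (1\<^sub>m (dim_row G), G)) 0"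
    if okG: "canon_ok G cs" for G :: "'a mat" and cs i
  proof -
    let ?n = "dim_row G"
    have G: "G \<in> carrier_mat ?n ?n" using okG by (auto simp: canon_ok_def)
    obtain E where E: "E \<in> carrier_mat ?n ?n" "G * E = 1\<^sub>m ?n" "E * G = 1\<^sub>m ?n" using canon_ok_inverse[OF okG] by metis
    have zero: "coord_subspace ?n {} = {0\<^sub>v ?n :: 'a vec}" by (auto simp: coord_subspace_def intro!: eq_vecI)
    have fk: "forward_kernel i (1\<^sub>m ?n, G) = coord_subspace ?n {}" for i
      using pencil_chain_regular(1)[OF G E] by (auto simp: forward_kernel_def zero)
    have bk: "backward_kernel i (1\<^sub>m ?n, G) = coord_subspace ?n {}"
      using pencil_chain_regular(2)[OF G E] by (auto simp: backward_kernel_def zero)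
    have "pair_dims (1\<^sub>m ?n, G) ?n ?n"
      unfolding pair_dims_def fst_conv snd_conv using G one_carrier_mat by blast
    then have fr: "forward_range i (1\<^sub>m ?n, G) = coord_subspace ?n {..<?n}"
      using pencil_chain_regular(3)[OF G E] pencil_chain_carrier(2) unfolding forward_range_def coord_subspace_def by fastforce
    show "coord_dim ?n (forward_kernel i (1\<^sub>m ?n, G)) 0" by (rule coord_dimI[OF fk]) auto
    show "coord_dim ?n (backward_kernel i (1\<^sub>m ?n, G)) 0" by (rule coord_dimI[OF bk]) auto
    show "coord_dim ?n (forward_range i (1\<^sub>m ?n, G)) ?n" by (rule coord_dimI[OF fr]) auto
    show "coord_dim ?n (forward_kernel 1 (1\<^sub>m ?n, G) \<inter> backward_kernel i (1\<^sub>m ?n, G)) 0"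
      unfolding fk bk by (rule coord_dimI[of _ _ "{}"]) auto
  qed
  have additive4: "additive_invariant (\<lambda>P :: 'a mat \<times> 'a mat. forward_kernel 1 P \<inter> backward_kernel i P)" for i
    by (rule additive_invariant_Int[OF additive_forward_kernel additive_backward_kernel kernel_carrier])
  show "mset bs = mset bs'"
  proof (rule block_mset_eq[OF sz])
    fix i
    show "sum_list (map (fk_dim i) bs) = sum_list (map (fk_dim i) bs')"
      using inv[OF additive_forward_kernel reg(1)[OF ok(1)] reg(1)[OF ok(2)] coord_dim_block(1) fkm fkm', of i] by simp
    show "sum_list (map (bk_dim i) bs) = sum_list (map (bk_dim i) bs')"
      using inv[OF additive_backward_kernel reg(2)[OF ok(1)] reg(2)[OF ok(2)] coord_dim_block(2) bkm bkm', of i] by simp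
    show "sum_list (map (fr_dim i) bs) = sum_list (map (fr_dim i) bs')"
      using inv[OF additive_forward_range reg(3)[OF ok(1)] reg(3)[OF ok(2)] coord_dim_block(3) frm frm', of i] r by simp
    have "0 + sum_list (map (ik_dim i) bs) = 0 + sum_list (map (ik_dim i) bs')"
      by (rule inv[OF additive4 reg(4)[OF ok(1)] reg(4)[OF ok(2)] coord_dim_block(4)])
        (use fkm fkm' bkm bkm' in blast)+
    then show "sum_list (map (ik_dim i) bs) = sum_list (map (ik_dim i) bs')" by simp
  qed (use rows r in simp)
qed

lemma top_equiv_rows:
  fixes P Q :: "'a::real_normed_field mat \<times> 'a mat"
  assumes F: "is_R_or_C TYPE('a)" and P: "pair_dims P m n" and Q: "pair_dims Q m' n'" and e: "top_equiv P Q"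
  shows "m = m'"
proof -
  obtain \<psi> :: "'a vec \<Rightarrow> 'a vec" where "vec_homeo (dim_row (fst P)) (dim_row (fst Q)) \<psi>"
    using e unfolding top_equiv_def case_prod_beta by blast
  then show ?thesis using vec_homeo_imp_eq_dim[OF F] P Q unfolding pair_dims_def by (metis carrier_matD(1))
qed

theorem theorem1:
  fixes m n :: nat and A B :: "'a::real_normed_field mat"
  assumes "is_R_or_C TYPE('a)"
    and "A \<in> carrier_mat m n" and "B \<in> carrier_mat m n"
  shows "(\<exists>D bs. canon_ok D bs \<and> top_equiv (A, B) (canon D bs))
    \<and> (\<forall>D bs D' bs'. canon_ok D bs \<and> canon_ok D' bs' \<and>
          top_equiv (A, B) (canon D bs) \<and> top_equiv (A, B) (canon D' bs') \<longrightarrow>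
          dim_row D = dim_row D' \<and> top_similar D D' \<and> length bs = length bs' \<and>
          mset (map block_pair bs :: ('a mat \<times> 'a mat) list) = mset (map block_pair bs'))"
proof (intro conjI allI impI)
  show "\<exists>D bs. canon_ok D bs \<and> top_equiv (A, B) (canon D bs)"
    using top_equiv_canon_exists[OF assms(2,3)] .
next
  fix D bs D' bs'
  assume *: "canon_ok D bs \<and> canon_ok D' bs' \<and> top_equiv (A, B) (canon D bs) \<and> top_equiv (A, B) (canon D' bs')"
  have D: "D \<in> carrier_mat (dim_row D) (dim_row D)" "D' \<in> carrier_mat (dim_row D') (dim_row D')"
    using * by (auto simp: canon_ok_def)
  have AB: "pair_dims (A, B) m n" using assms by (simp add: pair_dims_def)
  note d = pair_dims_canon[OF D(1), of bs] pair_dims_canon[OF D(2), of bs']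
  obtain \<phi> g \<phi>' g' where h: "pencil_homeo (A, B) (canon D bs) n (dim_row D + sum_list (map block_cols bs)) \<phi> g"
    "pencil_homeo (A, B) (canon D' bs') n (dim_row D' + sum_list (map block_cols bs')) \<phi>' g'"
    using top_equiv_imp_pencil_homeo[OF AB d(1)] top_equiv_imp_pencil_homeo[OF AB d(2)] * by metis
  have "m = dim_row D + sum_list (map block_rows bs)" "m = dim_row D' + sum_list (map block_rows bs')"
    using top_equiv_rows[OF assms(1) AB d(1)] top_equiv_rows[OF assms(1) AB d(2)] * by blast+
  \<comment> \<open>Going back along the first equivalence and on along the second compares the
    canonical forms directly. The block labels themselves agree as multisets, which implies the
    claim about the matrix pairs.\<close>
  then have u: "dim_row D = dim_row D'" "top_similar D D'" "mset bs = mset bs'"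
    using canon_unique[OF assms(1) _ _ pencil_homeo_comp[OF pencil_homeo_sym[OF h(1)] h(2)]] * by auto
  show "dim_row D = dim_row D'" "top_similar D D'" by (fact u)+
  show "length bs = length bs'" using u(3) by (rule mset_eq_length)
  show "mset (map block_pair bs :: ('a mat \<times> 'a mat) list) = mset (map block_pair bs')"
    using u(3) by (metis mset_map)
qed

end
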